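(* Let $m\geq 1$ be an integer, let $k\geq 2\cdot 3^{m+1}+2$, and let $\gamma_m = 2^{1-m}$. Let $A\subseteq \{1,2,\dots, N\}$ be a set which contains no non-trivial solutions to the equation \[x_1+x_2+\cdots + x_{k-1} = (k-1)x_k,\] where a solution $(x_1,\dots,x_k)\in A^k$ is trivial if all variables are equal. Then \[|A|\leq \exp\bigl(-c\log^{1/(6+\gamma_m)} N\bigr)N,\] where $c>0$ is a constant independent of $N$ and $A$.
   Formalization: The bound is stated for all sufficiently large N (N at least some threshold not depending on A), because for N = 2 the set A = {1,2} has only trivial solutions and violates the bound for every c > 0. *)

theory Defs
  imports Complex_Main
begin

definition is_solution :: "nat \<Rightarrow> nat set \<Rightarrow> (nat \<Rightarrow> nat) \<Rightarrow> bool" where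
  "is_solution k A x \<longleftrightarrow> (\<forall>i\<in>{1..k}. x i \<in> A) \<and>
     (\<Sum>i=1..k-1. x i) = (k - 1) * x k"

definition trivial_solution :: "nat \<Rightarrow> (nat \<Rightarrow> nat) \<Rightarrow> bool" where
  "trivial_solution k x \<longleftrightarrow> (\<forall>i\<in>{1..k}. \<forall>j\<in>{1..k}. x i = x j)"

definition no_nontrivial_solutions :: "nat \<Rightarrow> nat set \<Rightarrow> bool" where
  "no_nontrivial_solutions k A \<longleftrightarrow> (\<forall>x. is_solution k A x \<longrightarrow> trivial_solution k x)"

end

theory Submission
  imports Defs "HOL-Library.FuncSet"
begin

text \<open>
  Density increment on Bourgain systems of integers (nested families \<open>B s\<close> of symmetric sets with
  \<open>B s + B t \<subseteq> B (s + t)\<close> and \<open>card (B s) \<ge> e\<^sup>w s\<^sup>d\<close>), run at two scales. Write \<open>e\<close> to the power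
  \<open>- \<rho>\<^sup>2\<close> for the density. A Bogolyubov lemma (Croot-Sisask almost periodicity followed by a relative
  form of Chang's theorem) shows that sums of four elements of \<open>A\<close> fill a translate of a system \<open>T\<^sub>1\<close>
  of rank \<open>O(\<rho>\<^sup>8)\<close>. If the density of \<open>A\<close> does not increase by the large factor \<open>exp \<rho>\<close> on a translate
  of \<open>T\<^sub>1\<close>, then \<open>A + T\<^sub>1\<close> has density about \<open>exp (- \<rho>)\<close>, so that the lemma applied to \<open>A + T\<^sub>1\<close> gives a
  system \<open>T\<^sub>2\<close> of rank only \<open>O(\<rho>\<^sup>4)\<close>, a translate of which consists of sums of eight elements of \<open>A\<close>.
  If the density does not increase by a constant factor on \<open>T\<^sub>2\<close>, or on \<open>T\<^sub>2\<close> divided by the coefficient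
  \<open>K = k - 1\<close>, then both \<open>A + T\<^sub>2\<close> and \<open>K A + T\<^sub>2\<close> are so large that they meet, which is a solution. There are
  at most \<open>\<rho>\<close> increments of the first kind and \<open>O(\<rho>\<^sup>2)\<close> of the second; in total they cost a factor
  \<open>exp (O(\<rho>\<^sup>1\<^sup>2))\<close> in size. Hence the exponent \<open>1 / 6\<close> is available for every \<open>k \<ge> 10\<close>.
\<close>

subsection \<open>Counting and averaging\<close>

text \<open>Bogolyubov arguments produce differences, but the left side of the equation allows only
  sums. So the lemma is applied to sets \<open>P\<close> for which \<open>x + P\<close> and
  \<open>x + w - P\<close> both lie in the given set: differences from \<open>P\<close> then become
  sums. Triviality is excluded by counting representations instead of asserting one, so that a
  single forbidden value can be avoided. The solution found has \<open>K\<close> summands: one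
  point, the eight points from the two scales, and \<open>K - 9\<close> copies of a fixed point.

  The exponent 12 arises as follows. At relative density exp(-l) the lemma adds rank of order l^4
  and shrinks radii by exp(-O(l)), so a system of rank d loses O(d l) in logarithmic size. The rank
  is dominated by the first kind of increment, \<open>\<rho>\<close> steps of
  \<open>\<rho> ^ 8\<close> each, that is \<open>\<rho> ^ 9\<close>. A step of the first kind then
  costs \<open>\<rho> ^ 9\<close> times \<open>\<rho> ^ 2\<close>, one of the second kind
  \<open>\<rho> ^ 9\<close> times \<open>\<rho>\<close>; with \<open>\<rho>\<close> and
  \<open>\<rho> ^ 2\<close> steps respectively both totals are of order
  \<open>\<rho> ^ 12\<close>.\<close>

lemma exists_ge_average:
  fixes f :: "'a \<Rightarrow> real" and c :: real
  assumes "finite Z" "Z \<noteq> {}" "c * card Z \<le> sum f Z"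
  shows "\<exists>z\<in>Z. c \<le> f z"
proof (rule ccontr)
  assume "\<not> ?thesis"
  then have "sum f Z < (\<Sum>z\<in>Z. c)"
    using assms by (intro sum_strict_mono) auto
  then show False using assms by (simp add: mult.commute)
qed

lemma card_filter_sum: "finite S \<Longrightarrow> real (card {x\<in>S. P x}) = (\<Sum>x\<in>S. of_bool (P x))"
  by (subst of_bool_def, subst sum.If_cases) (auto simp: Int_def)

lemma large_fibre:
  assumes "finite X" "finite C" "C \<noteq> {}" "f ` X \<subseteq> C"
  shows "\<exists>c\<in>C. card X \<le> card C * card {x\<in>X. f x = c}"
proof -
  have "real (card X) = (\<Sum>c\<in>C. real (card {x\<in>X. f x = c}))"
    using sum.group[OF assms(1,2,4), of "\<lambda>_. 1::real"] by simp
  then have "\<exists>c\<in>C. real (card X) / card C \<le> card {x\<in>X. f x = c}"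
    using assms by (intro exists_ge_average) auto
  then obtain c where c: "c \<in> C" "real (card X) / card C \<le> card {x\<in>X. f x = c}" by blast
  have "card C > 0" using assms by (simp add: card_gt_0_iff)
  then have "real (card X) \<le> real (card C * card {x\<in>X. f x = c})"
    using c by (simp add: field_simps)
  then show ?thesis using c by (meson of_nat_le_iff)
qed

lemma card_int_interval:
  assumes "0 \<le> r"
  shows "finite {x::int. \<bar>real_of_int x\<bar> \<le> r}" "real (card {x::int. \<bar>real_of_int x\<bar> \<le> r}) \<le> 2 * r + 1"
proof -
  have eq: "{x::int. \<bar>real_of_int x\<bar> \<le> r} = {-\<lfloor>r\<rfloor>..\<lfloor>r\<rfloor>}"
    by (auto simp: abs_le_iff le_floor_iff minus_le_iff[of "\<lfloor>r\<rfloor>"])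
  show "finite {x::int. \<bar>real_of_int x\<bar> \<le> r}" by (simp add: eq)
  have "0 \<le> \<lfloor>r\<rfloor>" using assms by simp
  then have "real (card {x::int. \<bar>real_of_int x\<bar> \<le> r}) = 2 * of_int \<lfloor>r\<rfloor> + 1"
    by (simp add: eq)
  also have "\<dots> \<le> 2 * r + 1" by simp
  finally show "real (card {x::int. \<bar>real_of_int x\<bar> \<le> r}) \<le> 2 * r + 1" .
qed

section \<open>Counting on translates, and density that is uniform over a window\<close>

definition cnt :: "int set \<Rightarrow> int \<Rightarrow> int set \<Rightarrow> nat" where
  "cnt A x U = card {u\<in>U. x + u \<in> A}"

lemma cnt_sum: "finite U \<Longrightarrow> real (cnt A x U) = (\<Sum>u\<in>U. of_bool (x + u \<in> A))"
  unfolding cnt_def by (rule card_filter_sum)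

lemma cnt_le: "finite U \<Longrightarrow> cnt A x U \<le> card U"
  unfolding cnt_def by (rule card_mono) auto

text \<open>Each single shift \<open>u\<close> in \<open>W\<close> meets \<open>A\<close> from a
  proportion \<open>\<alpha>\<close> of one common set \<open>Z\<close> of base points. Averaging
  over \<open>u\<close> keeps the proportion on every non-empty finite subset of \<open>W\<close>,
  so density passes to subsystems without loss, and several subsets can be served by the same base
  point.\<close>

definition dense_in :: "int set \<Rightarrow> int set \<Rightarrow> real \<Rightarrow> bool" where
  "dense_in A W \<alpha> \<longleftrightarrow>
     (\<exists>Z. finite Z \<and> Z \<noteq> {} \<and> (\<forall>u\<in>W. \<alpha> * card Z \<le> card {y\<in>Z. y + u \<in> A}))"

lemma dense_in_mono: "dense_in A W \<alpha> \<Longrightarrow> W' \<subseteq> W \<Longrightarrow> \<alpha>' \<le> \<alpha> \<Longrightarrow> dense_in A W' \<alpha>'"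
  unfolding dense_in_def
  by (meson order_trans mult_right_mono of_nat_0_le_iff subsetD)

lemma dense_in_le_1:
  assumes "dense_in A W \<alpha>" "W \<noteq> {}"
  shows "\<alpha> \<le> 1"
proof -
  obtain Z u where Z: "finite Z" "Z \<noteq> {}" "u \<in> W" "\<alpha> * card Z \<le> card {y\<in>Z. y + u \<in> A}"
    using assms unfolding dense_in_def by blast
  have "card {y\<in>Z. y + u \<in> A} \<le> card Z" using Z by (intro card_mono) auto
  then have "\<alpha> * real (card Z) \<le> 1 * real (card Z)" using Z(4) by linarith
  moreover have "0 < real (card Z)" using Z by (simp add: card_gt_0_iff)
  ultimately show ?thesis by (simp only: mult_le_cancel_right_pos)
qed

text \<open>Averaged over \<open>Z\<close>, the relative densities on the sets \<open>U j\<close>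
  sum to at least \<open>card J * \<alpha>\<close>, so some \<open>y\<close> attains this sum. As no
  density exceeds \<open>\<kappa> * \<alpha>\<close>, the other \<open>card J - 1\<close> terms
  cannot account for all of it, and the rest bounds each term from below.\<close>

lemma dense_in_common_translate:
  fixes U :: "'j \<Rightarrow> int set" and \<alpha> \<kappa> :: real
  assumes dense: "dense_in A W \<alpha>" and J: "finite J"
    and U: "\<And>j. j \<in> J \<Longrightarrow> finite (U j) \<and> U j \<noteq> {} \<and> U j \<subseteq> W"
    and upper: "\<And>j y. j \<in> J \<Longrightarrow> cnt A y (U j) \<le> \<kappa> * \<alpha> * card (U j)"
  shows "\<exists>y. \<forall>j\<in>J. (real (card J) - (real (card J) - 1) * \<kappa>) * \<alpha> * card (U j) \<le> cnt A y (U j)"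
proof -
  obtain Z where Z: "finite Z" "Z \<noteq> {}" "\<And>u. u \<in> W \<Longrightarrow> \<alpha> * card Z \<le> card {y\<in>Z. y + u \<in> A}"
    using dense unfolding dense_in_def by blast
  define f where "f j y = real (cnt A y (U j)) / card (U j)" for j y
  have cU: "0 < real (card (U j))" if "j \<in> J" for j
    using U[OF that] by (simp add: card_gt_0_iff)
  have avg: "\<alpha> * card Z \<le> (\<Sum>y\<in>Z. f j y)" if j: "j \<in> J" for j
  proof -
    have "\<alpha> * card Z * card (U j) = (\<Sum>u\<in>U j. \<alpha> * card Z)" by simp
    also have "\<dots> \<le> (\<Sum>u\<in>U j. real (card {y\<in>Z. y + u \<in> A}))"
      using Z(3) U[OF j] by (intro sum_mono) auto
    also have "\<dots> = (\<Sum>u\<in>U j. \<Sum>y\<in>Z. of_bool (y + u \<in> A))"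
      using Z(1) by (simp add: card_filter_sum)
    also have "\<dots> = (\<Sum>y\<in>Z. real (cnt A y (U j)))"
      using U[OF j] by (subst sum.swap) (simp add: cnt_sum)
    finally show ?thesis
      using cU[OF j] by (simp add: f_def sum_divide_distrib[symmetric] field_simps)
  qed
  have "(card J * \<alpha>) * card Z = (\<Sum>j\<in>J. \<alpha> * card Z)" by simp
  also have "\<dots> \<le> (\<Sum>j\<in>J. \<Sum>y\<in>Z. f j y)" by (rule sum_mono) (rule avg)
  also have "\<dots> = (\<Sum>y\<in>Z. \<Sum>j\<in>J. f j y)" by (rule sum.swap)
  finally obtain y where y: "card J * \<alpha> \<le> (\<Sum>j\<in>J. f j y)"
    using exists_ge_average[OF Z(1,2)] by blast
  have fle: "f j y \<le> \<kappa> * \<alpha>" if "j \<in> J" for j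
    using upper[OF that, of y] cU[OF that] by (simp add: f_def field_simps)
  have "(real (card J) - (real (card J) - 1) * \<kappa>) * \<alpha> * card (U j) \<le> cnt A y (U j)" if j: "j \<in> J" for j
  proof -
    have "(\<Sum>i\<in>J - {j}. f i y) \<le> (\<Sum>i\<in>J - {j}. \<kappa> * \<alpha>)" using fle by (intro sum_mono) auto
    also have "\<dots> = (real (card J) - 1) * (\<kappa> * \<alpha>)"
      using j J card_gt_0_iff[of J] by (auto simp: of_nat_diff)
    finally have "(real (card J) - (real (card J) - 1) * \<kappa>) * \<alpha> \<le> f j y"
      using y j J by (simp add: sum.remove algebra_simps)
    then show ?thesis using cU[OF j] by (simp add: f_def field_simps)
  qed
  then show ?thesis by blast
qed

text \<open>The translate \<open>x + U'\<close> is tried as the set of base points for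
  \<open>V\<close>. Its failure gives one \<open>v\<close> for which few of its points
  \<open>y\<close> have \<open>y + v\<close> in \<open>A\<close>, and the points
  \<open>x + u\<close> of \<open>A\<close> inject into these by subtracting
  \<open>v\<close>.\<close>

lemma cnt_le_if_not_dense_in:
  fixes \<beta> \<eta> :: real
  assumes "\<not> dense_in A V \<beta>" "finite U'" "U' \<noteq> {}" "\<And>u v. u \<in> U \<Longrightarrow> v \<in> V \<Longrightarrow> u - v \<in> U'"
    "card U' \<le> (1 + \<eta>) * card U" "0 \<le> \<beta>" "finite U"
  shows "cnt A x U \<le> (1 + \<eta>) * \<beta> * card U"
proof -
  have "finite ((+) x ` U')" "(+) x ` U' \<noteq> {}" using assms by auto
  then obtain v where v: "v \<in> V" "card {y\<in>(+) x ` U'. y + v \<in> A} < \<beta> * card ((+) x ` U')"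
    using assms(1) unfolding dense_in_def by (metis not_le)
  have "cnt A x U \<le> card {y\<in>(+) x ` U'. y + v \<in> A}"
    unfolding cnt_def
  proof (rule card_inj_on_le)
    show "inj_on (\<lambda>u. x + u - v) {u\<in>U. x + u \<in> A}" by (auto simp: inj_on_def)
    show "(\<lambda>u. x + u - v) ` {u\<in>U. x + u \<in> A} \<subseteq> {y\<in>(+) x ` U'. y + v \<in> A}"
    proof clarify
      fix u assume u: "u \<in> U" "x + u \<in> A"
      have "x + u - v = x + (u - v)" by simp
      then show "x + u - v \<in> (+) x ` U' \<and> x + u - v + v \<in> A"
        using assms(4)[OF u(1) v(1)] u by (metis diff_add_cancel imageI)
    qed
  qed (use assms in auto)
  also have "real \<dots> \<le> \<beta> * card U'"
    using v(2) by (simp add: card_image)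
  also have "\<dots> \<le> \<beta> * ((1 + \<eta>) * card U)" using assms by (intro mult_left_mono) auto
  finally show ?thesis by (simp add: algebra_simps)
qed

text \<open>Thin fibres force a large image: a pair of a point \<open>x + u\<close> of
  \<open>A\<close> and some \<open>t\<close> in \<open>T\<close> is sent to
  \<open>b = u - t\<close>, and no \<open>b\<close> is hit more than
  \<open>\<kappa> * card T\<close> times. This is how the absence of a density increment on
  \<open>T\<close> makes the \<open>T\<close>-neighbourhood of \<open>A\<close> large.\<close>

lemma cover_count:
  fixes \<kappa> :: real
  assumes upper: "\<And>y. cnt A y T \<le> \<kappa> * card T" and fin: "finite T" "T \<noteq> {}" "finite U'" "finite U"
    and sub: "\<And>u t. u \<in> U \<Longrightarrow> t \<in> T \<Longrightarrow> u - t \<in> U'"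
  shows "cnt A x U \<le> \<kappa> * card {b\<in>U'. \<exists>t\<in>T. x + b + t \<in> A}"
proof -
  define E where "E = {b\<in>U'. \<exists>t\<in>T. x + b + t \<in> A}"
  have finE: "finite E" using fin by (simp add: E_def)
  have "cnt A x U * card T = card ({u\<in>U. x + u \<in> A} \<times> T)"
    by (simp add: cnt_def card_cartesian_product)
  also have "\<dots> \<le> card (SIGMA b:E. {t\<in>T. x + b + t \<in> A})"
  proof (rule card_inj_on_le)
    show "inj_on (\<lambda>(u, t). (u - t, t)) ({u\<in>U. x + u \<in> A} \<times> T)" by (auto simp: inj_on_def)
    show "(\<lambda>(u, t). (u - t, t)) ` ({u\<in>U. x + u \<in> A} \<times> T) \<subseteq> (SIGMA b:E. {t\<in>T. x + b + t \<in> A})"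
      using sub by (force simp: E_def)
    show "finite (SIGMA b:E. {t\<in>T. x + b + t \<in> A})" using fin finE by auto
  qed
  also have "\<dots> = (\<Sum>b\<in>E. cnt A (x + b) T)"
    using fin finE by (simp add: cnt_def)
  finally have "real (cnt A x U) * card T \<le> (\<Sum>b\<in>E. real (cnt A (x + b) T))"
    by (metis of_nat_le_iff of_nat_mult of_nat_sum)
  also have "\<dots> \<le> (\<Sum>b\<in>E. \<kappa> * card T)" by (intro sum_mono upper)
  also have "\<dots> = (\<kappa> * card E) * card T" by simp
  finally show ?thesis
    using fin unfolding E_def by (simp add: card_gt_0_iff)
qed

text \<open>A set that is dense on two translates has a large subset \<open>P\<close> such that also \<open>z - P\<close> lies in
  the set; differences of elements of \<open>P\<close> then become sums.\<close>
lemma symmetric_part: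
  assumes fin: "finite U" "finite U'" "finite W" "W \<noteq> {}"
    and sub: "\<And>u u'. u \<in> U \<Longrightarrow> u' \<in> U' \<Longrightarrow> u + u' \<in> W"
  shows "\<exists>w\<in>W. cnt A x U * cnt A y U' \<le> card W * card {u\<in>U'. y + u \<in> A \<and> x + w - u \<in> A}"
proof -
  let ?X = "{u\<in>U. x + u \<in> A} \<times> {u\<in>U'. y + u \<in> A}"
  have "\<exists>w\<in>W. card ?X \<le> card W * card {z\<in>?X. fst z + snd z = w}"
    using fin sub by (intro large_fibre) auto
  then obtain w where w: "w \<in> W" "card ?X \<le> card W * card {z\<in>?X. fst z + snd z = w}" by blast
  have "card {z\<in>?X. fst z + snd z = w} \<le> card {u\<in>U'. y + u \<in> A \<and> x + w - u \<in> A}"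
  proof (rule card_inj_on_le)
    show "inj_on snd {z\<in>?X. fst z + snd z = w}" by (auto simp: inj_on_def)
    show "snd ` {z\<in>?X. fst z + snd z = w} \<subseteq> {u\<in>U'. y + u \<in> A \<and> x + w - u \<in> A}"
      by (auto simp: algebra_simps)
  qed (use fin in auto)
  then have "card ?X \<le> card W * card {u\<in>U'. y + u \<in> A \<and> x + w - u \<in> A}"
    using w(2) by (meson le_trans mult_le_mono2)
  then show ?thesis using w(1) by (auto simp: card_cartesian_product cnt_def)
qed

subsection \<open>Characters\<close>

definition echar :: "real \<Rightarrow> int \<Rightarrow> complex" where
  "echar \<theta> x = cis (2 * pi * \<theta> * of_int x)"

lemma echar_add: "echar \<theta> (x + y) = echar \<theta> x * echar \<theta> y"
  by (simp add: echar_def cis_mult algebra_simps)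

lemma echar_add_freq: "echar (\<theta> + \<phi>) x = echar \<theta> x * echar \<phi> x"
  by (simp add: echar_def cis_mult algebra_simps)

lemma echar_minus: "echar \<theta> (- x) = cnj (echar \<theta> x)"
  by (simp add: echar_def cis_cnj)

lemma echar_minus_freq: "echar (- \<theta>) x = cnj (echar \<theta> x)"
  by (simp add: echar_def cis_cnj)

lemma echar_diff: "echar \<theta> (x - y) = echar \<theta> x * cnj (echar \<theta> y)"
  using echar_add[of \<theta> x "- y"] by (simp add: echar_minus)

lemma echar_0 [simp]: "echar \<theta> 0 = 1" "echar 0 x = 1"
  by (simp_all add: echar_def)

lemma norm_echar [simp]: "cmod (echar \<theta> x) = 1"
  by (simp add: echar_def)

lemma echar_power: "echar \<theta> (int n * x) = echar \<theta> x ^ n"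
  by (simp add: echar_def DeMoivre algebra_simps)

lemma norm_mult_minus_1_le:
  fixes a b :: complex
  assumes "cmod a = 1"
  shows "cmod (a * b - 1) \<le> cmod (a - 1) + cmod (b - 1)"
proof -
  have "a * b - 1 = a * (b - 1) + (a - 1)" by (simp add: algebra_simps)
  then have "cmod (a * b - 1) \<le> cmod (a * (b - 1)) + cmod (a - 1)" by (metis norm_triangle_ineq)
  then show ?thesis using assms by (simp add: norm_mult)
qed

abbreviation cdev :: "real \<Rightarrow> int \<Rightarrow> real" where
  "cdev \<theta> x \<equiv> cmod (echar \<theta> x - 1)"

lemma norm_echar_add: "cmod (echar \<theta> (x + y) - 1) \<le> cdev \<theta> x + cdev \<theta> y"
  by (simp add: echar_add norm_mult_minus_1_le)

lemma norm_echar_add_freq: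
  "cmod (echar (\<theta> + \<phi>) x - 1) \<le> cdev \<theta> x + cdev \<phi> x"
  by (simp add: echar_add_freq norm_mult_minus_1_le)

lemma norm_echar_minus: "cmod (echar \<theta> (- x) - 1) = cdev \<theta> x"
  by (metis complex_cnj_diff complex_cnj_one complex_mod_cnj echar_minus)

lemma norm_echar_minus_freq: "cmod (echar (- \<theta>) x - 1) = cdev \<theta> x"
  by (metis echar_minus echar_minus_freq norm_echar_minus)

lemma norm_cis_minus_1_le: "cmod (cis a - 1) \<le> \<bar>a\<bar>"
proof -
  have "cmod (cis a - 1)^2 = (cos a - 1)^2 + (sin a)^2"
    by (simp add: cmod_power2)
  also have "\<dots> = 2 - 2 * cos a"
    using sin_cos_squared_add[of a] by (simp add: power2_eq_square algebra_simps)
  also have "\<dots> = 4 * (sin (a/2))^2"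
    using cos_double_sin[of "a/2"] by simp
  also have "\<dots> \<le> 4 * (\<bar>a/2\<bar>)^2"
    using abs_sin_x_le_abs_x[of "a/2"] by (metis abs_le_square_iff mult_le_cancel_left_pos power2_abs zero_less_numeral abs_abs)
  also have "\<dots> = \<bar>a\<bar>^2" by (simp add: power_divide)
  finally show ?thesis by (meson abs_ge_zero power2_le_imp_le)
qed

lemma norm_echar_diff_le_frac:
  "cmod (echar \<theta> (x - y) - 1) \<le> 2 * pi * \<bar>frac (\<theta> * x) - frac (\<theta> * y)\<bar>"
proof -
  define n where "n = \<lfloor>\<theta> * x\<rfloor> - \<lfloor>\<theta> * y\<rfloor>"
  have "2 * pi * \<theta> * real_of_int (x - y) = 2 * pi * (frac (\<theta> * x) - frac (\<theta> * y)) + 2 * pi * of_int n"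
    by (simp add: n_def frac_def algebra_simps)
  then have "echar \<theta> (x - y) = cis (2 * pi * (frac (\<theta> * x) - frac (\<theta> * y)))"
    by (simp add: echar_def cis_mult[symmetric] cis_multiple_2pi)
  then show ?thesis
    using norm_cis_minus_1_le[of "2 * pi * (frac (\<theta> * x) - frac (\<theta> * y))"] by (simp add: abs_mult)
qed

text \<open>If \<open>z\<close> is within \<open>1/2\<close> of 1, then \<open>z + 1\<close> has
  modulus at least \<open>3/2\<close>, and \<open>z^2 - 1 = (z - 1) * (z + 1)\<close>. Hence each
  step back from \<open>z^2\<close> to \<open>z\<close> gains a factor \<open>2/3\<close>.\<close>

lemma norm_minus_1_le_by_doubling:
  fixes z :: complex
  assumes "cmod z = 1" "\<And>j. j \<le> i \<Longrightarrow> cmod (z ^ (2 ^ j) - 1) \<le> 1/2"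
  shows "cmod (z - 1) \<le> (2/3) ^ i"
  using assms
proof (induction i arbitrary: z)
  case 0
  then show ?case using 0(2)[of 0] by simp
next
  case (Suc i)
  have "cmod (z^2 - 1) \<le> (2/3) ^ i"
  proof (rule Suc.IH)
    show "cmod (z^2) = 1" using Suc.prems by (simp add: norm_power)
    show "cmod ((z^2) ^ (2 ^ j) - 1) \<le> 1/2" if "j \<le> i" for j
      using Suc.prems(2)[of "Suc j"] that by (simp add: power_mult)
  qed
  moreover have "cmod (z^2 - 1) = cmod (z - 1) * cmod (z + 1)"
    by (simp add: norm_mult[symmetric] power2_eq_square algebra_simps)
  moreover have "cmod (z + 1) \<ge> 3/2"
  proof -
    have "cmod 2 \<le> cmod (z + 1) + cmod (z - 1)"
      using norm_triangle_ineq4[of "z + 1" "z - 1"] by simp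
    then show ?thesis using Suc.prems(2)[of 0] by simp
  qed
  then have "cmod (z - 1) * (3/2) \<le> cmod (z - 1) * cmod (z + 1)"
    by (intro mult_left_mono) auto
  ultimately show ?case by simp
qed

subsection \<open>Bourgain systems\<close>

text \<open>\<open>d\<close> is the rank and \<open>w\<close> the logarithm of a lower bound for the
  size at index 1. No doubling condition is imposed: growth is controlled only by this lower bound
  and by the interval of radius \<open>s * N\<close> containing the system, and regular radii come
  from pigeonhole between the two.\<close>

definition bsys :: "real \<Rightarrow> real \<Rightarrow> real \<Rightarrow> (real \<Rightarrow> int set) \<Rightarrow> bool" where
  "bsys N d w B \<longleftrightarrow>
     (\<forall>s>0. 0 \<in> B s \<and> (\<forall>x\<in>B s. - x \<in> B s \<and> \<bar>real_of_int x\<bar> \<le> s * N)) \<and>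
     (\<forall>s>0. \<forall>t>0. \<forall>x\<in>B s. \<forall>y\<in>B t. x + y \<in> B (s + t)) \<and>
     (\<forall>s. 0 < s \<and> s \<le> 1 \<longrightarrow> w + d * ln s \<le> ln (card (B s)))"

lemma bsysD:
  assumes "bsys N d w B" "0 < s"
  shows bsys_0: "0 \<in> B s"
    and bsys_minus: "x \<in> B s \<Longrightarrow> - x \<in> B s"
    and bsys_bound: "x \<in> B s \<Longrightarrow> \<bar>real_of_int x\<bar> \<le> s * N"
    and bsys_add: "0 < t \<Longrightarrow> x \<in> B s \<Longrightarrow> y \<in> B t \<Longrightarrow> x + y \<in> B (s + t)"
    and bsys_card: "s \<le> 1 \<Longrightarrow> w + d * ln s \<le> ln (card (B s))"
  using assms unfolding bsys_def by auto

lemma bsys_diff: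
  assumes "bsys N d w B" "0 < s" "0 < t" "x \<in> B s" "y \<in> B t"
  shows "x - y \<in> B (s + t)"
  using bsys_add[OF assms(1,2,3,4) bsys_minus[OF assms(1,3,5)]] by simp

lemma bsys_mono:
  assumes "bsys N d w B" "0 < s" "s \<le> t"
  shows "B s \<subseteq> B t"
proof (cases "s = t")
  case False
  then have "0 < t - s" using assms by simp
  then show ?thesis
    using bsys_add[OF assms(1,2) _ _ bsys_0[OF assms(1)], of "t - s"] by auto
qed simp

lemma bsys_finite:
  assumes "bsys N d w B" "0 < s"
  shows "finite (B s)"
proof -
  have "0 \<le> s * N" using bsys_bound[OF assms bsys_0[OF assms]] by simp
  then show ?thesis
    using bsys_bound[OF assms] by (intro finite_subset[OF _ card_int_interval(1)[of "s * N"]]) auto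
qed

lemma bsys_card_le:
  fixes N :: real
  assumes "bsys N d w B" "0 < s"
  shows "card (B s) \<le> 2 * s * N + 1"
proof -
  have "0 \<le> s * N" using bsys_bound[OF assms bsys_0[OF assms]] by simp
  note * = card_int_interval[OF this]
  have "card (B s) \<le> card {x. \<bar>real_of_int x\<bar> \<le> s * N}"
    using bsys_bound[OF assms] by (intro card_mono *) auto
  then show ?thesis using *(2) by linarith
qed

lemma bsys_card_pos:
  assumes "bsys N d w B" "0 < s"
  shows "0 < card (B s)"
  using bsys_0[OF assms] bsys_finite[OF assms] by (auto simp: card_gt_0_iff)

lemma bsys_rescale:
  assumes "bsys N d w B" "0 < \<rho>" "\<rho> \<le> 1"
  shows "bsys N d (w + d * ln \<rho>) (\<lambda>s. B (\<rho> * s))"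
  unfolding bsys_def
proof (intro conjI allI impI ballI)
  fix s :: real assume s: "0 < s"
  have p: "0 < \<rho> * s" using assms s by simp
  show "0 \<in> B (\<rho> * s)" by (rule bsys_0[OF assms(1) p])
  fix x assume x: "x \<in> B (\<rho> * s)"
  show "- x \<in> B (\<rho> * s)" by (rule bsys_minus[OF assms(1) p x])
  have "\<bar>real_of_int x\<bar> \<le> \<rho> * s * N" by (rule bsys_bound[OF assms(1) p x])
  also have "\<dots> \<le> s * N"
  proof -
    have "0 \<le> \<rho> * (s * N)" using bsys_bound[OF assms(1) p bsys_0[OF assms(1) p]] by (simp add: mult.assoc)
    then have "0 \<le> s * N" using assms by (simp add: zero_le_mult_iff)
    then show ?thesis using assms by (simp add: mult.assoc mult_left_le_one_le)
  qed
  finally show "\<bar>real_of_int x\<bar> \<le> s * N" .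
next
  fix s t :: real and x y assume "0 < s" "0 < t" "x \<in> B (\<rho> * s)" "y \<in> B (\<rho> * t)"
  then show "x + y \<in> B (\<rho> * (s + t))"
    using bsys_add[OF assms(1), of "\<rho> * s" "\<rho> * t"] assms by (simp add: distrib_left)
next
  fix s :: real assume s: "0 < s \<and> s \<le> 1"
  then have "\<rho> * s \<le> 1" "0 < \<rho> * s" using assms by (auto simp: mult_le_one)
  then show "w + d * ln \<rho> + d * ln s \<le> ln (card (B (\<rho> * s)))"
    using bsys_card[OF assms(1), of "\<rho> * s"] assms s by (simp add: ln_mult algebra_simps)
qed

text \<open>The index is divided by \<open>K\<close> so that the multiples of \<open>K\<close> stay
  in the interval of radius \<open>s * N\<close>; the price is that of rescaling by
  \<open>1 / K\<close>.\<close>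

lemma bsys_dilate:
  fixes N :: real
  assumes "bsys N d w B" "1 \<le> K"
  shows "bsys N d (w - d * ln K) (\<lambda>s. (*) (int K) ` B (s / K))"
proof -
  have K: "0 < 1 / real K" "1 / real K \<le> 1" using assms(2) by auto
  note R = bsys_rescale[OF assms(1) K]
  have lnK: "ln (1 / real K) = - ln K" using assms(2) by (simp add: ln_div)
  show ?thesis
    unfolding bsys_def
  proof (intro conjI allI impI ballI)
    fix s :: real assume s: "0 < s"
    have p: "0 < s / K" using assms s by simp
    show "0 \<in> (*) (int K) ` B (s / K)" using bsys_0[OF assms(1) p] by force
    fix x assume x: "x \<in> (*) (int K) ` B (s / K)"
    show "- x \<in> (*) (int K) ` B (s / K)"
      using x bsys_minus[OF assms(1) p] by (auto intro: image_eqI[of _ _ "- _"])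
    show "\<bar>real_of_int x\<bar> \<le> s * N"
      using x bsys_bound[OF assms(1) p] assms(2) by (auto simp: abs_mult field_simps)
  next
    fix s t :: real and x y
    assume *: "0 < s" "0 < t" "x \<in> (*) (int K) ` B (s / K)" "y \<in> (*) (int K) ` B (t / K)"
    then obtain a b where "a \<in> B (s / K)" "b \<in> B (t / K)" "x = int K * a" "y = int K * b" by auto
    moreover from this have "a + b \<in> B ((s + t) / K)"
      using bsys_add[OF assms(1), of "s / K" "t / K"] * assms(2) by (simp add: add_divide_distrib)
    ultimately show "x + y \<in> (*) (int K) ` B ((s + t) / K)"
      by (intro image_eqI[of _ _ "a + b"]) (auto simp: algebra_simps)
  next
    fix s :: real assume s: "0 < s \<and> s \<le> 1"
    have "inj_on ((*) (int K)) (B (s / K))" using assms(2) by (auto simp: inj_on_def)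
    then show "w - d * ln K + d * ln s \<le> ln (card ((*) (int K) ` B (s / K)))"
      using bsys_card[OF R, of s] s lnK by (simp add: card_image)
  qed
qed

text \<open>If the size grew by more than \<open>1 + \<eta>\<close> on each of the \<open>M\<close>
  steps from \<open>s\<close> to \<open>2 * s\<close>, it would outgrow the bound
  \<open>5 * N\<close>. The radius returned is the midpoint of a good step, so that it can be moved
  by \<open>s / (2 * M)\<close> both ways.\<close>

lemma bsys_regular_radius:
  fixes N \<eta> :: real
  assumes B: "bsys N d w B" and N: "1 \<le> N" and s: "0 < s" "s \<le> 1"
    and M: "0 < M" "ln (5 * N) - w - d * ln s \<le> M * ln (1 + \<eta>)" and \<eta>: "0 \<le> \<eta>"
  shows "\<exists>s'. s \<le> s' - s / (2 * real M) \<and> s' + s / (2 * real M) \<le> 2 * s \<and>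
     card (B (s' + s / (2 * real M))) \<le> (1 + \<eta>) * card (B (s' - s / (2 * real M)))"
proof -
  define r where "r i = s + real i * s / M" for i :: nat
  have rpos: "0 < r i" for i using s M by (simp add: r_def add_pos_nonneg)
  have "\<exists>i<M. card (B (r (Suc i))) \<le> (1 + \<eta>) * card (B (r i))"
  proof (rule ccontr)
    assume "\<not> ?thesis"
    then have step: "(1 + \<eta>) * card (B (r i)) < card (B (r (Suc i)))" if "i < M" for i
      using that by (meson not_le)
    have "(1 + \<eta>) ^ i * card (B s) \<le> card (B (r i))" if "i \<le> M" for i
      using that
    proof (induction i)
      case 0 then show ?case by (simp add: r_def)
    next
      case (Suc i)
      then have "(1 + \<eta>) * ((1 + \<eta>) ^ i * card (B s)) \<le> (1 + \<eta>) * card (B (r i))"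
        using \<eta> by (intro mult_left_mono) auto
      then show ?case using step[of i] Suc.prems by (simp add: mult.assoc)
    qed
    from this[of "M - 1"] have "(1 + \<eta>) ^ (M - 1) * card (B s) \<le> card (B (r (M - 1)))" by simp
    then have "(1 + \<eta>) * ((1 + \<eta>) ^ (M - 1) * card (B s)) \<le> (1 + \<eta>) * card (B (r (M - 1)))"
      using \<eta> by (intro mult_left_mono) auto
    also have "\<dots> < card (B (r M))" using step[of "M - 1"] M by simp
    also have "r M = 2 * s" using M by (simp add: r_def)
    also have "real (card (B (2 * s))) \<le> 2 * (2 * s) * N + 1" using bsys_card_le[OF B, of "2 * s"] s by simp
    also have "\<dots> \<le> 5 * N"
    proof -
      have "s * N \<le> N" using s N by (simp add: mult_left_le_one_le)
      then show ?thesis using N by linarith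
    qed
    finally have "(1 + \<eta>) ^ M * card (B s) < 5 * N"
      using M by (simp add: power_eq_if mult.assoc split: if_splits)
    moreover have pos: "0 < (1 + \<eta>) ^ M * card (B s)"
      using \<eta> bsys_card_pos[OF B s(1)] by simp
    ultimately have "ln ((1 + \<eta>) ^ M * card (B s)) < ln (5 * N)" by simp
    then have "M * ln (1 + \<eta>) + ln (card (B s)) < ln (5 * N)"
      using \<eta> bsys_card_pos[OF B s(1)] by (simp add: ln_mult ln_realpow)
    then show False using bsys_card[OF B s] M by linarith
  qed
  then obtain i where i: "i < M" "card (B (r (Suc i))) \<le> (1 + \<eta>) * card (B (r i))" by blast
  define s' where "s' = r i + s / (2 * real M)"
  have eq: "s' - s / (2 * real M) = r i" "s' + s / (2 * real M) = r (Suc i)"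
    using M by (simp_all add: s'_def r_def field_simps)
  have "(real i + 1) * s \<le> real M * s" using i s by (intro mult_right_mono) auto
  then have "r (Suc i) \<le> 2 * s" "s \<le> r i" using M s by (simp_all add: r_def field_simps)
  then show ?thesis using i by (intro exI[of _ s']) (simp add: eq)
qed

text \<open>Pigeonhole on the fractional parts of \<open>\<theta> * x\<close> for
  \<open>\<theta>\<close> in \<open>\<Lambda>\<close>: a popular box, translated back by one of its
  points, lies in the restricted set. Taking differences doubles the radius, hence
  \<open>\<rho> / 2\<close>, and each frequency costs a factor \<open>M\<close>, at most
  \<open>9 / (\<nu> * s)\<close>.\<close>

lemma bsys_restrict:
  fixes N d w \<rho> \<nu> :: real
  assumes B: "bsys N d w B" and \<Lambda>: "finite \<Lambda>" and \<rho>: "0 < \<rho>" "\<rho> \<le> 1" and \<nu>: "0 < \<nu>" "\<nu> \<le> 1"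
  shows "bsys N (d + card \<Lambda>) (w + d * ln (\<rho> / 2) + card \<Lambda> * ln (\<nu> / 9))
           (\<lambda>s. {t\<in>B (\<rho> * s). \<forall>\<theta>\<in>\<Lambda>. cdev \<theta> t \<le> \<nu> * s})"
proof -
  note R = bsys_rescale[OF B \<rho>]
  have \<rho>2: "0 < \<rho> / 2" "\<rho> / 2 \<le> 1" using \<rho> by auto
  note R2 = bsys_rescale[OF B \<rho>2]
  let ?T = "\<lambda>s. {t\<in>B (\<rho> * s). \<forall>\<theta>\<in>\<Lambda>. cdev \<theta> t \<le> \<nu> * s}"
  show ?thesis
    unfolding bsys_def
  proof (intro conjI allI impI ballI)
    fix s :: real assume s: "0 < s"
    show "0 \<in> ?T s" using bsys_0[OF R s] \<nu> s by simp
    fix x assume x: "x \<in> ?T s"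
    then show "- x \<in> ?T s" using bsys_minus[OF R s] by (simp add: norm_echar_minus)
    show "\<bar>real_of_int x\<bar> \<le> s * N" using bsys_bound[OF R s] x by simp
  next
    fix s t :: real and x y assume *: "0 < s" "0 < t" "x \<in> ?T s" "y \<in> ?T t"
    have "cmod (echar \<theta> (x + y) - 1) \<le> \<nu> * (s + t)" if "\<theta> \<in> \<Lambda>" for \<theta>
      using norm_echar_add[of \<theta> x y] * that by (force simp: distrib_left)
    then show "x + y \<in> ?T (s + t)" using bsys_add[OF R, of s t x y] * by simp
  next
    fix s :: real assume s: "0 < s \<and> s \<le> 1"
    then have fin: "finite (B (\<rho> / 2 * s))" using bsys_finite[OF R2] by simp
    \<comment> \<open>Fractional parts in one of the \<open>M\<close> cells differ by at most
      \<open>1 / M\<close>, so the character deviates by at most \<open>2 * pi / M\<close>, which is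
      at most \<open>\<nu> * s\<close>.\<close>
    define M where "M = nat \<lceil>2 * pi / (\<nu> * s)\<rceil>"
    have \<nu>s: "0 < \<nu> * s" "\<nu> * s \<le> 1" using \<nu> s by (auto simp: mult_le_one)
    have M: "2 * pi / (\<nu> * s) \<le> M" unfolding M_def by (rule real_nat_ceiling_ge)
    have "0 < 2 * pi / (\<nu> * s)" using \<nu>s by simp
    then have Mpos: "0 < M" using M by (metis gr0I less_le_not_le of_nat_0)
    have "real M \<le> 2 * pi / (\<nu> * s) + 1"
      unfolding M_def using \<nu>s by (simp add: of_nat_nat)
    also have "\<dots> \<le> 8 / (\<nu> * s) + 1 / (\<nu> * s)"
    proof (rule add_mono)
      show "2 * pi / (\<nu> * s) \<le> 8 / (\<nu> * s)"
        using \<nu>s pi_less_4 by (intro divide_right_mono) auto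
      show "1 \<le> 1 / (\<nu> * s)" using \<nu>s by simp
    qed
    also have "\<dots> = 9 / (\<nu> * s)" by (simp add: add_divide_distrib[symmetric])
    finally have M9: "real M \<le> 9 / (\<nu> * s)" .
    define f where "f x = (\<lambda>\<theta>\<in>\<Lambda>. nat \<lfloor>M * frac (\<theta> * real_of_int x)\<rfloor>)" for x
    let ?C = "PiE \<Lambda> (\<lambda>_. {..<M})"
    have range: "nat \<lfloor>M * frac z\<rfloor> < M" for z :: real
    proof -
      have "M * frac z < M" using Mpos frac_lt_1[of z] by simp
      then have "\<lfloor>M * frac z\<rfloor> < int M" by (simp add: floor_less_iff)
      then show ?thesis using Mpos by linarith
    qed
    have "\<exists>c\<in>?C. card (B (\<rho> / 2 * s)) \<le> card ?C * card {x\<in>B (\<rho> / 2 * s). f x = c}"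
      using fin \<Lambda> range Mpos by (intro large_fibre) (auto simp: finite_PiE f_def PiE_eq_empty_iff)
    then obtain c where c: "card (B (\<rho> / 2 * s)) \<le> card ?C * card {x\<in>B (\<rho> / 2 * s). f x = c}" by blast
    let ?F = "{x\<in>B (\<rho> / 2 * s). f x = c}"
    have "0 < card (B (\<rho> / 2 * s))" using bsys_card_pos[OF R2] s by simp
    then have "0 < card ?F" using c by (cases "card ?F = 0") auto
    then obtain x0 where x0: "x0 \<in> B (\<rho> / 2 * s)" "f x0 = c" by (force simp: card_gt_0_iff)
    have "card ?F \<le> card (?T s)"
    proof (rule card_inj_on_le)
      show "inj_on (\<lambda>x. x - x0) ?F" by (auto simp: inj_on_def)
      show "finite (?T s)" using bsys_finite[OF R] s by simp
      show "(\<lambda>x. x - x0) ` ?F \<subseteq> ?T s"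
      proof clarify
        fix x assume x: "x \<in> B (\<rho> / 2 * s)" "c = f x"
        have "x - x0 \<in> B (\<rho> / 2 * s + \<rho> / 2 * s)"
          using bsys_diff[OF B _ _ x(1) x0(1)] \<rho> s by simp
        moreover have "cmod (echar \<theta> (x - x0) - 1) \<le> \<nu> * s" if "\<theta> \<in> \<Lambda>" for \<theta>
        proof -
          let ?a = "frac (\<theta> * real_of_int x)" and ?b = "frac (\<theta> * real_of_int x0)"
          have "nat \<lfloor>M * ?a\<rfloor> = nat \<lfloor>M * ?b\<rfloor>"
            using x0(2) x(2) that by (metis f_def restrict_apply')
          then have "\<lfloor>M * ?a\<rfloor> = \<lfloor>M * ?b\<rfloor>"
            by (simp add: eq_nat_nat_iff)
          then have "\<bar>M * ?a - M * ?b\<bar> \<le> 1" by linarith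
          then have "M * \<bar>?a - ?b\<bar> \<le> 1" by (simp add: abs_mult right_diff_distrib[symmetric])
          then have "\<bar>?a - ?b\<bar> \<le> 1 / M" using Mpos by (simp add: field_simps)
          then have "2 * pi * \<bar>?a - ?b\<bar> \<le> 2 * pi * (1 / M)" by (intro mult_left_mono) auto
          also have "\<dots> \<le> \<nu> * s"
          proof -
            have "2 * pi \<le> M * (\<nu> * s)" using M \<nu>s(1) by (simp only: pos_divide_le_eq)
            then show ?thesis using Mpos by (simp add: pos_divide_le_eq mult.commute)
          qed
          finally show ?thesis using norm_echar_diff_le_frac[of \<theta> x x0] by linarith
        qed
        ultimately show "x - x0 \<in> B (\<rho> * s) \<and> (\<forall>\<theta>\<in>\<Lambda>. cmod (echar \<theta> (x - x0) - 1) \<le> \<nu> * s)"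
          by simp
      qed
    qed
    then have "card ?C * card ?F \<le> card ?C * card (?T s)" by simp
    with c have "card (B (\<rho> / 2 * s)) \<le> card ?C * card (?T s)" by linarith
    also have "card ?C = M ^ card \<Lambda>" using \<Lambda> by (simp add: card_PiE)
    finally have "real (card (B (\<rho> / 2 * s))) \<le> real (M ^ card \<Lambda> * card (?T s))"
      by (rule of_nat_mono)
    then have le: "real (card (B (\<rho> / 2 * s))) \<le> real M ^ card \<Lambda> * card (?T s)" by simp
    have Tpos: "0 < card (?T s)" using \<open>0 < card ?F\<close> \<open>card ?F \<le> card (?T s)\<close> by linarith
    have "w + d * ln (\<rho> / 2) + d * ln s \<le> ln (card (B (\<rho> / 2 * s)))"
      using bsys_card[OF R2, of s] s by simp
    also have "\<dots> \<le> ln (real M ^ card \<Lambda> * card (?T s))"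
      using le \<open>0 < card (B (\<rho> / 2 * s))\<close> by (intro ln_mono) auto
    also have "\<dots> = card \<Lambda> * ln M + ln (card (?T s))"
      using Mpos Tpos by (simp add: ln_mult ln_realpow)
    finally have 1: "w + d * ln (\<rho> / 2) + d * ln s \<le> card \<Lambda> * ln M + ln (card (?T s))" .
    have "ln M \<le> ln (9 / (\<nu> * s))" using M9 Mpos by (intro ln_mono) auto
    also have "\<dots> = - ln (\<nu> / 9) - ln s" using \<nu> s by (simp add: ln_div ln_mult)
    finally have "card \<Lambda> * ln M \<le> card \<Lambda> * (- ln (\<nu> / 9) - ln s)"
      by (intro mult_left_mono) auto
    then show "w + d * ln (\<rho> / 2) + card \<Lambda> * ln (\<nu> / 9) + (d + card \<Lambda>) * ln s \<le> ln (card (?T s))"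
      using 1 by (simp add: distrib_right right_diff_distrib)
  qed
qed

subsection \<open>Averaging operators and a relative form of Chang's theorem\<close>

text \<open>The index set is kept apart from the shifts because two kinds of average are needed:
  over a system itself, and over the differences of pairs from a set \<open>X\<close>.\<close>

definition avg_op :: "'i set \<Rightarrow> ('i \<Rightarrow> int) \<Rightarrow> (int \<Rightarrow> complex) \<Rightarrow> int \<Rightarrow> complex" where
  "avg_op I \<phi> F x = (\<Sum>i\<in>I. F (x + \<phi> i)) / card I"

text \<open>Characters are eigenfunctions of averaging over shifts, and the eigenvalue is the
  average evaluated at 0.\<close>

lemma avg_op_echar_sum:
  "(avg_op I \<phi> ^^ k) (\<lambda>x. \<Sum>j\<in>J. c j * echar (\<theta> j) x) =
   (\<lambda>x. \<Sum>j\<in>J. c j * avg_op I \<phi> (echar (\<theta> j)) 0 ^ k * echar (\<theta> j) x)"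
proof (induction k)
  case (Suc k)
  have "avg_op I \<phi> (\<lambda>x. \<Sum>j\<in>J. c j * avg_op I \<phi> (echar (\<theta> j)) 0 ^ k * echar (\<theta> j) x) x
      = (\<Sum>j\<in>J. c j * avg_op I \<phi> (echar (\<theta> j)) 0 ^ Suc k * echar (\<theta> j) x)" for x
  proof -
    have "(\<Sum>i\<in>I. \<Sum>j\<in>J. c j * avg_op I \<phi> (echar (\<theta> j)) 0 ^ k * echar (\<theta> j) (x + \<phi> i))
      = (\<Sum>j\<in>J. c j * avg_op I \<phi> (echar (\<theta> j)) 0 ^ k * echar (\<theta> j) x * (\<Sum>i\<in>I. echar (\<theta> j) (\<phi> i)))"
      by (subst sum.swap) (simp add: sum_distrib_left echar_add mult.assoc)
    then show ?thesis
      unfolding avg_op_def[of I \<phi> "\<lambda>x. \<Sum>j\<in>J. _ j x"]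
      by (simp add: avg_op_def[of I \<phi> "echar _" 0] sum_divide_distrib[symmetric] power_Suc2 mult_ac)
  qed
  then show ?case by (simp add: Suc)
qed simp

definition mean :: "int set \<Rightarrow> real \<Rightarrow> complex" where
  "mean S \<theta> = (\<Sum>x\<in>S. echar \<theta> x) / card S"

lemma avg_op_id_eq_mean: "avg_op S (\<lambda>x. x) (echar \<theta>) 0 = mean S \<theta>"
  by (simp add: avg_op_def mean_def)

lemma mean_minus: "mean S (- \<theta>) = cnj (mean S \<theta>)"
  by (simp add: mean_def echar_minus_freq)

lemma norm_mean_le_1: "cmod (mean S \<theta>) \<le> 1"
proof -
  have "cmod (\<Sum>x\<in>S. echar \<theta> x) \<le> (\<Sum>x\<in>S. cmod (echar \<theta> x))" by (rule norm_sum)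
  then show ?thesis by (cases "card S = 0") (simp_all add: mean_def norm_divide)
qed

lemma norm_echar_combination:
  assumes "finite \<Lambda>" "\<And>\<theta>. \<theta> \<in> \<Lambda> \<Longrightarrow> e \<theta> \<in> {-1, 0, 1::real}"
  shows "cmod (echar (\<Sum>\<theta>\<in>\<Lambda>. e \<theta> * \<theta>) t - 1) \<le> (\<Sum>\<theta>\<in>\<Lambda>. cdev \<theta> t)"
  using assms
proof (induction \<Lambda> rule: finite_induct)
  case (insert \<theta> \<Lambda>)
  have "cmod (echar (e \<theta> * \<theta>) t - 1) \<le> cdev \<theta> t"
    using insert.prems[of \<theta>] by (auto simp: norm_echar_minus_freq)
  then show ?case
    using norm_echar_add_freq[of "e \<theta> * \<theta>" "\<Sum>\<theta>\<in>\<Lambda>. e \<theta> * \<theta>" t] insert by fastforce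
qed simp

text \<open>A shift by \<open>y\<close> in \<open>B t\<close> maps \<open>B s\<close> into
  \<open>B (s + t)\<close>, so for nonnegative \<open>P\<close> the sum of each shifted function
  over the larger set dominates. Averaging over \<open>y\<close> and iterating replaces
  \<open>P\<close> by a smoothed function.\<close>

lemma sum_avg_op_ge:
  assumes B: "bsys N d w B" and s: "0 < s" "0 < t" and P: "\<And>x. 0 \<le> Re (P x)"
  shows "(\<Sum>b\<in>B s. Re (P b)) \<le> (\<Sum>b\<in>B (s + real r * t). Re ((avg_op (B t) (\<lambda>x. x) ^^ r) P b))"
  using s(1) P
proof (induction r arbitrary: s P)
  case (Suc r)
  let ?Q = "avg_op (B t) (\<lambda>x. x) P"
  have ReQ: "Re (?Q x) = (\<Sum>y\<in>B t. Re (P (x + y))) / card (B t)" for x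
    by (simp add: avg_op_def)
  have Q: "0 \<le> Re (?Q x)" for x
    unfolding ReQ using Suc.prems(2) by (intro divide_nonneg_nonneg sum_nonneg) auto
  have pos: "0 < card (B t)" by (rule bsys_card_pos[OF B s(2)])
  have "(\<Sum>b\<in>B s. Re (P b)) \<le> (\<Sum>b\<in>B (s + t). Re (P (b + y)))" if y: "y \<in> B t" for y
  proof -
    have "(\<Sum>b\<in>B s. Re (P b)) = (\<Sum>b\<in>(\<lambda>b. b - y) ` B s. Re (P (b + y)))"
      by (subst sum.reindex) (auto simp: inj_on_def)
    also have "\<dots> \<le> (\<Sum>b\<in>B (s + t). Re (P (b + y)))"
      using bsys_diff[OF B Suc.prems(1) s(2) _ y] bsys_finite[OF B] Suc.prems s
      by (intro sum_mono2) auto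
    finally show ?thesis .
  qed
  then have "(\<Sum>y\<in>B t. \<Sum>b\<in>B s. Re (P b)) \<le> (\<Sum>y\<in>B t. \<Sum>b\<in>B (s + t). Re (P (b + y)))"
    by (rule sum_mono)
  then have "card (B t) * (\<Sum>b\<in>B s. Re (P b)) \<le> (\<Sum>b\<in>B (s + t). \<Sum>y\<in>B t. Re (P (b + y)))"
    by (subst sum.swap) simp
  then have "(\<Sum>b\<in>B s. Re (P b)) \<le> (\<Sum>b\<in>B (s + t). Re (?Q b))"
    unfolding ReQ using pos by (simp add: sum_divide_distrib[symmetric] field_simps)
  also have "\<dots> \<le> (\<Sum>b\<in>B (s + t + real r * t). Re ((avg_op (B t) (\<lambda>x. x) ^^ r) ?Q b))"
    using Suc.prems s Q by (intro Suc.IH) auto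
  finally show ?case
    unfolding funpow_Suc_right by (simp add: algebra_simps)
qed simp

text \<open>The logarithm of the Riesz product \<open>p\<close> has average at least
  \<open>card \<Lambda> / 32\<close> over \<open>X\<close>, because every factor is aligned with a
  large mean. The average of \<open>p\<close> itself over \<open>X\<close> is at most
  \<open>2 * C\<close>: the passage to the larger set makes room for \<open>r\<close> averagings
  over \<open>B t\<close>, which damp every non-constant term by \<open>(8/9) ^ r\<close>, while all
  coefficients together have size \<open>(9/8) ^ card \<Lambda>\<close>. Concavity of the logarithm
  compares the two.\<close>

lemma card_le_of_riesz_product:
  fixes C :: real
  assumes B: "bsys N d w B" and s: "0 < s" "0 < t" and X: "X \<subseteq> B s" "X \<noteq> {}"
    and C: "card (B (s + real r * t)) \<le> C * card X"
    and \<Lambda>: "finite \<Lambda>" "card \<Lambda> \<le> r" "\<And>\<theta>. \<theta> \<in> \<Lambda> \<Longrightarrow> 1/2 \<le> cmod (mean X \<theta>)"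
    and dissoc: "\<And>e. e \<in> PiE \<Lambda> (\<lambda>_. {-1, 0, 1::real}) \<Longrightarrow> \<exists>\<theta>\<in>\<Lambda>. e \<theta> \<noteq> 0 \<Longrightarrow>
        cmod (mean (B t) (\<Sum>\<theta>\<in>\<Lambda>. e \<theta> * \<theta>)) \<le> 8/9"
  shows "real (card \<Lambda>) \<le> 32 * ln (2 * C)"
proof -
  define \<omega> where "\<omega> \<theta> = cnj (mean X \<theta>) / cmod (mean X \<theta>)" for \<theta>
  define u where "u \<theta> x = Re (\<omega> \<theta> * echar \<theta> x)" for \<theta> x
  \<comment> \<open>The amplitude \<open>1/8\<close> makes the coefficients of one factor sum to
    \<open>1 + 2/16 = 9/8\<close>, the reciprocal of the damping factor \<open>8/9\<close>.\<close>
  define p where "p x = (\<Prod>\<theta>\<in>\<Lambda>. 1 + u \<theta> x / 8)" for x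
  define a where "a \<theta> e = (if e = 0 then 1 else if e = (1::real) then \<omega> \<theta> / 16 else cnj (\<omega> \<theta>) / 16)" for \<theta> e
  define E where "E = PiE \<Lambda> (\<lambda>_. {-1, 0, 1::real})"
  define c where "c e = (\<Prod>\<theta>\<in>\<Lambda>. a \<theta> (e \<theta>))" for e
  define \<phi> where "\<phi> e = (\<Sum>\<theta>\<in>\<Lambda>. e \<theta> * \<theta>)" for e :: "real \<Rightarrow> real"
  have finX: "finite X" using X bsys_finite[OF B s(1)] finite_subset by blast
  then have cX: "0 < card X" using X by (simp add: card_gt_0_iff)
  have finE: "finite E" using \<Lambda> by (simp add: E_def finite_PiE)
  have nz: "mean X \<theta> \<noteq> 0" if "\<theta> \<in> \<Lambda>" for \<theta> using \<Lambda>(3)[OF that] by auto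
  have norm\<omega>: "cmod (\<omega> \<theta>) = 1" if "\<theta> \<in> \<Lambda>" for \<theta>
    using nz[OF that] by (simp add: \<omega>_def norm_divide)
  have u1: "\<bar>u \<theta> x\<bar> \<le> 1" if "\<theta> \<in> \<Lambda>" for \<theta> x
    using abs_Re_le_cmod[of "\<omega> \<theta> * echar \<theta> x"] norm\<omega>[OF that] by (simp add: u_def norm_mult)
  have factor_pos: "0 < 1 + u \<theta> x / 8" if "\<theta> \<in> \<Lambda>" for \<theta> x
    using u1[OF that, of x] by linarith
  then have factor_ne: "1 + u \<theta> x / 8 \<noteq> 0" if "\<theta> \<in> \<Lambda>" for \<theta> x
    using that by (metis less_irrefl)
  have p_pos: "0 < p x" for x unfolding p_def using factor_pos by (intro prod_pos) auto
  have avg_u: "(\<Sum>x\<in>X. u \<theta> x) \<ge> card X / 2" if "\<theta> \<in> \<Lambda>" for \<theta>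
  proof -
    have "(\<Sum>x\<in>X. u \<theta> x) = Re (\<omega> \<theta> * (\<Sum>x\<in>X. echar \<theta> x))"
      by (simp add: u_def sum_distrib_left)
    also have "(\<Sum>x\<in>X. echar \<theta> x) = card X * mean X \<theta>" using cX by (simp add: mean_def)
    also have "\<omega> \<theta> * (card X * mean X \<theta>) = of_real (card X * cmod (mean X \<theta>))"
      using nz[OF that] complex_norm_square[of "mean X \<theta>"]
      by (simp add: \<omega>_def field_simps power2_eq_square)
    finally show ?thesis using \<Lambda>(3)[OF that] cX by (simp add: field_simps)
  qed
  have expand: "of_real (p x) = (\<Sum>e\<in>E. c e * echar (\<phi> e) x)" for x
  proof -
    have "of_real (1 + u \<theta> x / 8) = (\<Sum>e\<in>{-1, 0, 1}. a \<theta> e * echar (e * \<theta>) x)" for \<theta>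
    proof -
      have "complex_of_real (u \<theta> x) = (\<omega> \<theta> * echar \<theta> x + cnj (\<omega> \<theta>) * cnj (echar \<theta> x)) / 2"
        unfolding u_def by (simp add: complex_eq_iff)
      then show ?thesis by (simp add: a_def echar_minus_freq add_divide_distrib)
    qed
    then have "of_real (p x) = (\<Prod>\<theta>\<in>\<Lambda>. \<Sum>e\<in>{-1, 0, 1}. a \<theta> e * echar (e * \<theta>) x)"
      by (simp add: p_def)
    also have "\<dots> = (\<Sum>e\<in>E. \<Prod>\<theta>\<in>\<Lambda>. a \<theta> (e \<theta>) * echar (e \<theta> * \<theta>) x)"
      unfolding E_def using \<Lambda> by (subst prod_sum_PiE) auto
    also have "\<dots> = (\<Sum>e\<in>E. c e * echar (\<phi> e) x)"
    proof (rule sum.cong[OF refl])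
      fix e
      have "(\<Prod>\<theta>\<in>\<Lambda>. echar (e \<theta> * \<theta>) x) = echar (\<phi> e) x"
        unfolding \<phi>_def using \<Lambda>(1) by (induction \<Lambda> rule: finite_induct) (auto simp: echar_add_freq)
      then show "(\<Prod>\<theta>\<in>\<Lambda>. a \<theta> (e \<theta>) * echar (e \<theta> * \<theta>) x) = c e * echar (\<phi> e) x"
        by (simp add: prod.distrib c_def)
    qed
    finally show ?thesis .
  qed
  have sum_c: "(\<Sum>e\<in>E. cmod (c e)) = (9/8) ^ card \<Lambda>"
  proof -
    have "(\<Sum>e\<in>E. cmod (c e)) = (\<Sum>e\<in>E. \<Prod>\<theta>\<in>\<Lambda>. cmod (a \<theta> (e \<theta>)))"
      by (simp add: c_def prod_norm)
    also have "\<dots> = (\<Prod>\<theta>\<in>\<Lambda>. \<Sum>e\<in>{-1, 0, 1}. cmod (a \<theta> e))"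
      unfolding E_def using \<Lambda> by (subst prod_sum_PiE) auto
    also have "\<dots> = (\<Prod>\<theta>\<in>\<Lambda>. 9/8)"
      using norm\<omega> by (intro prod.cong) (auto simp: a_def norm_divide)
    finally show ?thesis by simp
  qed
  let ?m = "mean (B t)"
  define B' where "B' = B (s + real r * t)"
  have "(\<Sum>x\<in>X. p x) \<le> (\<Sum>x\<in>B s. Re (of_real (p x)))"
    using X bsys_finite[OF B s(1)] p_pos by (simp, intro sum_mono2) (auto intro: less_imp_le)
  also have "\<dots> \<le> (\<Sum>b\<in>B'. Re ((avg_op (B t) (\<lambda>x. x) ^^ r) (\<lambda>x. of_real (p x)) b))"
    unfolding B'_def using p_pos by (intro sum_avg_op_ge[OF B s]) (auto intro: less_imp_le)
  also have "\<dots> \<le> (\<Sum>b\<in>B'. 2)"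
  proof (rule sum_mono)
    fix b
    let ?e0 = "\<lambda>\<theta>\<in>\<Lambda>. 0::real"
    have e0: "?e0 \<in> E" by (simp add: E_def)
    have c0: "c ?e0 = 1" "\<phi> ?e0 = 0" by (simp_all add: c_def a_def \<phi>_def)
    have le: "cmod (c e * ?m (\<phi> e) ^ r * echar (\<phi> e) b) \<le> cmod (c e) * (8/9) ^ r"
      if e: "e \<in> E - {?e0}" for e
    proof -
      have "\<exists>\<theta>\<in>\<Lambda>. e \<theta> \<noteq> 0"
      proof (rule ccontr)
        assume "\<not> ?thesis"
        then have "e = ?e0" using e by (intro PiE_ext[of e \<Lambda> "\<lambda>_. {-1,0,1}"]) (auto simp: E_def)
        then show False using e by simp
      qed
      then have "cmod (?m (\<phi> e)) \<le> 8/9" using dissoc e unfolding E_def \<phi>_def by blast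
      then have "cmod (?m (\<phi> e)) ^ r \<le> (8/9) ^ r" by (intro power_mono) auto
      then show ?thesis by (simp add: norm_mult norm_power mult_left_mono)
    qed
    have "Re ((avg_op (B t) (\<lambda>x. x) ^^ r) (\<lambda>x. of_real (p x)) b)
        \<le> cmod (\<Sum>e\<in>E. c e * ?m (\<phi> e) ^ r * echar (\<phi> e) b)"
      unfolding expand avg_op_echar_sum avg_op_id_eq_mean by (rule complex_Re_le_cmod)
    also have "\<dots> \<le> cmod (c ?e0 * ?m (\<phi> ?e0) ^ r * echar (\<phi> ?e0) b)
        + (\<Sum>e\<in>E - {?e0}. cmod (c e * ?m (\<phi> e) ^ r * echar (\<phi> e) b))"
      unfolding sum.remove[OF finE e0]
      by (rule order_trans[OF norm_triangle_ineq add_left_mono[OF norm_sum]])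
    also have "\<dots> \<le> 1 + (\<Sum>e\<in>E - {?e0}. cmod (c e) * (8/9) ^ r)"
    proof (rule add_mono)
      show "cmod (c ?e0 * ?m (\<phi> ?e0) ^ r * echar (\<phi> ?e0) b) \<le> 1"
        unfolding c0 using norm_mean_le_1[of "B t" 0] by (simp add: norm_mult norm_power power_le_one)
    qed (rule sum_mono, rule le)
    also have "\<dots> \<le> 1 + (\<Sum>e\<in>E. cmod (c e)) * (8/9) ^ r"
      using finE by (simp add: sum_distrib_right, intro sum_mono2) auto
    also have "\<dots> \<le> 1 + (9/8) ^ r * (8/9) ^ r"
      unfolding sum_c using \<Lambda>(2) by (intro add_left_mono mult_right_mono power_increasing) auto
    also have "\<dots> = 2" by (simp add: power_mult_distrib[symmetric])
    finally show "Re ((avg_op (B t) (\<lambda>x. x) ^^ r) (\<lambda>x. of_real (p x)) b) \<le> 2" .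
  qed
  finally have sum_p: "(\<Sum>x\<in>X. p x) \<le> 2 * C * card X" using C by (simp add: B'_def)
  have "0 < (\<Sum>x\<in>X. p x)" using finX X p_pos by (intro sum_pos) auto
  then have "0 < 2 * C * card X" using sum_p by linarith
  then have Cpos: "0 < 2 * C" using cX by (simp add: zero_less_mult_iff)
  have "card \<Lambda> * (card X / 32) = (\<Sum>\<theta>\<in>\<Lambda>. card X / 32)" by simp
  also have "\<dots> \<le> (\<Sum>\<theta>\<in>\<Lambda>. \<Sum>x\<in>X. ln (1 + u \<theta> x / 8))"
  proof (rule sum_mono)
    fix \<theta> assume \<theta>: "\<theta> \<in> \<Lambda>"
    \<comment> \<open>Averaged over \<open>X\<close> the linear term is at least
      \<open>1/16\<close>, and the quadratic error is at most \<open>2/64 = 1/32\<close>; this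
      leaves \<open>1/32\<close> for each frequency.\<close>
    have "u \<theta> x / 8 - 1 / 32 \<le> ln (1 + u \<theta> x / 8)" for x
    proof -
      have "\<bar>ln (1 + u \<theta> x / 8) - u \<theta> x / 8\<bar> \<le> 2 * (u \<theta> x / 8)\<^sup>2"
        using u1[OF \<theta>, of x] by (intro abs_ln_one_plus_x_minus_x_bound) auto
      moreover have "(u \<theta> x / 8)\<^sup>2 \<le> 1 / 64"
        using u1[OF \<theta>, of x] by (simp add: power_divide abs_square_le_1)
      ultimately show ?thesis by linarith
    qed
    then have "(\<Sum>x\<in>X. u \<theta> x / 8 - 1 / 32) \<le> (\<Sum>x\<in>X. ln (1 + u \<theta> x / 8))"
      by (rule sum_mono)
    then show "card X / 32 \<le> (\<Sum>x\<in>X. ln (1 + u \<theta> x / 8))"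
      using avg_u[OF \<theta>] by (simp add: sum_subtractf sum_divide_distrib[symmetric])
  qed
  also have "\<dots> = (\<Sum>x\<in>X. ln (p x))"
    unfolding p_def by (subst sum.swap) (intro sum.cong refl ln_prod[symmetric]; use factor_ne \<Lambda> in auto)
  \<comment> \<open>The logarithm is bounded by its tangent at \<open>2 * C\<close>.\<close>
  also have "\<dots> \<le> (\<Sum>x\<in>X. p x / (2 * C) - 1 + ln (2 * C))"
  proof (rule sum_mono)
    fix x
    have "ln (p x / (2 * C)) \<le> p x / (2 * C) - 1"
      using p_pos Cpos by (intro ln_le_minus_one) auto
    then show "ln (p x) \<le> p x / (2 * C) - 1 + ln (2 * C)"
      using p_pos[of x] Cpos by (simp add: ln_div split: if_splits)
  qed
  also have "\<dots> = (\<Sum>x\<in>X. p x) / (2 * C) - card X + card X * ln (2 * C)"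
    by (simp add: sum.distrib sum_subtractf sum_divide_distrib)
  also have "\<dots> \<le> card X * ln (2 * C)"
    using sum_p Cpos by (simp add: field_simps)
  finally show ?thesis using cX by (simp add: field_simps)
qed

text \<open>\<open>\<Lambda>\<close> is a maximal subset of the large spectrum of \<open>X\<close>
  that is dissociated relative to means over \<open>B t\<close>. For a further
  \<open>\<theta>\<close>, maximality gives a relation with coefficients -1, 0, 1 whose value has a
  large mean on \<open>B t\<close>. The coefficient of \<open>\<theta>\<close> is 1 or -1, so the
  relation can be solved for \<open>\<theta>\<close>.\<close>

lemma relative_chang:
  fixes C :: real
  assumes B: "bsys N d w B" and s: "0 < s" "0 < t" and X: "X \<subseteq> B s" "X \<noteq> {}"
    and C: "card (B (s + real r * t)) \<le> C * card X" and r: "32 * ln (2 * C) < r"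
  shows "\<exists>\<Lambda>. finite \<Lambda> \<and> card \<Lambda> < r \<and> (\<forall>\<theta>. 1/2 \<le> cmod (mean X \<theta>) \<longrightarrow>
     (\<exists>\<phi>. 8/9 \<le> cmod (mean (B t) \<phi>) \<and>
        (\<forall>z. cdev \<theta> z \<le> (\<Sum>\<mu>\<in>\<Lambda>. cdev \<mu> z) + cdev \<phi> z)))"
proof -
  define E where "E \<Lambda> = PiE \<Lambda> (\<lambda>_. {-1, 0, 1::real})" for \<Lambda> :: "real set"
  define D where "D \<Lambda> \<longleftrightarrow> finite \<Lambda> \<and> (\<forall>\<theta>\<in>\<Lambda>. 1/2 \<le> cmod (mean X \<theta>)) \<and>
     (\<forall>e\<in>E \<Lambda>. (\<exists>\<theta>\<in>\<Lambda>. e \<theta> \<noteq> 0) \<longrightarrow> cmod (mean (B t) (\<Sum>\<theta>\<in>\<Lambda>. e \<theta> * \<theta>)) \<le> 8/9)" for \<Lambda>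
  have bound: "card \<Lambda> < r" if "D \<Lambda>" "card \<Lambda> \<le> r" for \<Lambda>
  proof -
    have "real (card \<Lambda>) \<le> 32 * ln (2 * C)"
      using that unfolding D_def E_def by (intro card_le_of_riesz_product[OF B s X C]) auto
    then show ?thesis using r by linarith
  qed
  \<comment> \<open>Maximality is taken among sets of size at most \<open>r\<close>, the range of
    the Riesz product bound. The bound is strictly below \<open>r\<close>, so adding one element
    does not leave the range.\<close>
  have "\<exists>\<Lambda>. (D \<Lambda> \<and> card \<Lambda> \<le> r) \<and> (\<forall>\<Lambda>'. D \<Lambda>' \<and> card \<Lambda>' \<le> r \<longrightarrow> card \<Lambda>' \<le> card \<Lambda>)"
    by (rule ex_has_greatest_nat[of _ "{}" _ "Suc r"]) (auto simp: D_def)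
  then obtain \<Lambda> where \<Lambda>: "D \<Lambda>" "card \<Lambda> \<le> r" "\<And>\<Lambda>'. D \<Lambda>' \<Longrightarrow> card \<Lambda>' \<le> r \<Longrightarrow> card \<Lambda>' \<le> card \<Lambda>"
    by blast
  have fin: "finite \<Lambda>" using \<Lambda>(1) by (simp add: D_def)
  have "\<exists>\<phi>. 8/9 \<le> cmod (mean (B t) \<phi>) \<and>
        (\<forall>z. cdev \<theta> z \<le> (\<Sum>\<mu>\<in>\<Lambda>. cdev \<mu> z) + cdev \<phi> z)"
    if \<theta>: "1/2 \<le> cmod (mean X \<theta>)" for \<theta>
  proof (cases "\<theta> \<in> \<Lambda>")
    case True
    have "mean (B t) 0 = 1" using bsys_card_pos[OF B s(2)] by (simp add: mean_def)
    moreover have "cdev \<theta> z \<le> (\<Sum>\<mu>\<in>\<Lambda>. cdev \<mu> z)" for z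
      using fin True by (intro member_le_sum) auto
    ultimately show ?thesis by (intro exI[of _ 0]) auto
  next
    case False
    have "\<not> D (insert \<theta> \<Lambda>)"
      using \<Lambda>(3)[of "insert \<theta> \<Lambda>"] bound[OF \<Lambda>(1,2)] False fin by auto
    then obtain e where e: "e \<in> E (insert \<theta> \<Lambda>)" "\<exists>\<mu>\<in>insert \<theta> \<Lambda>. e \<mu> \<noteq> 0"
      and big: "8/9 < cmod (mean (B t) (\<Sum>\<mu>\<in>insert \<theta> \<Lambda>. e \<mu> * \<mu>))"
      using \<Lambda>(1) \<theta> unfolding D_def by (auto simp: not_le)
    let ?S = "\<Sum>\<mu>\<in>\<Lambda>. e \<mu> * \<mu>"
    have eval: "e \<mu> \<in> {-1, 0, 1}" if "\<mu> \<in> insert \<theta> \<Lambda>" for \<mu>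
      using e(1) that unfolding E_def by (rule PiE_mem)
    have "e \<theta> \<noteq> 0"
    proof
      assume 0: "e \<theta> = 0"
      have "restrict e \<Lambda> \<in> E \<Lambda>" using eval by (auto simp: E_def)
      moreover have "\<exists>\<mu>\<in>\<Lambda>. restrict e \<Lambda> \<mu> \<noteq> 0" using e(2) 0 by auto
      ultimately have "cmod (mean (B t) (\<Sum>\<mu>\<in>\<Lambda>. restrict e \<Lambda> \<mu> * \<mu>)) \<le> 8/9"
        using \<Lambda>(1) unfolding D_def by blast
      then show False using big 0 fin False by (simp cong: sum.cong)
    qed
    then have pm: "e \<theta> = 1 \<or> e \<theta> = -1" using eval[of \<theta>] by auto
    define \<phi> where "\<phi> = \<theta> + e \<theta> * ?S"
    have "\<phi> = e \<theta> * (\<Sum>\<mu>\<in>insert \<theta> \<Lambda>. e \<mu> * \<mu>)"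
      using pm fin False by (auto simp: \<phi>_def)
    then have "8/9 \<le> cmod (mean (B t) \<phi>)"
      using pm big by (auto simp: mean_minus[of _ "\<Sum>\<mu>\<in>insert \<theta> \<Lambda>. e \<mu> * \<mu>"])
    moreover have "cdev \<theta> z \<le> (\<Sum>\<mu>\<in>\<Lambda>. cdev \<mu> z) + cdev \<phi> z" for z
    proof -
      have "\<theta> = (\<Sum>\<mu>\<in>\<Lambda>. (- e \<theta> * e \<mu>) * \<mu>) + \<phi>"
        by (simp add: \<phi>_def sum_distrib_left sum_negf mult.assoc)
      then have "cdev \<theta> z
          \<le> cmod (echar (\<Sum>\<mu>\<in>\<Lambda>. (- e \<theta> * e \<mu>) * \<mu>) z - 1) + cdev \<phi> z"
        by (metis norm_echar_add_freq)
      also have "cmod (echar (\<Sum>\<mu>\<in>\<Lambda>. (- e \<theta> * e \<mu>) * \<mu>) z - 1) \<le> (\<Sum>\<mu>\<in>\<Lambda>. cdev \<mu> z)"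
        using eval pm by (intro norm_echar_combination fin) fastforce
      finally show ?thesis by simp
    qed
    ultimately show ?thesis by blast
  qed
  then show ?thesis using fin bound[OF \<Lambda>(1,2)] by blast
qed

subsection \<open>Almost periodicity outside a small set\<close>

lemma exp_le_quadratic:
  fixes v :: real
  assumes "\<bar>v\<bar> \<le> 1"
  shows "exp v \<le> 1 + v + v\<^sup>2"
proof (cases "0 \<le> v")
  case True
  then show ?thesis using exp_bound[of v] assms by simp
next
  case False
  have "1 \<le> (1 + v + v\<^sup>2) * (1 - v)"
  proof -
    have "v ^ 3 \<le> 0" using False by (simp add: power_less_zero_eq less_imp_le)
    then show ?thesis by (simp add: algebra_simps power2_eq_square power3_eq_cube)
  qed
  also have "\<dots> \<le> (1 + v + v\<^sup>2) * exp (- v)"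
  proof (rule mult_left_mono)
    show "1 - v \<le> exp (- v)" using exp_ge_add_one_self[of "- v"] by simp
    show "0 \<le> 1 + v + v\<^sup>2" using assms by (simp add: abs_le_iff add_nonneg_nonneg)
  qed
  finally show ?thesis by (simp add: exp_minus field_simps)
qed

text \<open>Exponential moments: the optimal parameter \<open>s = \<epsilon> / 2\<close> gives the
  exponent \<open>s\<^sup>2 * n - s * \<epsilon> * n = - \<epsilon>\<^sup>2 * n / 4\<close>.\<close>

lemma card_large_deviation:
  fixes y :: "'a \<Rightarrow> real"
  assumes P: "finite P" "P \<noteq> {}" and y: "\<And>p. p \<in> P \<Longrightarrow> \<bar>y p\<bar> \<le> 1" "(\<Sum>p\<in>P. y p) = 0"
    and \<epsilon>: "0 \<le> \<epsilon>" "\<epsilon> \<le> 2"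
  shows "card {u\<in>PiE {..<n} (\<lambda>_. P). \<epsilon> * n \<le> (\<Sum>i<n. y (u i))} \<le> card P ^ n * exp (- (\<epsilon>\<^sup>2 * n / 4))"
proof -
  define s where "s = \<epsilon> / 2"
  define U where "U = PiE {..<n} (\<lambda>_. P)"
  define W where "W = {u\<in>U. \<epsilon> * n \<le> (\<Sum>i<n. y (u i))}"
  have finU: "finite U" using P by (simp add: U_def finite_PiE)
  have "card W * exp (s * (\<epsilon> * n)) = (\<Sum>u\<in>W. exp (s * (\<epsilon> * n)))" by simp
  also have "\<dots> \<le> (\<Sum>u\<in>W. exp (s * (\<Sum>i<n. y (u i))))"
    using \<epsilon> by (intro sum_mono) (auto simp: W_def s_def intro!: mult_left_mono)
  also have "\<dots> \<le> (\<Sum>u\<in>U. exp (s * (\<Sum>i<n. y (u i))))"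
    using finU by (intro sum_mono2) (auto simp: W_def)
  also have "\<dots> = (\<Sum>u\<in>U. \<Prod>i<n. exp (s * y (u i)))"
    by (simp add: exp_sum sum_distrib_left)
  also have "\<dots> = (\<Prod>i<n. \<Sum>p\<in>P. exp (s * y p))"
    unfolding U_def using P by (subst prod_sum_PiE) auto
  also have "\<dots> \<le> (\<Prod>i<n. card P * exp (s\<^sup>2))"
  proof (rule prod_mono)
    fix i
    have "(\<Sum>p\<in>P. exp (s * y p)) \<le> (\<Sum>p\<in>P. 1 + s * y p + s\<^sup>2)"
    proof (rule sum_mono)
      fix p assume p: "p \<in> P"
      have y1: "\<bar>y p\<bar> \<le> 1" by (rule y(1)[OF p])
      then have "\<bar>s * y p\<bar> \<le> 1"
        using \<epsilon> unfolding abs_mult by (intro mult_le_one) (auto simp: s_def)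
      then have "exp (s * y p) \<le> 1 + s * y p + (s * y p)\<^sup>2" by (rule exp_le_quadratic)
      also have "(s * y p)\<^sup>2 \<le> s\<^sup>2"
        using y1 by (simp add: power_mult_distrib mult_left_le abs_square_le_1)
      finally show "exp (s * y p) \<le> 1 + s * y p + s\<^sup>2" by simp
    qed
    also have "\<dots> = card P * (1 + s\<^sup>2)"
      using y(2) by (simp add: sum.distrib sum_distrib_left[symmetric] algebra_simps)
    also have "\<dots> \<le> card P * exp (s\<^sup>2)"
      using exp_ge_add_one_self[of "s\<^sup>2"] by (intro mult_left_mono) auto
    finally show "0 \<le> (\<Sum>p\<in>P. exp (s * y p)) \<and> (\<Sum>p\<in>P. exp (s * y p)) \<le> card P * exp (s\<^sup>2)"
      by (simp add: sum_nonneg)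
  qed
  also have "\<dots> = card P ^ n * exp (s\<^sup>2 * n)"
    by (simp add: power_mult_distrib exp_of_nat_mult[symmetric] mult.commute)
  finally have "card W \<le> card P ^ n * exp (s\<^sup>2 * n) / exp (s * (\<epsilon> * n))"
    by (simp add: field_simps)
  also have "\<dots> = card P ^ n * exp (s\<^sup>2 * n - s * (\<epsilon> * n))" by (simp add: exp_diff)
  also have "s\<^sup>2 * n - s * (\<epsilon> * n) = - (\<epsilon>\<^sup>2 * n / 4)"
    by (simp add: s_def power2_eq_square algebra_simps)
  finally show ?thesis by (simp add: W_def U_def)
qed

lemma card_large_deviation_abs:
  fixes y :: "'a \<Rightarrow> real"
  assumes P: "finite P" "P \<noteq> {}" and y: "\<And>p. p \<in> P \<Longrightarrow> \<bar>y p\<bar> \<le> 1" "(\<Sum>p\<in>P. y p) = 0"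
    and \<epsilon>: "0 \<le> \<epsilon>" "\<epsilon> \<le> 2"
  shows "card {u\<in>PiE {..<n} (\<lambda>_. P). \<epsilon> * n \<le> \<bar>\<Sum>i<n. y (u i)\<bar>}
    \<le> 2 * card P ^ n * exp (- (\<epsilon>\<^sup>2 * n / 4))"
proof -
  let ?U = "PiE {..<n} (\<lambda>_. P)"
  let ?V = "{u\<in>?U. \<epsilon> * n \<le> (\<Sum>i<n. y (u i))}" and ?W = "{u\<in>?U. \<epsilon> * n \<le> (\<Sum>i<n. - y (u i))}"
  have "card {u\<in>?U. \<epsilon> * n \<le> \<bar>\<Sum>i<n. y (u i)\<bar>} \<le> card (?V \<union> ?W)"
    using P by (intro card_mono) (auto simp: finite_PiE sum_negf abs_if split: if_splits)
  also have "\<dots> \<le> card ?V + card ?W" by (rule card_Un_le)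
  finally show ?thesis
    using card_large_deviation[OF P y \<epsilon>, of n] card_large_deviation[OF P, of "\<lambda>p. - y p", OF _ _ \<epsilon>, of n] y
    by (simp add: sum_negf)
qed

lemma shifted_tuple_inject:
  fixes t :: int
  assumes "u \<in> PiE I (\<lambda>_. P)" "u' \<in> PiE I (\<lambda>_. P)" "(\<lambda>i\<in>I. u i + t) = (\<lambda>i\<in>I. u' i + t)"
  shows "u = u'"
proof (rule PiE_ext[OF assms(1,2)])
  fix i assume i: "i \<in> I"
  have "(\<lambda>i\<in>I. u i + t) i = (\<lambda>i\<in>I. u' i + t) i" using assms(3) by (rule fun_cong)
  then show "u i = u' i" using i by simp
qed

text \<open>At least half of the \<open>n\<close>-tuples \<open>u\<close> from \<open>P\<close>
  approximate \<open>cnt S x P / card P\<close> by sampling, except at few \<open>x\<close>. A tuple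
  shifted by \<open>t\<close> has entries in \<open>V\<close>, so pigeonhole gives one tuple
  \<open>v\<close> equal to \<open>u + t\<close> for many \<open>t\<close>, each with its own good
  \<open>u\<close>. The sample average \<open>h\<close> along \<open>v\<close> then gives the
  approximation \<open>h (x - t)\<close> at \<open>x\<close> for all these \<open>t\<close> at
  once.\<close>

lemma croot_sisask:
  fixes K \<epsilon> \<xi> :: real
  assumes P: "finite P" "P \<noteq> {}" and T: "finite T"
    and V: "finite V" "\<And>p t. p \<in> P \<Longrightarrow> t \<in> T \<Longrightarrow> p + t \<in> V" "card V \<le> K * card P"
    and D: "finite D" and n: "0 < n"
    and \<epsilon>: "0 < \<epsilon>" "\<epsilon> \<le> 2" and \<xi>: "0 < \<xi>" "4 * exp (- (\<epsilon>\<^sup>2 * n / 4)) \<le> \<xi>"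
  shows "\<exists>X h bad. X \<subseteq> T \<and> card T \<le> 2 * K ^ n * card X \<and>
     (\<forall>t\<in>X. bad t \<subseteq> D \<and> card (bad t) \<le> \<xi> * card D \<and>
        (\<forall>x\<in>D - bad t. \<bar>h (x - t) - cnt S x P / card P\<bar> \<le> \<epsilon>))"
proof -
  define U where "U = PiE {..<n} (\<lambda>_. P)"
  define g where "g x = real (cnt S x P) / card P" for x
  define smp where "smp u x = (\<Sum>i<n. of_bool (x + u i \<in> S)) / real n" for u :: "nat \<Rightarrow> int" and x
  define bad where "bad u = {x\<in>D. \<epsilon> < \<bar>smp u x - g x\<bar>}" for u
  define good where "good = {u\<in>U. card (bad u) \<le> \<xi> * card D}"
  have cP: "0 < card P" using P by (simp add: card_gt_0_iff)
  have finU: "finite U" using P by (simp add: U_def finite_PiE)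
  have cardU: "card U = card P ^ n" by (simp add: U_def card_PiE)
  have "card {u\<in>U. \<epsilon> < \<bar>smp u x - g x\<bar>} \<le> \<xi> / 2 * card P ^ n" for x
  proof -
    define y where "y p = of_bool (x + p \<in> S) - g x" for p
    have g01: "0 \<le> g x" "g x \<le> 1"
      using cnt_le[OF P(1), of S x] cP by (auto simp: g_def)
    have "card {u\<in>U. \<epsilon> < \<bar>smp u x - g x\<bar>} \<le> card {u\<in>U. \<epsilon> * n \<le> \<bar>\<Sum>i<n. y (u i)\<bar>}"
    proof (intro card_mono)
      have eq: "(\<Sum>i<n. y (u i)) = n * (smp u x - g x)" for u
        using n by (simp add: y_def smp_def sum_subtractf field_simps)
      have "\<epsilon> * n \<le> \<bar>\<Sum>i<n. y (u i)\<bar>" if "\<epsilon> < \<bar>smp u x - g x\<bar>" for u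
        unfolding eq abs_mult mult.commute[of \<epsilon>] using that \<epsilon> by (intro mult_mono) auto
      then show "{u\<in>U. \<epsilon> < \<bar>smp u x - g x\<bar>} \<subseteq> {u\<in>U. \<epsilon> * n \<le> \<bar>\<Sum>i<n. y (u i)\<bar>}"
        by blast
    qed (use finU in auto)
    also have "real \<dots> \<le> 2 * card P ^ n * exp (- (\<epsilon>\<^sup>2 * n / 4))"
      unfolding U_def
    proof (rule card_large_deviation_abs[OF P])
      show "\<bar>y p\<bar> \<le> 1" for p using g01 by (auto simp: y_def)
      show "(\<Sum>p\<in>P. y p) = 0"
        using cP P by (simp add: y_def sum_subtractf g_def cnt_sum)
    qed (use \<epsilon> in auto)
    also have "\<dots> = (2 * exp (- (\<epsilon>\<^sup>2 * n / 4))) * card P ^ n" by simp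
    also have "\<dots> \<le> \<xi> / 2 * card P ^ n" using \<xi> by (intro mult_right_mono) auto
    finally show ?thesis by simp
  qed
  then have "(\<Sum>x\<in>D. real (card {u\<in>U. \<epsilon> < \<bar>smp u x - g x\<bar>})) \<le> (\<Sum>x\<in>D. \<xi> / 2 * card P ^ n)"
    by (rule sum_mono)
  moreover have "(\<Sum>x\<in>D. real (card {u\<in>U. \<epsilon> < \<bar>smp u x - g x\<bar>})) = (\<Sum>u\<in>U. real (card (bad u)))"
    unfolding bad_def by (simp only: card_filter_sum[OF D] card_filter_sum[OF finU], rule sum.swap)
  ultimately have sum_bad: "(\<Sum>u\<in>U. real (card (bad u))) \<le> card D * (\<xi> / 2 * card P ^ n)" by simp
  \<comment> \<open>Markov's inequality: on average a tuple has at most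
    \<open>\<xi> * card D / 2\<close> bad points.\<close>
  have "card P ^ n \<le> 2 * real (card good)"
  proof (cases "D = {}")
    case True
    then have "good = U" by (auto simp: good_def bad_def)
    then show ?thesis using cardU by simp
  next
    case False
    then have cD: "0 < card D" using D by (simp add: card_gt_0_iff)
    have "card (U - good) * (\<xi> * card D) = (\<Sum>u\<in>U - good. \<xi> * card D)" by simp
    also have "\<dots> \<le> (\<Sum>u\<in>U - good. real (card (bad u)))"
      by (intro sum_mono) (auto simp: good_def)
    also have "\<dots> \<le> (\<Sum>u\<in>U. real (card (bad u)))" using finU by (intro sum_mono2) auto
    also note sum_bad
    finally have "card (U - good) * (\<xi> * card D) \<le> (card P ^ n / 2) * (\<xi> * card D)"
      by (simp add: algebra_simps)
    then have "card (U - good) \<le> real (card P) ^ n / 2"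
      using cD \<xi> by (subst (asm) mult_le_cancel_right_pos) auto
    moreover have "card U = card good + card (U - good)"
      using finU by (subst card_Diff_subset) (auto simp: good_def card_mono)
    ultimately have "real (card good) + real (card (U - good)) = real (card P) ^ n"
      using cardU by (metis of_nat_add of_nat_power)
    then show ?thesis using \<open>card (U - good) \<le> real (card P) ^ n / 2\<close> by simp
  qed
  define W where "W = PiE {..<n} (\<lambda>_. V)"
  define \<Phi> where "\<Phi> z = (\<lambda>i\<in>{..<n}. fst z i + snd z)" for z :: "(nat \<Rightarrow> int) \<times> int"
  have fingood: "finite good" using finU by (simp add: good_def)
  show ?thesis
  proof (cases "T = {}")
    case True
    then show ?thesis by (intro exI[of _ "{}"]) auto
  next
    case False
    then have "V \<noteq> {}" using P V by (metis all_not_in_conv)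
    then have "W \<noteq> {}" "finite W" using V by (auto simp: W_def finite_PiE PiE_eq_empty_iff)
    moreover have "\<Phi> z \<in> W" if z: "z \<in> good \<times> T" for z
    proof -
      have "fst z \<in> U" "snd z \<in> T" using z by (auto simp: good_def)
      then have "fst z i + snd z \<in> V" if "i < n" for i
        using V(2) PiE_mem[of "fst z" "{..<n}" "\<lambda>_. P" i] that by (simp add: U_def)
      then show ?thesis by (simp add: W_def \<Phi>_def restrict_PiE_iff)
    qed
    ultimately have "\<exists>v\<in>W. card (good \<times> T) \<le> card W * card {z\<in>good \<times> T. \<Phi> z = v}"
      using fingood T by (intro large_fibre) auto
    then obtain v where v: "v \<in> W" "card (good \<times> T) \<le> card W * card {z\<in>good \<times> T. \<Phi> z = v}" by blast
    define Y where "Y = {z\<in>good \<times> T. \<Phi> z = v}"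
    define X where "X = snd ` Y"
    have Y1: "fst z \<in> good" and Y2: "\<Phi> z = v" if "z \<in> Y" for z
    proof -
      show "fst z \<in> good"
        using that unfolding Y_def mem_Collect_eq mem_Times_iff by (elim conjE)
      show "\<Phi> z = v"
        using that unfolding Y_def mem_Collect_eq by (elim conjE)
    qed
    have "inj_on snd Y"
    proof (rule inj_onI)
      fix a b assume *: "a \<in> Y" "b \<in> Y" "snd a = snd b"
      have "fst a = fst b"
      proof (rule shifted_tuple_inject)
        show "fst a \<in> PiE {..<n} (\<lambda>_. P)" "fst b \<in> PiE {..<n} (\<lambda>_. P)"
          using Y1[OF *(1)] Y1[OF *(2)] by (simp_all add: good_def U_def)
        have "\<Phi> a = \<Phi> b" by (rule trans[OF Y2[OF *(1)] Y2[OF *(2), symmetric]])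
        then show "(\<lambda>i\<in>{..<n}. fst a i + snd a) = (\<lambda>i\<in>{..<n}. fst b i + snd a)"
          unfolding \<Phi>_def *(3)[symmetric] .
      qed
      then show "a = b" using *(3) by (rule prod_eqI)
    qed
    then have "card Y = card X" by (simp add: X_def card_image)
    then have "card {z\<in>good \<times> T. \<Phi> z = v} \<le> card X" by (simp only: Y_def)
    then have "card (good \<times> T) \<le> card W * card X"
      by (rule le_trans[OF v(2) mult_le_mono2])
    moreover have "card W = card V ^ n" by (simp add: W_def card_PiE)
    ultimately have "card good * card T \<le> card V ^ n * card X"
      by (simp only: card_cartesian_product)
    then have "real (card good * card T) \<le> real (card V ^ n * card X)" by (rule of_nat_mono)
    then have "real (card good) * card T \<le> real (card V) ^ n * card X" by simp
    also have "\<dots> \<le> (K * card P) ^ n * card X"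
      using V(3) by (intro mult_right_mono power_mono) auto
    finally have "2 * real (card good) * card T \<le> 2 * K ^ n * card X * card P ^ n"
      by (simp add: power_mult_distrib mult_ac)
    moreover have "real (card P) ^ n * card T \<le> 2 * real (card good) * card T"
      using \<open>card P ^ n \<le> 2 * real (card good)\<close> by (intro mult_right_mono) auto
    ultimately have "card T * real (card P) ^ n \<le> (2 * K ^ n * card X) * real (card P) ^ n"
      by (simp add: mult_ac)
    then have "card T \<le> 2 * K ^ n * card X" using cP by (subst (asm) mult_le_cancel_right_pos) auto
    moreover
    define h where "h x = (\<Sum>i<n. of_bool (x + v i \<in> S)) / real n" for x
    define uu where "uu t = (SOME u. (u, t) \<in> Y)" for t
    have "bad (uu t) \<subseteq> D \<and> card (bad (uu t)) \<le> \<xi> * card D \<and>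
        (\<forall>x\<in>D - bad (uu t). \<bar>h (x - t) - cnt S x P / card P\<bar> \<le> \<epsilon>)" if t: "t \<in> X" for t
    proof -
      have "\<exists>u. (u, t) \<in> Y" using t by (force simp: X_def)
      then have "(uu t, t) \<in> Y" unfolding uu_def by (rule someI_ex)
      then have good: "uu t \<in> good" and \<Phi>: "\<Phi> (uu t, t) = v"
        using Y1[of "(uu t, t)"] Y2[of "(uu t, t)"] by simp_all
      have v_eq: "v i = uu t i + t" if "i < n" for i
        using fun_cong[OF \<Phi>, of i] that by (simp add: \<Phi>_def)
      have "smp (uu t) x = h (x - t)" for x
        unfolding smp_def h_def using v_eq by (intro arg_cong2[where f = "(/)"] sum.cong refl) simp
      then show ?thesis
        using good unfolding good_def bad_def g_def by auto
    qed
    moreover have "X \<subseteq> T" by (auto simp: X_def Y_def)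
    ultimately have "X \<subseteq> T \<and> card T \<le> 2 * K ^ n * card X \<and>
     (\<forall>t\<in>X. bad (uu t) \<subseteq> D \<and> card (bad (uu t)) \<le> \<xi> * card D \<and>
        (\<forall>x\<in>D - bad (uu t). \<bar>h (x - t) - cnt S x P / card P\<bar> \<le> \<epsilon>))"
      by simp
    then show ?thesis
      by (intro exI[of _ X] exI[of _ h] exI[of _ "\<lambda>t. bad (uu t)"])
  qed
qed

lemma of_real_of_bool: "complex_of_real (of_bool b) = of_bool b"
  by (cases b) simp_all

subsection \<open>A local Bogolyubov lemma\<close>

text \<open>Frequencies \<open>j / M\<close> replace the circle: all integers involved lie in a
  window shorter than \<open>M\<close>, on which congruence modulo \<open>M\<close> is
  equality.\<close>

lemma sum_echar_eq_0:
  assumes "\<bar>z\<bar> < int M"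
  shows "(\<Sum>j<M. echar (real j / real M) z) = (if z = 0 then of_nat M else 0)"
proof (cases "z = 0")
  case False
  define \<omega> where "\<omega> = cis (2 * pi * of_int z / M)"
  have M: "0 < M" using assms by auto
  have pow: "echar (real j / real M) z = \<omega> ^ j" for j
    by (simp add: echar_def \<omega>_def DeMoivre algebra_simps)
  have "\<omega> ^ M = cis (2 * pi * of_int z)" using M by (simp add: \<omega>_def DeMoivre)
  then have "\<omega> ^ M = 1" by (simp add: cis_multiple_2pi)
  moreover have "\<omega> \<noteq> 1"
  proof
    assume "\<omega> = 1"
    then have "cos (2 * pi * of_int z / M) = 1" unfolding \<omega>_def by (metis Re_complex_of_real cis.sel(1) of_real_1)
    then obtain n where "2 * pi * of_int z / M = real_of_int n * 2 * pi"
      unfolding cos_one_2pi_int by blast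
    then have "real_of_int z = real_of_int (n * int M)" using M by (simp add: field_simps)
    then have z: "z = n * int M" by (simp only: of_int_eq_iff)
    then have "n \<noteq> 0" using False by auto
    then have "1 * int M \<le> \<bar>n\<bar> * int M" by (intro mult_right_mono) auto
    then show False using assms z by (simp add: abs_mult)
  qed
  ultimately show ?thesis using False by (simp add: pow geometric_sum)
qed simp

lemma parseval_int_set:
  assumes "finite S" "\<And>x y. x \<in> S \<Longrightarrow> y \<in> S \<Longrightarrow> \<bar>x - y\<bar> < int M"
  shows "(\<Sum>j<M. (cmod (\<Sum>x\<in>S. echar (real j / real M) x))\<^sup>2) = real M * card S"
proof -
  have "of_real (\<Sum>j<M. (cmod (\<Sum>x\<in>S. echar (real j / real M) x))\<^sup>2)
     = (\<Sum>j<M. (\<Sum>x\<in>S. \<Sum>y\<in>S. echar (real j / real M) (x - y)))"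
    by (simp only: of_real_sum complex_norm_square cnj_sum sum_product echar_diff)
  also have "\<dots> = (\<Sum>x\<in>S. \<Sum>y\<in>S. \<Sum>j<M. echar (real j / real M) (x - y))"
    by (subst sum.swap, rule sum.cong[OF refl], rule sum.swap)
  also have "\<dots> = (\<Sum>x\<in>S. \<Sum>y\<in>S. if y = x then of_nat M else 0)"
    using assms by (intro sum.cong refl) (auto simp: sum_echar_eq_0)
  also have "\<dots> = of_real (real M * card S)" using assms by simp
  finally show ?thesis by (simp only: of_real_eq_iff)
qed

text \<open>Fourier inversion modulo \<open>M\<close>. In each coefficient the factor from
  \<open>P\<close> is at most \<open>card P\<close>, and the product of the other two is summed by
  the arithmetic-geometric mean inequality and Parseval.\<close>

lemma convolution_echar_sum:
  fixes P Q S :: "int set" and R :: int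
  assumes fin: "finite P" "finite Q" "finite S" and ne: "P \<noteq> {}" "Q \<noteq> {}" and QS: "card Q \<le> card S"
    and M: "\<And>p q s. p \<in> P \<Longrightarrow> q \<in> Q \<Longrightarrow> s \<in> S \<Longrightarrow> \<bar>p + q - s\<bar> + R < int M"
      "\<And>x y. x \<in> S \<Longrightarrow> y \<in> S \<Longrightarrow> \<bar>x - y\<bar> < int M" "\<And>x y. x \<in> Q \<Longrightarrow> y \<in> Q \<Longrightarrow> \<bar>x - y\<bar> < int M"
  shows "\<exists>c. (\<forall>x. \<bar>x\<bar> \<le> R \<longrightarrow> of_real ((\<Sum>p\<in>P. \<Sum>q\<in>Q. of_bool (x + p + q \<in> S)) / (real (card P) * card Q))
      = (\<Sum>j<M. c j * echar (real j / real M) x)) \<and> (\<Sum>j<M. cmod (c j)) \<le> real (card S) / card Q"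
proof -
  define h where "h X j = (\<Sum>x\<in>X. echar (real j / real M) x)" for X j
  define c where "c j = cnj (h S j) * h P j * h Q j / (of_nat M * of_nat (card P) * of_nat (card Q))" for j
  have cP: "0 < card P" and cQ: "0 < card Q" using fin ne by (auto simp: card_gt_0_iff)
  obtain q where "q \<in> Q" using ne by blast
  then have Mpos: "0 < M" using M(3)[of q q] by auto
  have "(\<Sum>j<M. c j * echar (real j / real M) x)
      = of_real ((\<Sum>p\<in>P. \<Sum>q\<in>Q. of_bool (x + p + q \<in> S)) / (real (card P) * card Q))" if x: "\<bar>x\<bar> \<le> R" for x
  proof -
    have "cnj (h S j) * h P j * h Q j * echar (real j / real M) x
        = (\<Sum>p\<in>P. \<Sum>q\<in>Q. \<Sum>s\<in>S. echar (real j / real M) (x + p + q - s))" for j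
      by (simp add: h_def echar_add echar_diff sum_distrib_left sum_distrib_right mult_ac sum.swap[of _ S])
    then have "(\<Sum>j<M. cnj (h S j) * h P j * h Q j * echar (real j / real M) x)
        = (\<Sum>p\<in>P. \<Sum>q\<in>Q. \<Sum>s\<in>S. \<Sum>j<M. echar (real j / real M) (x + p + q - s))"
      by (simp add: sum.swap[of _ "{..<M}"])
    also have "\<dots> = (\<Sum>p\<in>P. \<Sum>q\<in>Q. \<Sum>s\<in>S. if s = x + p + q then of_nat M else 0)"
    proof (intro sum.cong refl)
      fix p q s assume "p \<in> P" "q \<in> Q" "s \<in> S"
      then have "\<bar>x + p + q - s\<bar> < int M" using M(1)[of p q s] x by linarith
      then show "(\<Sum>j<M. echar (real j / real M) (x + p + q - s)) = (if s = x + p + q then of_nat M else 0)"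
        by (simp add: sum_echar_eq_0)
    qed
    also have "\<dots> = of_nat M * (\<Sum>p\<in>P. \<Sum>q\<in>Q. of_bool (x + p + q \<in> S))"
    proof -
      have "(\<Sum>s\<in>S. if s = z then of_nat M else 0) = of_nat M * (of_bool (z \<in> S) :: complex)" for z
        using fin by simp
      then show ?thesis by (simp only: sum_distrib_left)
    qed
    also have "(\<Sum>p\<in>P. \<Sum>q\<in>Q. of_bool (x + p + q \<in> S))
        = complex_of_real (\<Sum>p\<in>P. \<Sum>q\<in>Q. of_bool (x + p + q \<in> S))"
      by (simp only: of_real_sum of_real_of_bool)
    finally have eq: "(\<Sum>j<M. cnj (h S j) * h P j * h Q j * echar (real j / real M) x)
        = of_nat M * complex_of_real (\<Sum>p\<in>P. \<Sum>q\<in>Q. of_bool (x + p + q \<in> S))" .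
    have "(\<Sum>j<M. c j * echar (real j / real M) x)
        = (\<Sum>j<M. cnj (h S j) * h P j * h Q j * echar (real j / real M) x)
          / (of_nat M * of_nat (card P) * of_nat (card Q))"
      by (simp only: c_def sum_divide_distrib times_divide_eq_left)
    then show ?thesis unfolding eq using Mpos by simp
  qed
  moreover have "(\<Sum>j<M. cmod (c j)) \<le> real (card S) / card Q"
  proof -
    have "cmod (c j) \<le> ((cmod (h S j))\<^sup>2 + (cmod (h Q j))\<^sup>2) / (2 * M * card Q)" for j
    proof -
      have "cmod (h P j) \<le> card P"
        unfolding h_def using norm_sum[of "echar (real j / real M)" P] by simp
      then have "cmod (h S j) * cmod (h P j) * cmod (h Q j) \<le> cmod (h S j) * card P * cmod (h Q j)"
        by (intro mult_right_mono mult_left_mono) auto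
      also have "\<dots> \<le> card P * (((cmod (h S j))\<^sup>2 + (cmod (h Q j))\<^sup>2) / 2)"
      proof -
        have "cmod (h S j) * cmod (h Q j) \<le> ((cmod (h S j))\<^sup>2 + (cmod (h Q j))\<^sup>2) / 2"
          using sum_squares_bound[of "cmod (h S j)" "cmod (h Q j)"] by simp
        then have "card P * (cmod (h S j) * cmod (h Q j)) \<le> card P * (((cmod (h S j))\<^sup>2 + (cmod (h Q j))\<^sup>2) / 2)"
          by (rule mult_left_mono) simp
        then show ?thesis by (simp only: mult_ac)
      qed
      finally have "cmod (h S j) * cmod (h P j) * cmod (h Q j) / (real M * card P * card Q)
         \<le> card P * (((cmod (h S j))\<^sup>2 + (cmod (h Q j))\<^sup>2) / 2) / (real M * card P * card Q)"
        by (rule divide_right_mono) simp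
      also have "\<dots> = ((cmod (h S j))\<^sup>2 + (cmod (h Q j))\<^sup>2) / (2 * M * card Q)"
        using cP by simp
      finally show ?thesis by (simp add: c_def norm_mult norm_divide)
    qed
    then have "(\<Sum>j<M. cmod (c j)) \<le> (\<Sum>j<M. ((cmod (h S j))\<^sup>2 + (cmod (h Q j))\<^sup>2) / (2 * M * card Q))"
      by (rule sum_mono)
    also have "\<dots> = (real M * card S + real M * card Q) / (2 * M * card Q)"
      unfolding h_def using M(2,3) fin
      by (simp add: sum_divide_distrib[symmetric] sum.distrib parseval_int_set)
    also have "\<dots> \<le> (real M * card S + real M * card S) / (2 * M * card Q)"
      using QS by (intro divide_right_mono add_left_mono mult_left_mono) auto
    also have "\<dots> = real (card S) / card Q" using Mpos by simp
    finally show ?thesis .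
  qed
  ultimately show ?thesis by (intro exI[of _ c]) simp
qed

text \<open>Each averaging moves the point by an element of \<open>X - X\<close>, of index
  \<open>2 * s\<close>. The counter \<open>m\<close> records the moves already made, so that every
  point visited stays where \<open>step\<close> applies.\<close>

lemma avg_op_iterate_close:
  assumes B: "bsys N d w B" and s: "0 < s" and X: "X \<subseteq> B s" "X \<noteq> {}"
    and step: "\<And>y a b. y \<in> B ((2 * real k + 1) * s) \<Longrightarrow> a \<in> X \<Longrightarrow> b \<in> X \<Longrightarrow> cmod (G (y + (a - b)) - G y) \<le> \<epsilon>"
    and y: "y \<in> B ((2 * real m + 1) * s)" and j: "j + m \<le> Suc k"
  shows "cmod ((avg_op (X \<times> X) (\<lambda>z. fst z - snd z) ^^ j) G y - G y) \<le> real j * \<epsilon>"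
  using y j
proof (induction j arbitrary: y m)
  case (Suc j)
  let ?T = "avg_op (X \<times> X) (\<lambda>z. fst z - snd z)"
  let ?H = "(?T ^^ j) G"
  have fin: "finite X" using X bsys_finite[OF B s] finite_subset by blast
  then have c: "0 < card (X \<times> X)" using X by (simp add: card_gt_0_iff)
  have "?T ?H y - G y = (\<Sum>z\<in>X \<times> X. ?H (y + (fst z - snd z)) - G y) / card (X \<times> X)"
    using c by (simp add: avg_op_def sum_subtractf diff_divide_distrib del: card_cartesian_product)
  also have "cmod \<dots> \<le> (\<Sum>z\<in>X \<times> X. real (Suc j) * \<epsilon>) / card (X \<times> X)"
    unfolding norm_divide norm_of_nat
  proof (intro divide_right_mono sum_norm_le)
    fix z assume z: "z \<in> X \<times> X"
    have "y + (fst z - snd z) \<in> B ((2 * real m + 1) * s + (s + s))"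
      using z X s by (intro bsys_add[OF B] bsys_diff[OF B] Suc.prems(1)) auto
    then have "y + (fst z - snd z) \<in> B ((2 * real (Suc m) + 1) * s)" by (simp add: algebra_simps)
    then have "cmod (?H (y + (fst z - snd z)) - G (y + (fst z - snd z))) \<le> real j * \<epsilon>"
      using Suc.prems(2) by (intro Suc.IH[of _ "Suc m"]) auto
    moreover have "cmod (G (y + (fst z - snd z)) - G y) \<le> \<epsilon>"
    proof (rule step)
      show "y \<in> B ((2 * real k + 1) * s)"
        using bsys_mono[OF B, of "(2 * real m + 1) * s" "(2 * real k + 1) * s"] Suc.prems s by auto
    qed (use z in auto)
    ultimately have "cmod ((?H (y + (fst z - snd z)) - G (y + (fst z - snd z))) + (G (y + (fst z - snd z)) - G y))
        \<le> real j * \<epsilon> + \<epsilon>"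
      by (intro norm_triangle_le) linarith
    then show "cmod (?H (y + (fst z - snd z)) - G y) \<le> real (Suc j) * \<epsilon>" by (simp add: algebra_simps)
  qed simp
  also have "\<dots> = real (Suc j) * \<epsilon>" using c by (simp del: card_cartesian_product)
  finally show ?case by simp
qed simp

lemma avg_op_diff_multiplier:
  "avg_op (X \<times> X) (\<lambda>z. fst z - snd z) (echar \<theta>) 0 = of_real ((cmod (mean X \<theta>))\<^sup>2)"
proof -
  have "(\<Sum>z\<in>X \<times> X. echar \<theta> (0 + (fst z - snd z))) = (\<Sum>a\<in>X. echar \<theta> a) * cnj (\<Sum>b\<in>X. echar \<theta> b)"
    by (simp add: echar_diff sum_product sum.cartesian_product case_prod_beta)
  then show ?thesis
    by (simp only: avg_op_def complex_norm_square) (simp add: mean_def card_cartesian_product)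
qed

text \<open>\<open>B s\<close> and its translate by \<open>x\<close> both fill nearly all of
  \<open>B (s + \<delta>)\<close>, so their character sums differ by at most a fifth of
  \<open>card (B s)\<close>. The second sum is \<open>echar \<phi> x\<close> times the first, which
  is large.\<close>

lemma echar_near_1_of_mean:
  assumes B: "bsys N d w B" and s: "0 < s" "0 < \<delta>"
    and reg: "card (B (s + \<delta>)) \<le> (11/10) * real (card (B s))"
    and big: "8/9 \<le> cmod (mean (B s) \<phi>)" and x: "x \<in> B \<delta>"
  shows "cdev \<phi> x \<le> 1/2"
proof -
  let ?b = "real (card (B s))"
  have b: "0 < ?b" using bsys_card_pos[OF B s(1)] by simp
  have fin: "finite (B (s + \<delta>))" using bsys_finite[OF B] s by simp
  have close: "cmod ((\<Sum>y\<in>Y. echar \<phi> y) - (\<Sum>y\<in>B (s + \<delta>). echar \<phi> y)) \<le> ?b / 10"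
    if Y: "Y \<subseteq> B (s + \<delta>)" "card Y = card (B s)" for Y
  proof -
    have "(\<Sum>y\<in>B (s + \<delta>). echar \<phi> y) - (\<Sum>y\<in>Y. echar \<phi> y) = (\<Sum>y\<in>B (s + \<delta>) - Y. echar \<phi> y)"
      using sum_diff[OF fin Y(1), of "echar \<phi>"] by simp
    moreover have "cmod (\<Sum>y\<in>B (s + \<delta>) - Y. echar \<phi> y) \<le> real (card (B (s + \<delta>) - Y))"
      using norm_sum[of "echar \<phi>" "B (s + \<delta>) - Y"] by simp
    moreover have "real (card (B (s + \<delta>) - Y)) = real (card (B (s + \<delta>))) - ?b"
      using fin Y card_mono[OF fin Y(1)] by (simp add: card_Diff_subset finite_subset of_nat_diff)
    ultimately show ?thesis using reg by (subst norm_minus_commute) simp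
  qed
  have 1: "cmod ((\<Sum>y\<in>B s. echar \<phi> y) - (\<Sum>y\<in>B (s + \<delta>). echar \<phi> y)) \<le> ?b / 10"
    using bsys_mono[OF B, of s "s + \<delta>"] s by (intro close) auto
  have 2: "cmod ((\<Sum>y\<in>(\<lambda>y. y + x) ` B s. echar \<phi> y) - (\<Sum>y\<in>B (s + \<delta>). echar \<phi> y)) \<le> ?b / 10"
    using bsys_add[OF B, of s \<delta> _ x] s x by (intro close) (auto simp: card_image inj_on_def)
  have "(\<Sum>y\<in>(\<lambda>y. y + x) ` B s. echar \<phi> y) = echar \<phi> x * (\<Sum>y\<in>B s. echar \<phi> y)"
    by (subst sum.reindex) (auto simp: inj_on_def echar_add sum_distrib_left mult.commute)
  then have eq: "(echar \<phi> x - 1) * (\<Sum>y\<in>B s. echar \<phi> y) =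
     ((\<Sum>y\<in>(\<lambda>y. y + x) ` B s. echar \<phi> y) - (\<Sum>y\<in>B (s + \<delta>). echar \<phi> y))
      - ((\<Sum>y\<in>B s. echar \<phi> y) - (\<Sum>y\<in>B (s + \<delta>). echar \<phi> y))"
    by (simp add: algebra_simps)
  have "cdev \<phi> x * cmod (\<Sum>y\<in>B s. echar \<phi> y) \<le> ?b / 10 + ?b / 10"
    unfolding norm_mult[symmetric] eq by (rule order_trans[OF norm_triangle_ineq4 add_mono[OF 2 1]])
  moreover have "cmod (\<Sum>y\<in>B s. echar \<phi> y) \<ge> 8/9 * ?b"
    using big b by (simp add: mean_def norm_divide field_simps)
  then have "cdev \<phi> x * (8/9 * ?b) \<le> cdev \<phi> x * cmod (\<Sum>y\<in>B s. echar \<phi> y)"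
    by (intro mult_left_mono) auto
  ultimately have "(cdev \<phi> x * (8/9)) * ?b \<le> (1/5) * ?b" by simp
  then have "cdev \<phi> x * (8/9) \<le> 1/5" using b by (simp only: mult_le_cancel_right_pos)
  then show ?thesis by simp
qed

text \<open>The multiples \<open>2 ^ j * x\<close> with \<open>j \<le> i\<close> all remain in
  \<open>B \<delta>\<close>, so the weak bound \<open>1/2\<close> is amplified by doubling.\<close>

lemma echar_small_of_mean:
  assumes B: "bsys N d w B" and s: "0 < s" "0 < \<delta>"
    and reg: "card (B (s + \<delta>)) \<le> (11/10) * real (card (B s))"
    and big: "8/9 \<le> cmod (mean (B s) \<phi>)" and x: "x \<in> B (\<delta> / 2 ^ i)"
  shows "cdev \<phi> x \<le> (2/3) ^ i"
proof (rule norm_minus_1_le_by_doubling)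
  fix j assume j: "j \<le> i"
  have multiple: "int (2 ^ j) * x \<in> B (2 ^ j * (\<delta> / 2 ^ i))"
  proof (induction j)
    case (Suc j)
    show ?case using bsys_add[OF B _ _ Suc Suc] s by (simp add: algebra_simps)
  qed (use x in simp)
  have "(2::real) ^ j \<le> 2 ^ i" using j by (intro power_increasing) auto
  then have "2 ^ j * (\<delta> / 2 ^ i) \<le> \<delta>" using s by (simp add: field_simps mult_right_mono)
  then have "int (2 ^ j) * x \<in> B \<delta>" using bsys_mono[OF B, of "2 ^ j * (\<delta> / 2 ^ i)" \<delta>] multiple s by auto
  then have "cmod (echar \<phi> (int (2 ^ j) * x) - 1) \<le> 1/2" by (rule echar_near_1_of_mean[OF B s reg big])
  then show "cmod (echar \<phi> x ^ 2 ^ j - 1) \<le> 1/2" by (simp only: echar_power)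
qed simp

text \<open>The single value \<open>h (y + q - b)\<close> approximates \<open>g\<close> at
  \<open>y + q\<close>, through \<open>b\<close>, and at \<open>y + (a - b) + q\<close>, through
  \<open>a\<close>. Summing over \<open>q\<close> turns closeness outside small sets into closeness
  at the one point \<open>y\<close>, since each bad point is met by at most one
  \<open>q\<close>.\<close>

lemma smoothed_translate_close:
  fixes g h :: "int \<Rightarrow> real" and c \<epsilon> :: real
  assumes g01: "\<And>x. 0 \<le> g x" "\<And>x. g x \<le> 1" and Q: "finite Q" and \<epsilon>: "0 \<le> \<epsilon>"
    and D: "\<And>q. q \<in> Q \<Longrightarrow> y + q \<in> D" "\<And>q. q \<in> Q \<Longrightarrow> y + (a - b) + q \<in> D"
    and ha: "finite bad_a" "card bad_a \<le> c" "\<And>x. x \<in> D - bad_a \<Longrightarrow> \<bar>h (x - a) - g x\<bar> \<le> \<epsilon>"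
    and hb: "finite bad_b" "card bad_b \<le> c" "\<And>x. x \<in> D - bad_b \<Longrightarrow> \<bar>h (x - b) - g x\<bar> \<le> \<epsilon>"
  shows "\<bar>(\<Sum>q\<in>Q. g (y + (a - b) + q)) - (\<Sum>q\<in>Q. g (y + q))\<bar> \<le> 2 * \<epsilon> * card Q + 2 * c"
proof -
  let ?y' = "y + (a - b)"
  have each: "\<bar>g (?y' + q) - g (y + q)\<bar>
    \<le> 2 * \<epsilon> + of_bool (y + q \<in> bad_b) + of_bool (?y' + q \<in> bad_a)" if q: "q \<in> Q" for q
  proof (cases "y + q \<in> bad_b \<or> ?y' + q \<in> bad_a")
    case True
    then have "1 \<le> of_bool (y + q \<in> bad_b) + (of_bool (?y' + q \<in> bad_a) :: real)" by auto
    moreover have "\<bar>g (?y' + q) - g (y + q)\<bar> \<le> 1"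
      using g01[of "y + q"] g01[of "?y' + q"] by linarith
    ultimately show ?thesis using \<epsilon> by linarith
  next
    case False
    then have "\<bar>h (y + q - b) - g (y + q)\<bar> \<le> \<epsilon>" by (intro hb(3) DiffI D(1) q) simp
    moreover have "\<bar>h (?y' + q - a) - g (?y' + q)\<bar> \<le> \<epsilon>" using False by (intro ha(3) DiffI D(2) q) simp
    moreover have "?y' + q - a = y + q - b" by simp
    ultimately have "\<bar>g (?y' + q) - g (y + q)\<bar> \<le> 2 * \<epsilon>" by simp
    then show ?thesis by (simp add: False)
  qed
  have count: "(\<Sum>q\<in>Q. of_bool (z + q \<in> E)) \<le> c" if "finite E" "card E \<le> c" for z E
  proof -
    have "card {q\<in>Q. z + q \<in> E} \<le> card E"
      using that(1) by (intro card_inj_on_le[where f = "(+) z"]) auto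
    then have "real (card {q\<in>Q. z + q \<in> E}) \<le> c" using that(2) by linarith
    then show ?thesis by (simp only: card_filter_sum[OF Q])
  qed
  have "\<bar>\<Sum>q\<in>Q. g (?y' + q) - g (y + q)\<bar>
     \<le> (\<Sum>q\<in>Q. 2 * \<epsilon> + of_bool (y + q \<in> bad_b) + of_bool (?y' + q \<in> bad_a))"
    by (intro order_trans[OF sum_abs] sum_mono each)
  also have "\<dots> = 2 * \<epsilon> * card Q + (\<Sum>q\<in>Q. of_bool (y + q \<in> bad_b)) + (\<Sum>q\<in>Q. of_bool (?y' + q \<in> bad_a))"
    by (simp only: sum.distrib sum_constant mult.commute)
  also have "\<dots> \<le> 2 * \<epsilon> * card Q + c + c"
    by (intro add_mono order_refl count ha hb)
  finally show ?thesis by (simp only: sum_subtractf mult_2 add.assoc)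
qed

text \<open>The pairs that represent \<open>t\<close> in \<open>P + Q - P - Q\<close> are collected,
  not just their existence; their number later leaves room to avoid one value.\<close>

abbreviation sum_reps :: "int set \<Rightarrow> int set \<Rightarrow> int \<Rightarrow> (int \<times> int) set" where
  "sum_reps P Q t \<equiv> {z\<in>P \<times> Q. \<exists>p\<in>P. \<exists>q\<in>Q. t + fst z + snd z = p + q}"

text \<open>Put \<open>S = P + Q\<close> and let \<open>F x\<close> be the proportion of pairs with
  \<open>x + p + q\<close> in \<open>S\<close>; then \<open>F 0 = 1\<close>, and
  \<open>F t \<ge> 1/2\<close> is wanted. By almost periodicity, \<open>k\<close> averagings over
  \<open>X - X\<close> change \<open>F\<close> by at most \<open>1/8\<close>. They multiply each
  Fourier coefficient by the \<open>2 * k\<close>-th power of the modulus of the mean of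
  \<open>X\<close>: off the large spectrum this is at most \<open>1 / 4 ^ k\<close>, and on it
  Chang's theorem makes the character almost constant under the shift by \<open>t\<close>.\<close>

lemma bogolyubov_core:
  fixes K \<epsilon> \<xi> \<nu> \<nu>' :: real
  assumes B: "bsys N d w B"
    and s: "0 < s1" "0 < s2" "0 < s3" "0 < s4" "0 < \<delta>" "(2 * real k + 1) * s3 \<le> s2" "\<delta> \<le> s3"
    and P: "P \<subseteq> B s2" "P \<noteq> {}" and Q: "Q \<subseteq> B s1" "Q \<noteq> {}"
    and K: "card (B (s2 + s3)) \<le> K * card P" "card (B (s1 + s2)) \<le> K * card Q"
    and reg: "card (B (s3 + real r * s4)) \<le> 2 * real (card (B s3))"
      "card (B (s4 + \<delta>)) \<le> (11/10) * real (card (B s4))"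
    and k: "0 < k" and n: "0 < n" and \<epsilon>: "\<epsilon> = 1 / (32 * real k)"
    and \<xi>: "0 < \<xi>" "\<xi> * K \<le> \<epsilon>" "4 * exp (- (\<epsilon>\<^sup>2 * n / 4)) \<le> \<xi>"
    and \<nu>: "0 \<le> \<nu>" "K * (\<nu> + 2 / 4 ^ k) \<le> 1/4" "0 \<le> \<nu>'" "real r * \<nu>' + (2/3) ^ i \<le> \<nu>"
    and r: "32 * ln (8 * K ^ n) < r"
  shows "\<exists>\<Lambda>. finite \<Lambda> \<and> card \<Lambda> < r \<and> (\<forall>t\<in>B (\<delta> / 2 ^ i). (\<forall>\<mu>\<in>\<Lambda>. cdev \<mu> t \<le> \<nu>') \<longrightarrow>
     card P * card Q \<le> 2 * card (sum_reps P Q t))"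
proof -
  define S where "S = (\<lambda>z. fst z + snd z) ` (P \<times> Q)"
  define D where "D = B (s1 + s2)"
  have fin: "finite P" "finite Q" "finite D" "finite (B s3)" "finite (B (s2 + s3))"
    unfolding D_def using P Q bsys_finite[OF B] s by (auto intro: finite_subset)
  then have finS: "finite S" by (simp add: S_def)
  have cP: "0 < card P" and cQ: "0 < card Q" using fin P Q by (auto simp: card_gt_0_iff)
  have PQ_D: "p + q \<in> D" if "p \<in> P" "q \<in> Q" for p q
    using bsys_add[OF B s(1,2), of q p] P(1) Q(1) that by (auto simp: D_def add.commute[of p q])
  then have SD: "S \<subseteq> D" by (auto simp: S_def)
  have cardS: "card S \<le> K * card Q"
    using card_mono[OF fin(3) SD] K(2) by (simp add: D_def)
  define g where "g x = real (cnt S x P) / card P" for x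
  have g01: "0 \<le> g x" "g x \<le> 1" for x
    using cnt_le[OF fin(1), of S x] cP by (auto simp: g_def)
  have \<epsilon>0: "0 < \<epsilon>" "\<epsilon> \<le> 2" using k by (auto simp: \<epsilon> field_simps)
  have PV: "p + t \<in> B (s2 + s3)" if "p \<in> P" "t \<in> B s3" for p t
    using bsys_add[OF B s(2,3)] P(1) that by blast
  have "\<exists>X h bad. X \<subseteq> B s3 \<and> card (B s3) \<le> 2 * K ^ n * card X \<and>
     (\<forall>t\<in>X. bad t \<subseteq> D \<and> card (bad t) \<le> \<xi> * card D \<and>
        (\<forall>x\<in>D - bad t. \<bar>h (x - t) - cnt S x P / card P\<bar> \<le> \<epsilon>))"
    by (rule croot_sisask[OF fin(1) P(2) fin(4,5) _ K(1) fin(3) n \<epsilon>0 \<xi>(1,3)]) (rule PV)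
  then obtain X h bad where X: "X \<subseteq> B s3" "card (B s3) \<le> 2 * K ^ n * card X"
    and *: "\<forall>t\<in>X. bad t \<subseteq> D \<and> card (bad t) \<le> \<xi> * card D \<and>
        (\<forall>x\<in>D - bad t. \<bar>h (x - t) - cnt S x P / card P\<bar> \<le> \<epsilon>)"
    by (elim exE conjE) (rule that)
  have bad: "bad t \<subseteq> D" "card (bad t) \<le> \<xi> * card D" if "t \<in> X" for t
    using bspec[OF * that] by auto
  have h: "\<bar>h (x - t) - g x\<bar> \<le> \<epsilon>" if "t \<in> X" "x \<in> D - bad t" for t x
    using bspec[OF * that(1)] that(2) unfolding g_def by blast
  have Xne: "X \<noteq> {}" using X(2) bsys_card_pos[OF B s(3)] by auto
  define F where "F x = (\<Sum>p\<in>P. \<Sum>q\<in>Q. of_bool (x + p + q \<in> S)) / (real (card P) * card Q)" for x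
  have F_eq: "F x = (\<Sum>q\<in>Q. g (x + q)) / card Q" for x
  proof -
    have "(\<Sum>p\<in>P. \<Sum>q\<in>Q. of_bool (x + p + q \<in> S)) = (\<Sum>q\<in>Q. real (cnt S (x + q) P))"
      unfolding cnt_sum[OF fin(1)]
      by (subst sum.swap, intro sum.cong refl arg_cong[where f = of_bool]) (simp add: algebra_simps)
    then show ?thesis by (simp add: F_def g_def sum_divide_distrib[symmetric])
  qed
  \<comment> \<open>The index reached from \<open>B s3\<close> after \<open>k - 1\<close> moves by
    \<open>X - X\<close>; the last move, of index \<open>2 * s3\<close>, must still end in
    \<open>B s2\<close>.\<close>
  define u where "u = (2 * real (k - 1) + 1) * s3"
  have u: "0 < u" "s3 \<le> u" "u + (s3 + s3) \<le> s2" "u \<le> s2"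
  proof -
    show "0 < u" "s3 \<le> u" using s by (simp_all add: u_def mult_le_cancel_right1)
    have "u + (s3 + s3) = (2 * real k + 1) * s3" using k by (simp add: u_def of_nat_diff algebra_simps)
    then show le: "u + (s3 + s3) \<le> s2" using s(6) by simp
    show "u \<le> s2" using le s by linarith
  qed
  have u_s2: "y \<in> B s2" if "y \<in> B u" for y
    using bsys_mono[OF B u(1,4)] that by blast
  have shift: "y + (a - b) \<in> B s2" if y: "y \<in> B u" and ab: "a \<in> X" "b \<in> X" for y a b
  proof -
    have "a - b \<in> B (s3 + s3)" using ab X(1) s by (intro bsys_diff[OF B]) auto
    then have "y + (a - b) \<in> B (u + (s3 + s3))" using u s y by (intro bsys_add[OF B]) auto
    then show ?thesis using bsys_mono[OF B _ u(3)] u(1) s(3) by (metis add_pos_pos subsetD)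
  qed
  have finbad: "finite (bad t)" if "t \<in> X" for t
    using bad(1)[OF that] fin(3) by (rule finite_subset)
  have step: "\<bar>F (y + (a - b)) - F y\<bar> \<le> 4 * \<epsilon>" if y: "y \<in> B u" and ab: "a \<in> X" "b \<in> X" for y a b
  proof -
    have D: "z + q \<in> D" if "z \<in> B s2" "q \<in> Q" for z q
      using bsys_add[OF B s(2,1) that(1), of q] Q(1) that(2) unfolding D_def add.commute[of s1] by blast
    have "\<bar>(\<Sum>q\<in>Q. g (y + (a - b) + q)) - (\<Sum>q\<in>Q. g (y + q))\<bar> \<le> 2 * \<epsilon> * card Q + 2 * (\<xi> * card D)"
      by (rule smoothed_translate_close[OF g01 fin(2) less_imp_le[OF \<epsilon>0(1)] D[OF u_s2[OF y]] D[OF shift[OF y ab]]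
          finbad[OF ab(1)] bad(2)[OF ab(1)] h[OF ab(1)] finbad[OF ab(2)] bad(2)[OF ab(2)] h[OF ab(2)]])
    also have "\<xi> * card D \<le> \<xi> * (K * card Q)"
      using K(2) \<xi>(1) unfolding D_def by (intro mult_left_mono) auto
    also have "\<xi> * (K * card Q) = (\<xi> * K) * card Q" by simp
    also have "\<dots> \<le> \<epsilon> * card Q" using \<xi>(2) by (intro mult_right_mono) auto
    finally have "\<bar>(\<Sum>q\<in>Q. g (y + (a - b) + q)) - (\<Sum>q\<in>Q. g (y + q))\<bar> \<le> 4 * \<epsilon> * card Q" by simp
    then have "\<bar>(\<Sum>q\<in>Q. g (y + (a - b) + q)) - (\<Sum>q\<in>Q. g (y + q))\<bar> / card Q \<le> 4 * \<epsilon>"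
      using cQ by (simp add: pos_divide_le_eq)
    then show ?thesis unfolding F_eq diff_divide_distrib[symmetric] by (simp add: abs_divide)
  qed
  \<comment> \<open>The sum \<open>p + q\<close>, the element of \<open>S\<close> and the argument
    of \<open>F\<close> are each at most \<open>Z\<close> in absolute value, so the modulus
    \<open>3 * Z + 1\<close> admits no wrap-around.\<close>
  define Z where "Z = \<lceil>(s1 + s2) * N\<rceil>"
  define M where "M = nat (3 * Z + 1)"
  have bd: "\<bar>x\<bar> \<le> Z" if "x \<in> D" for x
    using bsys_bound[OF B _ that[unfolded D_def]] s unfolding Z_def
    by (simp add: le_ceiling_iff)
  have B_D: "B s1 \<subseteq> D" "B s2 \<subseteq> D"
    unfolding D_def using s by (intro bsys_mono[OF B]; simp)+
  have Q_D: "Q \<subseteq> D" using Q(1) B_D(1) by (rule subset_trans)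
  have Z0: "0 \<le> Z" using bd[of 0] bsys_0[OF B s(2)] B_D by auto
  then have M: "int M = 3 * Z + 1" by (simp add: M_def)
  obtain p0 where p0: "p0 \<in> P" using P by blast
  have "(+) p0 ` Q \<subseteq> S" unfolding S_def using p0 by force
  then have QS: "card Q \<le> card S" by (intro card_inj_on_le[OF _ _ finS]) simp_all
  have "\<exists>c. (\<forall>x. \<bar>x\<bar> \<le> Z \<longrightarrow> of_real (F x) = (\<Sum>j<M. c j * echar (real j / real M) x))
      \<and> (\<Sum>j<M. cmod (c j)) \<le> real (card S) / card Q"
    unfolding F_def
  proof (rule convolution_echar_sum[OF fin(1,2) finS P(2) Q(2) QS])
    show "\<bar>p + q - u\<bar> + Z < int M" if "p \<in> P" "q \<in> Q" "u \<in> S" for p q u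
      using bd[OF PQ_D[OF that(1,2)]] bd[OF subsetD[OF SD that(3)]] M by linarith
    show "\<bar>x - y\<bar> < int M" if "x \<in> S" "y \<in> S" for x y
      using bd[OF subsetD[OF SD that(1)]] bd[OF subsetD[OF SD that(2)]] M by linarith
    show "\<bar>x - y\<bar> < int M" if "x \<in> Q" "y \<in> Q" for x y
      using bd[OF subsetD[OF Q_D that(1)]] bd[OF subsetD[OF Q_D that(2)]] M by linarith
  qed
  then obtain c where c: "\<forall>x. \<bar>x\<bar> \<le> Z \<longrightarrow> of_real (F x) = (\<Sum>j<M. c j * echar (real j / real M) x)"
      "(\<Sum>j<M. cmod (c j)) \<le> real (card S) / card Q"
    by (elim exE conjE) (rule that)
  define G where "G x = (\<Sum>j<M. c j * echar (real j / real M) x)" for x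
  have FG: "G x = of_real (F x)" if "x \<in> B s2" for x
    unfolding G_def by (rule c(1)[rule_format, symmetric], rule bd, rule subsetD[OF B_D(2) that])
  let ?T = "avg_op (X \<times> X) (\<lambda>z. fst z - snd z)"
  have close: "cmod ((?T ^^ k) G y - G y) \<le> 1/8" if y: "y \<in> B s3" for y
  proof -
    have "cmod ((?T ^^ k) G y - G y) \<le> real k * (4 * \<epsilon>)"
    proof (rule avg_op_iterate_close[OF B s(3) X(1) Xne, where m = 0 and k = "k - 1"])
      show "cmod (G (y + (a - b)) - G y) \<le> 4 * \<epsilon>"
        if "y \<in> B ((2 * real (k - 1) + 1) * s3)" "a \<in> X" "b \<in> X" for y a b
      proof -
        have y: "y \<in> B u" using that(1) by (simp add: u_def)
        have "G (y + (a - b)) - G y = of_real (F (y + (a - b)) - F y)"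
          unfolding FG[OF u_s2[OF y]] FG[OF shift[OF y that(2,3)]] by simp
        then show ?thesis using step[OF y that(2,3)] by (simp only: norm_of_real)
      qed
    qed (use y k in auto)
    then show ?thesis using k by (simp add: \<epsilon>)
  qed
  have multiplier: "(?T ^^ k) G y = (\<Sum>j<M. c j * of_real ((cmod (mean X (real j / real M)))\<^sup>2) ^ k * echar (real j / real M) y)" for y
    unfolding G_def avg_op_echar_sum avg_op_diff_multiplier ..
  \<comment> \<open>Regularity costs a factor 2, and \<open>X\<close> has proportion at least
    \<open>1 / (2 * K ^ n)\<close> in \<open>B s3\<close>.\<close>
  have cC: "real (card (B (s3 + real r * s4))) \<le> (4 * K ^ n) * card X" using reg(1) X(2) by linarith
  have "32 * ln (2 * (4 * K ^ n)) < r" using r by simp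
  from relative_chang[OF B s(3,4) X(1) Xne cC this]
  obtain \<Lambda> where \<Lambda>: "finite \<Lambda>" "card \<Lambda> < r"
    and spec: "\<forall>\<theta>. 1/2 \<le> cmod (mean X \<theta>) \<longrightarrow> (\<exists>\<phi>. 8/9 \<le> cmod (mean (B s4) \<phi>) \<and>
        (\<forall>z. cdev \<theta> z \<le> (\<Sum>\<mu>\<in>\<Lambda>. cdev \<mu> z) + cdev \<phi> z))"
    by (elim exE conjE) (rule that)
  have "card P * card Q \<le> 2 * card (sum_reps P Q t)"
    if t: "t \<in> B (\<delta> / 2 ^ i)" and small: "\<forall>\<mu>\<in>\<Lambda>. cdev \<mu> t \<le> \<nu>'" for t
  proof -
    have "\<delta> / 2 ^ i \<le> \<delta>" using s by (simp add: field_simps)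
    then have t3: "t \<in> B s3" using bsys_mono[OF B, of "\<delta> / 2 ^ i" s3] t s by auto
    have near: "cdev \<theta> t \<le> \<nu>" if \<theta>: "1/2 \<le> cmod (mean X \<theta>)" for \<theta>
    proof -
      obtain \<phi> where \<phi>: "8/9 \<le> cmod (mean (B s4) \<phi>)"
        "cdev \<theta> t \<le> (\<Sum>\<mu>\<in>\<Lambda>. cdev \<mu> t) + cdev \<phi> t"
        using spec[rule_format, OF \<theta>] by blast
      have "(\<Sum>\<mu>\<in>\<Lambda>. cdev \<mu> t) \<le> card \<Lambda> * \<nu>'"
        using small by (intro sum_bounded_above) auto
      also have "\<dots> \<le> real r * \<nu>'" using \<Lambda>(2) \<nu>(3) by (intro mult_right_mono) auto
      finally show ?thesis
        using \<phi>(2) echar_small_of_mean[OF B s(4,5) reg(2) \<phi>(1) t] \<nu>(4) by linarith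
    qed
    have "(?T ^^ k) G t - (?T ^^ k) G 0 = (\<Sum>j<M. c j * of_real ((cmod (mean X (real j / real M)))\<^sup>2) ^ k * (echar (real j / real M) t - 1))"
      unfolding multiplier by (simp add: sum_subtractf[symmetric] algebra_simps)
    also have "cmod \<dots> \<le> (\<Sum>j<M. cmod (c j) * (\<nu> + 2 / 4 ^ k))"
    proof (rule sum_norm_le)
      fix j
      let ?\<theta> = "real j / real M"
      have "((cmod (mean X ?\<theta>))\<^sup>2) ^ k * cdev ?\<theta> t \<le> \<nu> + 2 / 4 ^ k"
      proof (cases "1/2 \<le> cmod (mean X ?\<theta>)")
        case True
        have "((cmod (mean X ?\<theta>))\<^sup>2) ^ k \<le> 1" by (intro power_le_one) (auto simp: norm_mean_le_1)
        then have "((cmod (mean X ?\<theta>))\<^sup>2) ^ k * cdev ?\<theta> t \<le> 1 * \<nu>"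
          using near[OF True] by (intro mult_mono) auto
        moreover have "0 \<le> 2 / (4::real) ^ k" by simp
        ultimately show ?thesis by linarith
      next
        case False
        then have "(cmod (mean X ?\<theta>))\<^sup>2 \<le> (1/2)\<^sup>2" by (intro power_mono) auto
        then have "((cmod (mean X ?\<theta>))\<^sup>2) ^ k \<le> (1/4) ^ k" by (intro power_mono) (auto simp: power2_eq_square)
        moreover have "cdev ?\<theta> t \<le> 2"
          using norm_triangle_ineq4[of "echar ?\<theta> t" 1] by simp
        ultimately have "((cmod (mean X ?\<theta>))\<^sup>2) ^ k * cdev ?\<theta> t \<le> (1/4) ^ k * 2"
          by (intro mult_mono) auto
        then show ?thesis using \<nu>(1) by (simp add: power_divide)
      qed
      then have "cmod (c j) * (((cmod (mean X ?\<theta>))\<^sup>2) ^ k * cdev ?\<theta> t) \<le> cmod (c j) * (\<nu> + 2 / 4 ^ k)"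
        by (rule mult_left_mono) simp
      then show "cmod (c j * of_real ((cmod (mean X ?\<theta>))\<^sup>2) ^ k * (echar ?\<theta> t - 1)) \<le> cmod (c j) * (\<nu> + 2 / 4 ^ k)"
        by (simp add: norm_mult norm_power mult.assoc)
    qed
    also have "\<dots> = (\<Sum>j<M. cmod (c j)) * (\<nu> + 2 / 4 ^ k)" by (simp add: sum_distrib_right)
    also have "\<dots> \<le> K * (\<nu> + 2 / 4 ^ k)"
    proof (rule mult_right_mono)
      have "real (card S) / card Q \<le> K" using cardS cQ by (simp add: field_simps)
      then show "(\<Sum>j<M. cmod (c j)) \<le> K" using c(2) by linarith
    qed (use \<nu> in simp)
    also have "\<dots> \<le> 1/4" by (rule \<nu>(2))
    finally have mid: "cmod ((?T ^^ k) G t - (?T ^^ k) G 0) \<le> 1/4" .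
    \<comment> \<open>The comparison goes through the averaged function: \<open>1/4\<close> for its
      own change, and \<open>1/8\<close> at each end for the averaging.\<close>
    have "G t - G 0 = ((?T ^^ k) G t - (?T ^^ k) G 0) - ((?T ^^ k) G t - G t) + ((?T ^^ k) G 0 - G 0)" by simp
    also have "cmod \<dots> \<le> (1/4 + 1/8) + 1/8"
      using mid close[OF t3] close[OF bsys_0[OF B s(3)]]
      by (intro norm_triangle_le[OF add_mono] order_trans[OF norm_triangle_ineq4 add_mono])
    finally have "cmod (G t - G 0) \<le> 1/2" by simp
    moreover have "t \<in> B s2" "0 \<in> B s2" using u_s2 bsys_mono[OF B s(3) u(2)] t3 bsys_0[OF B s(2)] by blast+
    then have "G t - G 0 = of_real (F t - F 0)" by (simp add: FG)
    moreover have "F 0 = 1"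
    proof -
      have "(\<Sum>p\<in>P. \<Sum>q\<in>Q. of_bool (0 + p + q \<in> S)) = (\<Sum>p\<in>P. \<Sum>q\<in>Q. (1::real))"
        by (intro sum.cong refl) (auto simp: S_def image_iff)
      then show ?thesis using cP cQ by (simp add: F_def)
    qed
    ultimately have "1/2 \<le> F t" by (simp only: norm_of_real)
    moreover have "(\<Sum>p\<in>P. \<Sum>q\<in>Q. of_bool (t + p + q \<in> S)) =
      real (card (sum_reps P Q t))"
    proof -
      have "real (card {z\<in>P \<times> Q. t + fst z + snd z \<in> S}) = (\<Sum>p\<in>P. \<Sum>q\<in>Q. of_bool (t + p + q \<in> S))"
        by (simp only: card_filter_sum[OF finite_cartesian_product[OF fin(1,2)]]
            sum.cartesian_product case_prod_unfold)
      moreover have "{z\<in>P \<times> Q. t + fst z + snd z \<in> S} = (sum_reps P Q t)"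
        unfolding S_def image_def by (intro Collect_cong conj_cong refl) force
      ultimately show ?thesis by simp
    qed
    ultimately have "real (card P) * card Q \<le> 2 * real (card (sum_reps P Q t))"
      using cP cQ by (simp add: F_def pos_le_divide_eq)
    then have "real (card P * card Q) \<le> real (2 * card (sum_reps P Q t))"
      by simp
    then show ?thesis by (simp only: of_nat_le_iff)
  qed
  then show ?thesis by (intro exI[of _ \<Lambda>] conjI ballI impI \<Lambda>)
qed

text \<open>The parameters for \<open>K = exp l\<close>. With \<open>k\<close> of order
  \<open>l\<close>, the power \<open>4 ^ k\<close> beats \<open>exp l\<close>. Then
  \<open>\<epsilon>\<close> is of order \<open>1 / l\<close>, sampling to accuracy
  \<open>\<epsilon>\<close> with failure rate \<open>\<xi>\<close> needs \<open>n\<close> of order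
  \<open>l / \<epsilon>\<^sup>2\<close>, that is \<open>l ^ 3\<close>, and Chang's theorem at
  proportion about \<open>exp (- l * n)\<close> gives a rank of order \<open>l * n\<close>. This is
  the source of \<open>l ^ 4\<close>.\<close>

lemma local_bogolyubov:
  fixes l :: real
  assumes B: "bsys N d w B" and l: "1 \<le> l"
    and s: "0 < s1" "0 < s2" "0 < s3" "0 < s4" "0 < \<delta>" "9 * l * s3 \<le> s2" "\<delta> \<le> s3"
    and P: "P \<subseteq> B s2" "P \<noteq> {}" and Q: "Q \<subseteq> B s1" "Q \<noteq> {}"
    and K: "card (B (s2 + s3)) \<le> exp l * card P" "card (B (s1 + s2)) \<le> exp l * card Q"
    and reg: "card (B (s3 + 2000000000 * l ^ 4 * s4)) \<le> 2 * real (card (B s3))"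
      "card (B (s4 + \<delta>)) \<le> (11/10) * real (card (B s4))"
  shows "\<exists>\<Lambda>. finite \<Lambda> \<and> real (card \<Lambda>) \<le> 2000000000 * l ^ 4 \<and>
     (\<forall>t\<in>B (\<delta> * exp (- 40 * l)). (\<forall>\<mu>\<in>\<Lambda>. cdev \<mu> t \<le> exp (- 40 * l)) \<longrightarrow>
     card P * card Q \<le> 2 * card (sum_reps P Q t))"
proof -
  define m where "m = nat \<lceil>l\<rceil>"
  have m: "l \<le> m" "m \<le> l + 1" using l unfolding m_def by linarith+
  define k where "k = m + 2"
  define \<epsilon> where "\<epsilon> = 1 / (32 * real k)"
  define \<xi> where "\<xi> = \<epsilon> * exp (- l)"
  \<comment> \<open>This makes \<open>\<epsilon>\<^sup>2 * n / 4\<close> at least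
    \<open>513 * l\<close>: of this \<open>512 * l\<close> absorbs the factor
    \<open>128 * k\<close>, because \<open>k \<le> 4 * l\<close>, and the last \<open>l\<close>
    gives the \<open>exp (- l)\<close> in \<open>\<xi>\<close>.\<close>
  define n where "n = nat \<lceil>4096 * (real k)\<^sup>2 * (513 * l)\<rceil>"
  define r where "r = nat \<lceil>1100000000 * l ^ 4\<rceil>"
  \<comment> \<open>Three doublings gain \<open>8/27\<close>, which is below \<open>1/3\<close> and
    so below \<open>exp (- 1)\<close>, for each unit of \<open>m\<close>; seven more gain
    \<open>1/16\<close>.\<close>
  define i where "i = 3 * m + 7"
  define \<nu> where "\<nu> = exp (- l) / 8"
  \<comment> \<open>The tolerance has to survive a sum over \<open>r\<close> frequencies:
    \<open>16 * r \<le> exp (39 * l)\<close>, whence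
    \<open>r * \<nu>' \<le> \<nu> / 2\<close>.\<close>
  define \<nu>' where "\<nu>' = exp (- 40 * l)"
  have k: "0 < k" "real k \<le> 4 * l" "2 * real k + 1 \<le> 9 * l" using m l by (auto simp: k_def)
  have e1: "exp (real j) \<le> 3 ^ j" for j :: nat
    using exp_le power_mono[of "exp 1" "3::real" j] by (simp add: exp_of_nat_mult[symmetric])
  have l_pow: "1 \<le> l ^ j" for j using l by (rule one_le_power)
  have n_lower: "4096 * (real k)\<^sup>2 * (513 * l) \<le> n" unfolding n_def by (rule real_nat_ceiling_ge)
  have pos: "0 < 4096 * (real k)\<^sup>2 * (513 * l)" using k l by simp
  then have n0: "0 < n" using n_lower by linarith
  have n_upper: "n \<le> 34000000 * l ^ 3"
  proof -
    have "real n \<le> 4096 * (real k)\<^sup>2 * (513 * l) + 1" using pos unfolding n_def by linarith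
    also have "\<dots> \<le> 4096 * (4 * l)\<^sup>2 * (513 * l) + l ^ 3"
      using k l l_pow[of 3] by (intro add_mono mult_right_mono mult_left_mono power_mono; linarith)
    also have "\<dots> = 33619969 * l ^ 3" by (simp add: power2_eq_square power3_eq_cube)
    also have "\<dots> \<le> 34000000 * l ^ 3" using l by (intro mult_right_mono) auto
    finally show ?thesis .
  qed
  have r_lower: "1100000000 * l ^ 4 \<le> r" unfolding r_def by (rule real_nat_ceiling_ge)
  have r_upper: "r \<le> 2000000000 * l ^ 4"
  proof -
    have "real r \<le> 1100000000 * l ^ 4 + 1" using mult_nonneg_nonneg[of 1100000000 "l ^ 4"] l_pow[of 4] unfolding r_def by linarith
    then show ?thesis using l_pow[of 4] by linarith
  qed
  have \<epsilon>: "0 < \<epsilon>" using k by (simp add: \<epsilon>_def)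
  have \<xi>: "0 < \<xi>" "\<xi> * exp l \<le> \<epsilon>" using \<epsilon> by (auto simp: \<xi>_def exp_minus)
  have \<xi>2: "4 * exp (- (\<epsilon>\<^sup>2 * n / 4)) \<le> \<xi>"
  proof -
    have "513 * l \<le> \<epsilon>\<^sup>2 * n / 4"
      using n_lower k by (simp add: \<epsilon>_def power_divide power_mult_distrib field_simps)
    then have "exp (- (\<epsilon>\<^sup>2 * n / 4)) \<le> exp (- (513 * l))" by simp
    moreover have "128 * real k \<le> exp (512 * l)"
      using k exp_ge_add_one_self[of "512 * l"] by linarith
    then have "128 * real k * exp (- (513 * l)) \<le> exp (512 * l) * exp (- (513 * l))"
      by (intro mult_right_mono) auto
    then have "128 * real k * exp (- (513 * l)) \<le> exp (- l)"
      by (simp add: exp_add[symmetric])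
    then have "4 * exp (- (513 * l)) \<le> \<xi>"
      using k by (simp add: \<xi>_def \<epsilon>_def field_simps)
    ultimately show ?thesis by linarith
  qed
  have "exp l * (2 / 4 ^ k) \<le> 1 / 8"
  proof -
    have "exp l \<le> exp (real m)" using m by simp
    also have "\<dots> \<le> 3 ^ m" by (rule e1)
    also have "\<dots> \<le> 4 ^ m" by (rule power_mono) auto
    finally have "exp l \<le> 4 ^ m" .
    then show ?thesis by (simp add: k_def power_add)
  qed
  then have \<nu>2: "exp l * (\<nu> + 2 / 4 ^ k) \<le> 1/4"
    unfolding \<nu>_def distrib_left by (simp only: exp_minus times_divide_eq_right right_inverse[OF exp_not_eq_zero])
  have "(2/3) ^ i \<le> \<nu> / 2"
  proof -
    have "(2/3::real) ^ i = (8/27) ^ m * (128/2187)"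
      unfolding i_def power_add power_mult by (simp add: power_divide)
    also have "\<dots> \<le> (1/3) ^ m * (1/16)"
      by (intro mult_mono power_mono) auto
    also have "(1/3::real) ^ m \<le> exp (- real m)"
      using e1[of m] by (simp add: exp_minus field_simps power_divide)
    also have "exp (- real m) \<le> exp (- l)" using m by simp
    finally show ?thesis by (simp add: \<nu>_def)
  qed
  moreover have "real r * \<nu>' \<le> \<nu> / 2"
  proof -
    have "32000000000 \<le> (2::real) ^ 35" by simp
    also have "(2::real) ^ 35 \<le> exp 1 ^ 35" using exp_ge_add_one_self[of 1] by (intro power_mono) auto
    also have "\<dots> \<le> exp (35 * l)" using l by (simp add: exp_of_nat_mult[symmetric])
    finally have e35: "32000000000 \<le> exp (35 * l)" .
    have "l \<le> exp l" using exp_ge_add_one_self[of l] by linarith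
    then have "l ^ 4 \<le> exp l ^ 4" using l by (intro power_mono) auto
    then have l4: "l ^ 4 \<le> exp (4 * l)" by (simp add: exp_of_nat_mult[symmetric])
    have "16 * real r \<le> (32000000000) * l ^ 4" using r_upper by simp
    also have "\<dots> \<le> exp (35 * l) * exp (4 * l)" using e35 l4 l by (intro mult_mono) auto
    also have "\<dots> = exp (39 * l)" by (simp add: exp_add[symmetric])
    finally have "16 * real r * exp (- 40 * l) \<le> exp (39 * l) * exp (- 40 * l)"
      by (intro mult_right_mono) auto
    also have "\<dots> = exp (- l)" by (simp add: exp_add[symmetric])
    finally show ?thesis by (simp add: \<nu>_def \<nu>'_def)
  qed
  ultimately have \<nu>4: "real r * \<nu>' + (2/3) ^ i \<le> \<nu>" by simp
  have rr: "32 * ln (8 * exp l ^ n) < r"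
  proof -
    have "ln (8 * exp l ^ n) = ln 8 + n * l"
      by (simp add: ln_mult ln_realpow)
    also have "\<dots> \<le> 7 + 34000000 * l ^ 3 * l"
      using ln_le_minus_one[of "8::real"] n_upper l by (intro add_mono mult_right_mono) auto
    also have "\<dots> = 7 + 34000000 * l ^ 4" by (simp add: power_numeral_reduce)
    finally show ?thesis using r_lower l_pow[of 4] by linarith
  qed
  have s6: "(2 * real k + 1) * s3 \<le> s2"
    using mult_right_mono[OF k(3), of s3] s by linarith
  have reg1: "card (B (s3 + real r * s4)) \<le> 2 * real (card (B s3))"
  proof -
    have "real r * s4 \<le> 2000000000 * l ^ 4 * s4" using r_upper s by (intro mult_right_mono) auto
    then have "B (s3 + real r * s4) \<subseteq> B (s3 + 2000000000 * l ^ 4 * s4)"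
      using s by (intro bsys_mono[OF B] add_pos_nonneg) auto
    moreover have "finite (B (s3 + 2000000000 * l ^ 4 * s4))"
      using s l by (intro bsys_finite[OF B] add_pos_pos mult_pos_pos) auto
    ultimately have "card (B (s3 + real r * s4)) \<le> card (B (s3 + 2000000000 * l ^ 4 * s4))"
      by (rule card_mono[rotated])
    then show ?thesis using reg(1) by linarith
  qed
  have \<nu>0: "0 \<le> \<nu>" "0 \<le> \<nu>'" by (auto simp: \<nu>_def \<nu>'_def)
  from bogolyubov_core[OF B s(1-5) s6 s(7) P Q K reg1 reg(2) k(1) n0 \<epsilon>_def \<xi> \<xi>2 \<nu>0(1) \<nu>2 \<nu>0(2) \<nu>4 rr]
  obtain \<Lambda> where \<Lambda>: "finite \<Lambda>" "card \<Lambda> < r"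
    "\<forall>t\<in>B (\<delta> / 2 ^ i). (\<forall>\<mu>\<in>\<Lambda>. cdev \<mu> t \<le> \<nu>') \<longrightarrow>
     card P * card Q \<le> 2 * card (sum_reps P Q t)"
    by (elim exE conjE) (rule that)
  have "B (\<delta> * exp (- 40 * l)) \<subseteq> B (\<delta> / 2 ^ i)"
  proof (rule bsys_mono[OF B])
    have "(2::real) ^ i \<le> exp 1 ^ i" using exp_ge_add_one_self[of 1] by (intro power_mono) auto
    also have "\<dots> = exp (real i)" by (simp add: exp_of_nat_mult[symmetric])
    also have "real i \<le> 40 * l" using m l by (simp add: i_def)
    then have "exp (real i) \<le> exp (40 * l)" by simp
    finally have "(2::real) ^ i \<le> exp (40 * l)" .
    then have "inverse (exp (40 * l)) \<le> inverse (2 ^ i)" by (intro le_imp_inverse_le) auto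
    then show "\<delta> * exp (- 40 * l) \<le> \<delta> / 2 ^ i"
      using s by (simp add: exp_minus divide_inverse)
  qed (use s in simp)
  then have "\<forall>t\<in>B (\<delta> * exp (- 40 * l)). (\<forall>\<mu>\<in>\<Lambda>. cdev \<mu> t \<le> exp (- 40 * l)) \<longrightarrow>
     card P * card Q \<le> 2 * card (sum_reps P Q t)"
    using \<Lambda>(3) unfolding \<nu>'_def by (meson subsetD)
  moreover have "real (card \<Lambda>) \<le> 2000000000 * l ^ 4" using \<Lambda>(2) r_upper by linarith
  ultimately show ?thesis using \<Lambda>(1) by (intro exI[of _ \<Lambda>] conjI)
qed

section \<open>Sums of four elements of a dense set\<close>

lemma symmetric_part_dense:
  fixes \<rho> :: real
  assumes H: "bsys N d w H" and s: "0 < s" "0 < s'" "0 < \<delta>" "s' \<le> \<delta>" and \<rho>: "0 \<le> \<rho>"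
    and dens: "\<rho> * card (H (s + \<delta>)) \<le> cnt Y x (H s)" "\<rho> * b \<le> cnt Y x (H s')" and b: "0 \<le> b"
  shows "\<exists>w\<in>H (s + \<delta>). \<rho>\<^sup>2 * b \<le> card {u\<in>H s'. x + u \<in> Y \<and> x + w - u \<in> Y}"
proof -
  have pos: "0 < real (card (H (s + \<delta>)))" using bsys_card_pos[OF H, of "s + \<delta>"] s by simp
  have "\<exists>w\<in>H (s + \<delta>). cnt Y x (H s) * cnt Y x (H s') \<le> card (H (s + \<delta>)) * card {u\<in>H s'. x + u \<in> Y \<and> x + w - u \<in> Y}"
  proof (rule symmetric_part)
    show "finite (H s)" "finite (H s')" "finite (H (s + \<delta>))"
      using s by (intro bsys_finite[OF H]; simp)+
    show "H (s + \<delta>) \<noteq> {}" using pos by auto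
    show "u + u' \<in> H (s + \<delta>)" if "u \<in> H s" "u' \<in> H s'" for u u'
      using bsys_add[OF H s(1,3) that(1), of u'] bsys_mono[OF H s(2,4)] that(2) by blast
  qed
  then obtain w where w: "w \<in> H (s + \<delta>)"
    "cnt Y x (H s) * cnt Y x (H s') \<le> card (H (s + \<delta>)) * card {u\<in>H s'. x + u \<in> Y \<and> x + w - u \<in> Y}" by blast
  have "card (H (s + \<delta>)) * (\<rho>\<^sup>2 * b) = (\<rho> * card (H (s + \<delta>))) * (\<rho> * b)"
    by (simp add: power2_eq_square)
  also have "\<dots> \<le> real (cnt Y x (H s)) * real (cnt Y x (H s'))"
    using dens \<rho> b by (intro mult_mono) auto
  also have "\<dots> \<le> real (card (H (s + \<delta>))) * real (card {u\<in>H s'. x + u \<in> Y \<and> x + w - u \<in> Y})"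
    using of_nat_mono[OF w(2), where 'a = real] by simp
  finally show ?thesis using w(1) pos by (intro bexI[of _ w]) (simp_all only: mult_le_cancel_left_pos)
qed

text \<open>The clause \<open>y1 \<noteq> v\<close> is the source of non-triviality:
  \<open>v\<close> becomes the variable on the right-hand side of the equation.\<close>

abbreviation four_sum :: "int set \<Rightarrow> int \<Rightarrow> int \<Rightarrow> bool" where
  "four_sum Y v s \<equiv> \<exists>y1 y2 y3 y4. {y1, y2, y3, y4} \<subseteq> Y \<and> y1 \<noteq> v \<and> y1 + y2 + y3 + y4 = s"

text \<open>From \<open>t = p + q - p' - q'\<close>, the number \<open>4 * x + wP + wQ + t\<close>
  is the sum of \<open>x + p\<close>, \<open>x + q\<close>, \<open>x + wP - p'\<close> and
  \<open>x + wQ - q'\<close>, all in \<open>Y\<close> because \<open>P\<close> and \<open>Q\<close>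
  are symmetric parts. The radii decrease from \<open>s0\<close> to \<open>s4\<close>: three carry
  the dense sets, one the almost periods, one the averages in Chang's theorem.\<close>

lemma four_sums:
  fixes l \<rho> :: real
  assumes H: "bsys N d w H" and l: "1 \<le> l" and \<rho>: "0 < \<rho>" "1 \<le> exp l * \<rho>\<^sup>2"
    and s: "0 < s0" "0 < s1" "0 < s2" "0 < s3" "0 < s4" "0 < \<delta>0" "0 < \<delta>1" "0 < \<delta>2" "0 < \<delta>4"
    and gaps: "s1 \<le> \<delta>0" "s2 \<le> \<delta>1" "s3 \<le> \<delta>2" "9 * l * s3 \<le> s2" "2000000000 * l ^ 4 * s4 \<le> \<delta>3" "\<delta>4 \<le> s3"
    and reg: "card (H (s3 + \<delta>3)) \<le> 2 * real (card (H s3))" "card (H (s4 + \<delta>4)) \<le> (11/10) * real (card (H s4))"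
    and dens: "\<rho> * card (H (s0 + \<delta>0)) \<le> cnt Y x (H s0)" "\<rho> * card (H (s1 + \<delta>1)) \<le> cnt Y x (H s1)"
      "\<rho> * card (H (s2 + \<delta>2)) \<le> cnt Y x (H s2)"
    and big: "3 \<le> \<rho>\<^sup>2 * card (H s2)"
  shows "\<exists>\<Lambda> z. finite \<Lambda> \<and> real (card \<Lambda>) \<le> 2000000000 * l ^ 4 \<and> z \<in> H ((s0 + \<delta>0) + (s1 + \<delta>1)) \<and>
     (\<forall>t\<in>H (\<delta>4 * exp (- 40 * l)). (\<forall>\<mu>\<in>\<Lambda>. cdev \<mu> t \<le> exp (- 40 * l)) \<longrightarrow>
       (\<forall>v. four_sum Y v (4 * x + z + t)))"
proof -
  have cpos: "0 \<le> real (card (H r))" for r by simp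
  obtain wQ where wQ: "wQ \<in> H (s0 + \<delta>0)"
    "\<rho>\<^sup>2 * card (H (s1 + \<delta>1)) \<le> card {u\<in>H s1. x + u \<in> Y \<and> x + wQ - u \<in> Y}"
    using symmetric_part_dense[OF H s(1,2,6) gaps(1) less_imp_le[OF \<rho>(1)] dens(1,2) cpos] by blast
  obtain wP where wP: "wP \<in> H (s1 + \<delta>1)"
    "\<rho>\<^sup>2 * card (H (s2 + \<delta>2)) \<le> card {u\<in>H s2. x + u \<in> Y \<and> x + wP - u \<in> Y}"
    using symmetric_part_dense[OF H s(2,3,7) gaps(2) less_imp_le[OF \<rho>(1)] dens(2,3) cpos] by blast
  define P where "P = {u\<in>H s2. x + u \<in> Y \<and> x + wP - u \<in> Y}"
  define Q where "Q = {u\<in>H s1. x + u \<in> Y \<and> x + wQ - u \<in> Y}"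
  have sub: "P \<subseteq> H s2" "Q \<subseteq> H s1" by (auto simp: P_def Q_def)
  have fin: "finite P" "finite Q"
    using sub bsys_finite[OF H s(2)] bsys_finite[OF H s(3)] finite_subset by blast+
  have mono: "real (card (H r)) \<le> card (H r')" if "0 < r" "r \<le> r'" for r r'
    using card_mono[OF bsys_finite[OF H] bsys_mono[OF H that]] that by simp
  have to_exp: "c \<le> exp l * p" if "\<rho>\<^sup>2 * c \<le> p" "0 \<le> c" for c p
  proof -
    have "1 * c \<le> (exp l * \<rho>\<^sup>2) * c" using \<rho>(2) that by (intro mult_right_mono) auto
    also have "\<dots> = exp l * (\<rho>\<^sup>2 * c)" by simp
    also have "\<dots> \<le> exp l * p" using that by (intro mult_left_mono) auto
    finally show ?thesis by simp
  qed
  have "card (H (s2 + s3)) \<le> real (card (H (s2 + \<delta>2)))" using s gaps by (intro mono) auto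
  also have "\<dots> \<le> exp l * card P" using wP(2) by (intro to_exp) (simp_all add: P_def)
  finally have K1: "card (H (s2 + s3)) \<le> exp l * card P" .
  have "card (H (s1 + s2)) \<le> real (card (H (s1 + \<delta>1)))" using s gaps by (intro mono) auto
  also have "\<dots> \<le> exp l * card Q" using wQ(2) by (intro to_exp) (simp_all add: Q_def)
  finally have K2: "card (H (s1 + s2)) \<le> exp l * card Q" .
  have P3: "3 \<le> card P"
  proof -
    have "3 \<le> \<rho>\<^sup>2 * card (H (s2 + \<delta>2))"
      using big mult_left_mono[OF mono[of s2 "s2 + \<delta>2"], of "\<rho>\<^sup>2"] s by simp
    then show ?thesis using wP(2) unfolding P_def by linarith
  qed
  have "0 < card (H (s1 + s2))" using s by (intro bsys_card_pos[OF H]) simp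
  then have "0 < exp l * card Q" using K2 by linarith
  then have Qne: "Q \<noteq> {}" by auto
  have Pne: "P \<noteq> {}" using P3 by auto
  have "0 < 2000000000 * l ^ 4 * s4" using l s by simp
  then have reg1: "card (H (s3 + 2000000000 * l ^ 4 * s4)) \<le> 2 * real (card (H s3))"
    using mono[of "s3 + 2000000000 * l ^ 4 * s4" "s3 + \<delta>3"] reg(1) s gaps by linarith
  obtain \<Lambda> where \<Lambda>: "finite \<Lambda>" "real (card \<Lambda>) \<le> 2000000000 * l ^ 4"
    "\<forall>t\<in>H (\<delta>4 * exp (- 40 * l)). (\<forall>\<mu>\<in>\<Lambda>. cdev \<mu> t \<le> exp (- 40 * l)) \<longrightarrow>
     card P * card Q \<le> 2 * card (sum_reps P Q t)"
    using local_bogolyubov[OF H l s(2,3,4,5,9) gaps(4,6) sub(1) Pne sub(2) Qne K1 K2 reg1 reg(2)]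
    by (elim exE conjE) (rule that)
  have main: "four_sum Y v (4 * x + (wP + wQ) + t)"
    if t: "t \<in> H (\<delta>4 * exp (- 40 * l))" "\<forall>\<mu>\<in>\<Lambda>. cdev \<mu> t \<le> exp (- 40 * l)" for t v
  proof -
    define R where "R = (sum_reps P Q t)"
    have R: "card P * card Q \<le> 2 * card R" using \<Lambda>(3) t unfolding R_def by blast
    \<comment> \<open>If the forbidden value were unavoidable, all pairs would share their first
      entry. There would then be at most \<open>card Q\<close> of them, fewer than the guaranteed
      \<open>card P * card Q / 2\<close>, since \<open>card P \<ge> 3\<close>.\<close>
    have "\<not> R \<subseteq> {x + wP - v} \<times> Q"
    proof
      assume "R \<subseteq> {x + wP - v} \<times> Q"
      then have "card R \<le> card ({x + wP - v} \<times> Q)" using fin by (intro card_mono) auto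
      then have "card R \<le> card Q" by (simp add: card_cartesian_product)
      moreover have "3 * card Q \<le> card P * card Q" using P3 by simp
      moreover have "0 < card Q" using Qne fin by (simp add: card_gt_0_iff)
      ultimately show False using R by linarith
    qed
    then obtain z where z: "z \<in> R" "z \<notin> {x + wP - v} \<times> Q" by blast
    then have zP: "fst z \<in> P" and zQ: "snd z \<in> Q" unfolding R_def by auto
    obtain p q where pq: "p \<in> P" "q \<in> Q" "t + fst z + snd z = p + q" using z(1) unfolding R_def by blast
    have "x + wP - fst z \<noteq> v"
    proof
      assume "x + wP - fst z = v"
      then have "fst z = x + wP - v" by simp
      then show False using z(2) zQ by (simp add: mem_Times_iff)
    qed
    moreover have "{x + wP - fst z, x + wQ - snd z, x + p, x + q} \<subseteq> Y"
      using zP zQ pq by (simp add: P_def Q_def)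
    moreover have "(x + wP - fst z) + (x + wQ - snd z) + (x + p) + (x + q) = 4 * x + (wP + wQ) + t"
      using pq(3) by simp
    ultimately show ?thesis by blast
  qed
  have z: "wP + wQ \<in> H ((s0 + \<delta>0) + (s1 + \<delta>1))"
    using bsys_add[OF H _ _ wQ(1) wP(1)] s by (simp add: add.commute)
  show ?thesis
  proof (rule exI[of _ \<Lambda>], rule exI[of _ "wP + wQ"], intro conjI ballI impI allI)
    fix t v assume "t \<in> H (\<delta>4 * exp (- 40 * l))" "\<forall>\<mu>\<in>\<Lambda>. cdev \<mu> t \<le> exp (- 40 * l)"
    then show "four_sum Y v (4 * x + (wP + wQ) + t)"
      by (rule main)
  qed (use \<Lambda>(1,2) z in auto)
qed

section \<open>Multiples, division by the coefficient, and sums of eight elements\<close>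

lemma bsys_multiple:
  assumes B: "bsys N d w B" and s: "0 < s" and b: "b \<in> B s" and K: "0 < K"
  shows "int K * b \<in> B (real K * s)"
  using K
proof (induction K rule: nat_induct_non_zero)
  case (Suc n)
  then have "int n * b + b \<in> B (real n * s + s)"
    using s b by (intro bsys_add[OF B]) auto
  then show ?case by (simp add: algebra_simps)
qed (use b in simp)

lemma card_preimage_mult:
  assumes "0 < K" "S \<subseteq> range ((*) (int K))"
  shows "card {b. int K * b \<in> S} = card S"
proof -
  have "(*) (int K) ` {b. int K * b \<in> S} = S" using assms(2) by auto
  moreover have "inj_on ((*) (int K)) {b. int K * b \<in> S}" using assms(1) by (auto simp: inj_on_def)
  ultimately show ?thesis by (metis card_image)
qed

text \<open>Division by \<open>K\<close> is a bijection on sets of multiples of \<open>K\<close>, so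
  neither rank nor size is lost.\<close>

lemma bsys_preimage_mult:
  assumes H: "bsys N d w H" and K: "0 < K" and range: "\<And>s. 0 < s \<Longrightarrow> H s \<subseteq> range ((*) (int K))"
  shows "bsys N d w (\<lambda>s. {b. int K * b \<in> H s})"
  unfolding bsys_def
proof (intro conjI allI impI ballI)
  fix s :: real assume s: "0 < s"
  show "0 \<in> {b. int K * b \<in> H s}" using bsys_0[OF H s] by simp
  fix x assume x: "x \<in> {b. int K * b \<in> H s}"
  show "- x \<in> {b. int K * b \<in> H s}" using bsys_minus[OF H s, of "int K * x"] x by simp
  have "\<bar>real_of_int x\<bar> * 1 \<le> \<bar>real_of_int x\<bar> * K" using K by (intro mult_left_mono) auto
  also have "\<dots> = \<bar>real_of_int (int K * x)\<bar>" by (simp add: abs_mult)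
  also have "\<dots> \<le> s * N" using bsys_bound[OF H s, of "int K * x"] x by simp
  finally show "\<bar>real_of_int x\<bar> \<le> s * N" by simp
next
  fix s t :: real and x y
  assume "0 < s" "0 < t" "x \<in> {b. int K * b \<in> H s}" "y \<in> {b. int K * b \<in> H t}"
  then show "x + y \<in> {b. int K * b \<in> H (s + t)}"
    using bsys_add[OF H, of s t "int K * x" "int K * y"] by (simp add: distrib_left)
next
  fix s :: real assume s: "0 < s \<and> s \<le> 1"
  then show "w + d * ln s \<le> ln (card {b. int K * b \<in> H s})"
    using bsys_card[OF H, of s] by (simp add: card_preimage_mult[OF K range])
qed

text \<open>The four points near \<open>A\<close> that add up to \<open>4 * x + z2 + t0\<close> are
  moved into \<open>A\<close> by corrections from \<open>T\<close>. The total correction is, up to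
  sign, in \<open>T1\<close>, and the other four summands are chosen to cancel it.\<close>

lemma eight_sums:
  fixes A T1 T :: "int set"
  assumes four1: "\<And>t v. t \<in> T1 \<Longrightarrow>
      four_sum A v (4 * x + z1 + t)"
    and four2: "\<exists>y1 y2 y3 y4. {y1, y2, y3, y4} \<subseteq> {y. \<exists>t\<in>T. y + t \<in> A} \<and> y1 + y2 + y3 + y4 = 4 * x + z2 + t0"
    and T: "\<And>a b c d. a \<in> T \<Longrightarrow> b \<in> T \<Longrightarrow> c \<in> T \<Longrightarrow> d \<in> T \<Longrightarrow> - (a + b + c + d) \<in> T1"
  shows "\<exists>xs. length xs = 8 \<and> set xs \<subseteq> A \<and> (\<exists>y\<in>set xs. y \<noteq> v) \<and> sum_list xs = 8 * x + z1 + z2 + t0"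
proof -
  obtain y1 y2 y3 y4 where y: "{y1, y2, y3, y4} \<subseteq> {y. \<exists>t\<in>T. y + t \<in> A}" "y1 + y2 + y3 + y4 = 4 * x + z2 + t0"
    using four2 by blast
  obtain a b c d where t: "a \<in> T" "b \<in> T" "c \<in> T" "d \<in> T"
    and A: "y1 + a \<in> A" "y2 + b \<in> A" "y3 + c \<in> A" "y4 + d \<in> A"
    using y(1) by auto
  obtain u1 u2 u3 u4 where u: "{u1, u2, u3, u4} \<subseteq> A" "u1 \<noteq> v"
    "u1 + u2 + u3 + u4 = 4 * x + z1 + - (a + b + c + d)"
    using four1[OF T[OF t]] by blast
  show ?thesis
    by (rule exI[of _ "[u1, u2, u3, u4, y1 + a, y2 + b, y3 + c, y4 + d]"])
      (use u A y(2) in \<open>simp add: algebra_simps\<close>)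
qed

subsection \<open>The density increment\<close>

lemma regular_scale:
  fixes N a :: real
  assumes B: "bsys N d w B" and N: "1 \<le> N" and a: "0 < a" "a \<le> 1"
    and M: "0 < M" "101 * (ln (5 * N) - w - d * ln a) \<le> M"
  shows "\<exists>s. a \<le> s - a / (2 * real M) \<and> s + a / (2 * real M) \<le> 2 * a \<and>
     card (B (s + a / (2 * real M))) \<le> (101/100) * real (card (B (s - a / (2 * real M))))"
proof -
  \<comment> \<open>The growth factor \<open>101/100\<close> has logarithm at least
    \<open>1/101\<close>; hence the 101 in the condition on \<open>M\<close>.\<close>
  have "1 / 101 \<le> ln (1 + 1/100 :: real)"
    using ln_le_minus_one[of "100/101 :: real"] by (simp add: ln_div)
  then have "M * (1 / 101) \<le> M * ln (1 + 1/100 :: real)" by (intro mult_left_mono) auto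
  moreover have "ln (5 * N) - w - d * ln a \<le> M * (1 / 101)" using M by simp
  ultimately have "ln (5 * N) - w - d * ln a \<le> M * ln (1 + 1/100 :: real)" by (rule order_trans[rotated])
  from bsys_regular_radius[OF B N a M(1) this] show ?thesis by simp
qed

lemma cnt_le_of_not_dense_in_system:
  fixes \<beta> :: real
  assumes T: "bsys N d w T" and nd: "\<not> dense_in A (T \<delta>) \<beta>" and s: "0 < s" "0 < \<delta>" and \<beta>: "0 \<le> \<beta>"
    and reg: "card (T (s + \<delta>)) \<le> (101/100) * real (card (T s))"
  shows "cnt A y (T s) \<le> (101/100) * \<beta> * card (T s)"
proof -
  have "cnt A y (T s) \<le> (1 + 1/100) * \<beta> * card (T s)"
  proof (rule cnt_le_if_not_dense_in[OF nd])
    show "finite (T (s + \<delta>))" "finite (T s)" using s by (intro bsys_finite[OF T]; simp)+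
    show "T (s + \<delta>) \<noteq> {}" using bsys_0[OF T, of "s + \<delta>"] s by auto
    show "u - v \<in> T (s + \<delta>)" if "u \<in> T s" "v \<in> T \<delta>" for u v
      by (rule bsys_diff[OF T s that])
  qed (use reg \<beta> in auto)
  then show ?thesis by simp
qed

text \<open>The cap \<open>10201/10000\<close> is \<open>101/100\<close> squared, one factor for the
  missing increment and one for regularity. Five sets leave \<open>5 - 4 * 1.0201 = 0.9196\<close>
  of the density. \<open>J\<close> is a set of sets, so coincidences only lower its size, which
  helps.\<close>

lemma exists_dense_translate:
  fixes \<alpha> :: real
  assumes dense: "dense_in A W \<alpha>" and \<alpha>: "0 \<le> \<alpha>" and J: "finite J" "card J \<le> 5"
    and U: "\<And>U. U \<in> J \<Longrightarrow> finite U \<and> U \<noteq> {} \<and> U \<subseteq> W"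
    and upper: "\<And>U y. U \<in> J \<Longrightarrow> cnt A y U \<le> (10201/10000) * \<alpha> * card U"
  shows "\<exists>y. \<forall>U\<in>J. (919/1000) * \<alpha> * card U \<le> cnt A y U"
proof -
  obtain y where y: "\<forall>U\<in>J. (real (card J) - (real (card J) - 1) * (10201/10000)) * \<alpha> * card U \<le> cnt A y U"
    using dense_in_common_translate[OF dense J(1), of "\<lambda>U. U" "10201/10000"] U upper by auto
  have "(919/1000) * \<alpha> * card U \<le> cnt A y U" if "U \<in> J" for U
  proof -
    have "919/1000 \<le> real (card J) - (real (card J) - 1) * (10201/10000)" proof -
      have "real (card J) \<le> 5" using J(2) by simp
      then show ?thesis by (simp add: field_simps)
    qed
    then have "(919/1000) * \<alpha> * card U \<le> (real (card J) - (real (card J) - 1) * (10201/10000)) * \<alpha> * card U"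
      using \<alpha> by (intro mult_right_mono) auto
    then show ?thesis using y that by force
  qed
  then show ?thesis by blast
qed

text \<open>The scaling puts radius \<open>\<delta> * e\<close> and tolerance \<open>e\<close>, the
  range of the Bogolyubov conclusion, at index 8; four elements of index at most 1 can be added
  within it. The 72 combines this 8 with the 9 of \<open>bsys_restrict\<close>.\<close>

lemma restricted_system:
  fixes e c \<delta> :: real
  assumes H: "bsys N d (w - d * \<kappa>) H" and d: "0 \<le> d" and \<kappa>: "0 \<le> \<kappa>"
    and \<Lambda>: "finite \<Lambda>" and e: "0 < e" "e \<le> 1" and \<delta>: "0 < \<delta>" "\<delta> \<le> 1"
    and c: "\<kappa> + ln (72 / (\<delta> * e)) \<le> c"
  shows "bsys N (d + card \<Lambda>) (w - (d + card \<Lambda>) * c)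
     (\<lambda>s. {t\<in>H (\<delta> * e / 8 * s). \<forall>\<theta>\<in>\<Lambda>. cdev \<theta> t \<le> e / 8 * s})"
proof -
  have p: "0 < \<delta> * e" "\<delta> * e \<le> 1" "\<delta> * e \<le> e" using e \<delta> by (auto simp: mult_le_one mult_left_le_one_le)
  have R: "bsys N (d + card \<Lambda>) (w - d * \<kappa> + d * ln (\<delta> * e / 8 / 2) + card \<Lambda> * ln (e / 8 / 9))
     (\<lambda>s. {t\<in>H (\<delta> * e / 8 * s). \<forall>\<theta>\<in>\<Lambda>. cdev \<theta> t \<le> e / 8 * s})"
    by (rule bsys_restrict[OF H \<Lambda>]; use p e in linarith)
  have 1: "- ln (\<delta> * e / 8 / 2) \<le> c - \<kappa>"
  proof -
    have "- ln (\<delta> * e / 8 / 2) = ln (16 / (\<delta> * e))" using p by (simp add: ln_div)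
    also have "\<dots> \<le> ln (72 / (\<delta> * e))" using p by (intro ln_mono divide_right_mono) auto
    finally show ?thesis using c by simp
  qed
  have 2: "- ln (e / 8 / 9) \<le> c"
  proof -
    have "- ln (e / 8 / 9) = ln (72 / e)" using e by (simp add: ln_div)
    also have "\<dots> \<le> ln (72 / (\<delta> * e))" using p e by (intro ln_mono divide_left_mono) auto
    finally show ?thesis using c \<kappa> by simp
  qed
  have "w - (d + card \<Lambda>) * c \<le> w - d * \<kappa> + d * ln (\<delta> * e / 8 / 2) + card \<Lambda> * ln (e / 8 / 9)"
    using mult_left_mono[OF 1 d] mult_left_mono[OF 2, of "real (card \<Lambda>)"] by (simp add: algebra_simps)
  then show ?thesis
    using R unfolding bsys_def by (meson add_right_mono order_trans)
qed

text \<open>The \<open>K\<close> summands are \<open>a\<close>, the eight given ones and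
  \<open>K - 9\<close> copies of \<open>x + f\<close>. One of the eight differs from
  \<open>c\<close>, so the solution is non-trivial.\<close>

lemma no_solution_of_common_point:
  fixes A :: "int set" and K :: nat
  assumes nosol: "\<And>xs c. length xs = K \<Longrightarrow> set xs \<subseteq> A \<Longrightarrow> c \<in> A \<Longrightarrow> sum_list xs = int K * c \<Longrightarrow> \<forall>y\<in>set xs. y = c"
    and K: "9 \<le> K" and a: "a \<in> A" and f: "x + f \<in> A" and c: "c \<in> A"
    and o: "z1 + z2 + int (K - 9) * f = off"
    and t: "int K * c = a + int (K - 1) * x + off + t"
    and eight: "\<exists>xs. length xs = 8 \<and> set xs \<subseteq> A \<and> (\<exists>y\<in>set xs. y \<noteq> c) \<and> sum_list xs = 8 * x + z1 + z2 + t"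
  shows False
proof -
  obtain xs y where xs: "length xs = 8" "set xs \<subseteq> A" "y \<in> set xs" "y \<noteq> c" "sum_list xs = 8 * x + z1 + z2 + t"
    using eight by blast
  let ?ys = "a # xs @ replicate (K - 9) (x + f)"
  have "sum_list ?ys = a + (8 * x + z1 + z2 + t) + int (K - 9) * (x + f)"
    using xs(5) by (simp add: sum_list_replicate)
  also have "\<dots> = int K * c" using t K unfolding o[symmetric] by (simp add: of_nat_diff algebra_simps)
  finally have "\<forall>y\<in>set ?ys. y = c"
    using xs K a f c by (intro nosol) auto
  then show False using xs by auto
qed

text \<open>\<open>1 / (4 * M)\<close> is the regularity gap at the base radius \<open>1/2\<close>.
  An increment would be recorded on the system rescaled to this gap, and the term
  \<open>ln (4 * M)\<close> withheld in the hypothesis on \<open>T\<close> pays for the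
  rescaling.\<close>

lemma regular_increment_system:
  fixes c dd :: real
  assumes T: "bsys N dd (w - dd * (c - ln (4 * real M))) T" and dd: "0 \<le> dd" and M: "0 < M" and N: "1 \<le> N"
    and budget: "101 * (ln (5 * N) - w + dd * c) \<le> real M"
  shows "\<exists>s. 0 < s \<and> s \<le> 1 \<and> card (T (s + 1 / (4 * real M))) \<le> (101/100) * real (card (T s))"
    and "bsys N dd (w - dd * c) (\<lambda>s. T (1 / (4 * real M) * s))"
proof -
  have M1: "1 \<le> real M" using M by simp
  have "ln (1 / (4 * real M)) = - ln (4 * real M)" using M by (simp add: ln_div)
  moreover have "bsys N dd (w - dd * (c - ln (4 * real M)) + dd * ln (1 / (4 * real M))) (\<lambda>s. T (1 / (4 * real M) * s))"
    using M1 by (intro bsys_rescale[OF T]) auto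
  ultimately show "bsys N dd (w - dd * c) (\<lambda>s. T (1 / (4 * real M) * s))"
    by (simp add: algebra_simps)
  have "ln 2 \<le> ln (4 * real M)" using M1 by (intro ln_mono) auto
  then have "- (dd * ln (1 / 2)) \<le> dd * ln (4 * real M)" using dd by (simp add: ln_div mult_left_mono)
  then have "101 * (ln (5 * N) - (w - dd * (c - ln (4 * real M))) - dd * ln (1 / 2)) \<le> M"
    using budget by (simp add: algebra_simps)
  from regular_scale[OF T N _ _ M this]
  obtain s where s: "1/2 \<le> s - 1/2 / (2 * real M)" "s + 1/2 / (2 * real M) \<le> 2 * (1/2)"
    "card (T (s + 1/2 / (2 * real M))) \<le> (101/100) * real (card (T (s - 1/2 / (2 * real M))))" by auto
  have eq: "1/2 / (2 * real M) = 1 / (4 * real M)" by simp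
  have p: "0 < 1 / (4 * real M)" using M by simp
  note s = s[unfolded eq]
  have s0: "0 < s" "s \<le> 1" "0 < s - 1 / (4 * real M)" using s p by linarith+
  have "card (T (s - 1 / (4 * real M))) \<le> card (T s)"
    by (intro card_mono bsys_finite[OF T] bsys_mono[OF T]; use s0 p in linarith)
  then have "card (T (s + 1 / (4 * real M))) \<le> (101/100) * real (card (T s))" using s(3) by linarith
  then show "\<exists>s. 0 < s \<and> s \<le> 1 \<and> card (T (s + 1 / (4 * real M))) \<le> (101/100) * real (card (T s))"
    using s0 by blast
qed

text \<open>Without an increment at \<open>g ^ 4\<close>, the density on all translates of the
  regular sets above that scale is capped, which is what a common dense translate requires. Scales 1
  to 3 host the dense sets of \<open>four_sums\<close>, while 4 and 5 need only regularity. At the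
  top scale both \<open>B\<close> and its dilate \<open>H\<close> occur, because in the end
  \<open>x + b\<close> and \<open>x + K * b\<close> must both be close to \<open>A\<close>.\<close>

lemma dense_scales:
  fixes N d w \<alpha> g :: real and K M :: nat
  defines "\<delta> \<equiv> \<lambda>j::nat. g ^ j / (2 * real M)"
  assumes B: "bsys N d w B" and N: "1 \<le> N" and d: "0 \<le> d" and dense: "dense_in A (B 1) \<alpha>" and \<alpha>: "0 < \<alpha>"
    and K: "0 < K" and M: "0 < M" and g: "0 < g" "32 * real K * g * M \<le> 1"
    and budget: "101 * (ln (5 * N) - w + d * (ln K + 5 * ln (1 / g))) \<le> M"
    and H_def: "H = (\<lambda>s. (*) (int K) ` B (s / K))"
    and nB: "\<not> dense_in A (B (g ^ 4)) ((101/100) * \<alpha>)" and nH: "\<not> dense_in A (H (g ^ 4)) ((101/100) * \<alpha>)"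
  shows "\<exists>\<sigma> s x. 1/2 \<le> \<sigma> - 1 / (4 * real M) \<and> \<sigma> + 1 / (4 * real M) \<le> 1 \<and>
     card (H (\<sigma> + 1 / (4 * real M))) \<le> (101/100) * real (card (H (\<sigma> - 1 / (4 * real M)))) \<and>
     (\<forall>j\<in>{1..5}. g ^ j \<le> s j - \<delta> j \<and> s j + \<delta> j \<le> 2 * g ^ j \<and>
        card (H (s j + \<delta> j)) \<le> (101/100) * real (card (H (s j - \<delta> j)))) \<and>
     (919/1000) * \<alpha> * card (B ((\<sigma> - 1 / (4 * real M)) / K)) \<le> cnt A x (B ((\<sigma> - 1 / (4 * real M)) / K)) \<and>
     (919/1000) * \<alpha> * card (H (\<sigma> - 1 / (4 * real M))) \<le> cnt A x (H (\<sigma> - 1 / (4 * real M))) \<and>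
     (\<forall>j\<in>{1..3}. (919/1000) * \<alpha> * card (H (s j - \<delta> j)) \<le> cnt A x (H (s j - \<delta> j)))"
proof -
  let ?e = "1 / (4 * real M)"
  have K1: "1 \<le> real K" and M1: "1 \<le> real M" using K M by auto
  have H: "bsys N d (w - d * ln K) H" unfolding H_def using K by (intro bsys_dilate[OF B]) auto
  have KM: "1 \<le> real K * real M" using mult_mono[OF K1 M1] by simp
  have g4: "g \<le> 1 / (32 * real K * M)" using g K1 M1 by (simp add: pos_le_divide_eq mult_ac)
  have "g * 1 \<le> g * (real K * real M)" using KM g by (intro mult_left_mono) auto
  moreover have "32 * real K * g * M = 32 * (g * (real K * real M))" by simp
  ultimately have g1: "g \<le> 1/32" using g(2) by linarith
  have gp: "g ^ j \<le> 1" "0 < g ^ j" for j using g g1 by (auto intro: power_le_one)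
  have reg: "\<exists>s. a \<le> s - a / (2 * real M) \<and> s + a / (2 * real M) \<le> 2 * a \<and>
     card (H (s + a / (2 * real M))) \<le> (101/100) * real (card (H (s - a / (2 * real M))))"
    if a: "g ^ 5 \<le> a" "a \<le> 1" for a
  proof -
    have a0: "0 < a" using a gp(2)[of 5] by linarith
    have "ln (g ^ 5) \<le> ln a" using a gp(2)[of 5] by (intro ln_mono) auto
    then have "- ln a \<le> 5 * ln (1 / g)" using g by (simp add: ln_div ln_realpow)
    then have "d * - ln a \<le> d * (5 * ln (1 / g))" using d by (rule mult_left_mono)
    then have "101 * (ln (5 * N) - (w - d * ln K) - d * ln a) \<le> M"
      using budget by (simp add: algebra_simps)
    from regular_scale[OF H N a0 a(2) M this] show ?thesis .
  qed
  have half: "g ^ 5 \<le> 1/2" using power_decreasing[of 1 5 g] g g1 by simp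
  obtain \<sigma> where \<sigma>: "1/2 \<le> \<sigma> - ?e" "\<sigma> + ?e \<le> 1" "card (H (\<sigma> + ?e)) \<le> (101/100) * real (card (H (\<sigma> - ?e)))"
    using reg[OF half] by auto
  have "\<forall>j\<in>{1..5}. \<exists>s. g ^ j \<le> s - \<delta> j \<and> s + \<delta> j \<le> 2 * g ^ j \<and>
        card (H (s + \<delta> j)) \<le> (101/100) * real (card (H (s - \<delta> j)))"
  proof
    fix j :: nat assume "j \<in> {1..5}"
    then have "g ^ 5 \<le> g ^ j" using g g1 by (intro power_decreasing) auto
    then show "\<exists>s. g ^ j \<le> s - \<delta> j \<and> s + \<delta> j \<le> 2 * g ^ j \<and>
        card (H (s + \<delta> j)) \<le> (101/100) * real (card (H (s - \<delta> j)))"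
      unfolding \<delta>_def using reg[of "g ^ j"] gp by blast
  qed
  then obtain s where s: "\<forall>j\<in>{1..5}. g ^ j \<le> s j - \<delta> j \<and> s j + \<delta> j \<le> 2 * g ^ j \<and>
        card (H (s j + \<delta> j)) \<le> (101/100) * real (card (H (s j - \<delta> j)))"
    by (rule bchoice[THEN exE])
  have \<delta>: "0 < \<delta> j" for j using gp(2)[of j] M1 by (simp add: \<delta>_def)
  have e: "0 < ?e" using M1 by simp
  have cardH: "card (H r) = card (B (r / K))" for r
    unfolding H_def using K by (intro card_image) (auto simp: inj_on_def)
  have HB: "H r \<subseteq> B 1" if "0 < r" "r \<le> 1" for r
  proof -
    have "int K * b \<in> B r" if "b \<in> B (r / K)" for b
      using bsys_multiple[OF B _ that K] \<open>0 < r\<close> K by simp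
    then show ?thesis using bsys_mono[OF B that] unfolding H_def by auto
  qed
  have g4e: "g ^ 4 \<le> ?e / K"
  proof -
    have "g ^ 4 \<le> g ^ 1" using g g1 by (intro power_decreasing) auto
    also have "\<dots> \<le> 1 / (32 * real K * M)" using g4 by simp
    also have "\<dots> \<le> 1 / (4 * (real K * M))" using K1 M1 by (intro divide_left_mono) auto
    finally show ?thesis by (simp add: mult_ac)
  qed
  have g4e': "g ^ 4 \<le> ?e"
  proof -
    have "?e / K \<le> ?e / 1" using K1 e by (intro divide_left_mono) auto
    then show ?thesis using g4e by simp
  qed
  have upper_H: "cnt A y (H (r - \<epsilon>)) \<le> (10201/10000) * \<alpha> * card (H (r - \<epsilon>))"
    if r: "0 < r - \<epsilon>" "0 < \<epsilon>" "g ^ 4 \<le> \<epsilon>" "card (H (r + \<epsilon>)) \<le> (101/100) * real (card (H (r - \<epsilon>)))" for r \<epsilon> y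
  proof -
    have nd: "\<not> dense_in A (H \<epsilon>) ((101/100) * \<alpha>)"
      using nH dense_in_mono[OF _ bsys_mono[OF H gp(2) r(3)]] by blast
    have "card (H r) \<le> card (H (r + \<epsilon>))"
      using r by (intro card_mono bsys_finite[OF H] bsys_mono[OF H]) auto
    then have "card (H (r - \<epsilon> + \<epsilon>)) \<le> (101/100) * real (card (H (r - \<epsilon>)))" using r(4) by simp
    from cnt_le_of_not_dense_in_system[OF H nd r(1,2) _ this, of y] show ?thesis using \<alpha> by simp
  qed
  have upper_B: "cnt A y (B ((\<sigma> - ?e) / K)) \<le> (10201/10000) * \<alpha> * card (B ((\<sigma> - ?e) / K))" for y
  proof -
    have nd: "\<not> dense_in A (B (?e / K)) ((101/100) * \<alpha>)"
      using nB dense_in_mono[OF _ bsys_mono[OF B gp(2) g4e]] by blast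
    have "card (H \<sigma>) \<le> card (H (\<sigma> + ?e))"
      by (intro card_mono bsys_finite[OF H] bsys_mono[OF H]; use \<sigma>(1) e in linarith)
    moreover have "(\<sigma> - ?e) / K + ?e / K = \<sigma> / K" by (simp add: diff_divide_distrib)
    ultimately have r: "card (B ((\<sigma> - ?e) / K + ?e / K)) \<le> (101/100) * real (card (B ((\<sigma> - ?e) / K)))"
      using \<sigma>(3) by (simp only: cardH)
    have "0 < (\<sigma> - ?e) / K" "0 < ?e / K" using \<sigma> e K1 by auto
    from cnt_le_of_not_dense_in_system[OF B nd this _ r, of y] show ?thesis using \<alpha> by simp
  qed
  have sj: "0 < s j - \<delta> j" "s j - \<delta> j \<le> 1" if "j \<in> {1..5}" for j
  proof -
    have *: "g ^ j \<le> s j - \<delta> j" "s j + \<delta> j \<le> 2 * g ^ j" using s that by auto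
    show "0 < s j - \<delta> j" using *(1) gp(2)[of j] by linarith
    have "g ^ j \<le> g ^ 1" using that g g1 by (intro power_decreasing) auto
    then show "s j - \<delta> j \<le> 1" using *(2) g1 \<delta>[of j] by simp
  qed
  \<comment> \<open>Scale 3 is the last one whose gap is at least \<open>g ^ 4\<close>.\<close>
  have g4\<delta>: "g ^ 4 \<le> \<delta> j" if "j \<in> {1..3}" for j
  proof -
    have "g ^ 4 = g * g ^ 3" by (simp add: power_numeral_reduce)
    also have "\<dots> \<le> (1 / (2 * real M)) * g ^ j"
    proof (rule mult_mono)
      have "1 / (32 * real K * M) \<le> 1 / (2 * real M)" using K1 M1 by (intro divide_left_mono) auto
      then show "g \<le> 1 / (2 * real M)" using g4 by linarith
      show "g ^ 3 \<le> g ^ j" using that g g1 by (intro power_decreasing) auto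
    qed (use g M1 in auto)
    finally show ?thesis by (simp add: \<delta>_def)
  qed
  define J where "J = insert (B ((\<sigma> - ?e) / K)) (insert (H (\<sigma> - ?e)) ((\<lambda>j. H (s j - \<delta> j)) ` {1..3}))"
  have "card ((\<lambda>j. H (s j - \<delta> j)) ` {1..3::nat}) \<le> 3"
    using card_image_le[of "{1..3::nat}" "\<lambda>j. H (s j - \<delta> j)"] by simp
  then have J: "finite J" "card J \<le> 5"
    unfolding J_def by (auto intro!: order_trans[OF card_insert_le_m1] simp: card_insert_if)
  have "\<exists>x. \<forall>U\<in>J. (919/1000) * \<alpha> * card U \<le> cnt A x U"
  proof (rule exists_dense_translate[OF dense less_imp_le[OF \<alpha>] J])
    have 1: "finite (B ((\<sigma> - ?e) / K)) \<and> B ((\<sigma> - ?e) / K) \<noteq> {} \<and> B ((\<sigma> - ?e) / K) \<subseteq> B 1"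
    proof -
      have p: "0 < (\<sigma> - ?e) / K" using \<sigma> K1 by simp
      have "\<sigma> - ?e \<le> 1 * real K" using \<sigma>(2) e K1 by linarith
      then have "(\<sigma> - ?e) / K \<le> 1" using K1 by (subst pos_divide_le_eq) linarith+
      then show ?thesis using bsys_finite[OF B p] bsys_0[OF B p] bsys_mono[OF B p] by auto
    qed
    have 2: "finite (H r) \<and> H r \<noteq> {} \<and> H r \<subseteq> B 1" if "0 < r" "r \<le> 1" for r
      using bsys_finite[OF H that(1)] bsys_0[OF H that(1)] HB[OF that] by auto
    have \<sigma>': "0 < \<sigma> - ?e" "\<sigma> - ?e \<le> 1" using \<sigma> e by linarith+
    show "finite U \<and> U \<noteq> {} \<and> U \<subseteq> B 1" if "U \<in> J" for U
    proof -
      have "U = B ((\<sigma> - ?e) / K) \<or> U = H (\<sigma> - ?e) \<or> (\<exists>j\<in>{1..3}. U = H (s j - \<delta> j))"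
        using that unfolding J_def by auto
      moreover have "finite (H (s j - \<delta> j)) \<and> H (s j - \<delta> j) \<noteq> {} \<and> H (s j - \<delta> j) \<subseteq> B 1" if "j \<in> {1..3}" for j
        using that by (intro 2 sj) auto
      ultimately show ?thesis using 1 2[OF \<sigma>'] by blast
    qed
    show "cnt A y U \<le> (10201/10000) * \<alpha> * card U" if "U \<in> J" for U y
    proof -
      have "U = B ((\<sigma> - ?e) / K) \<or> U = H (\<sigma> - ?e) \<or> (\<exists>j\<in>{1..3}. U = H (s j - \<delta> j))"
        using that unfolding J_def by auto
      moreover have "cnt A y (H (\<sigma> - ?e)) \<le> (10201/10000) * \<alpha> * card (H (\<sigma> - ?e))"
        by (rule upper_H[OF \<sigma>'(1) e g4e' \<sigma>(3)])
      moreover have "cnt A y (H (s j - \<delta> j)) \<le> (10201/10000) * \<alpha> * card (H (s j - \<delta> j))" if j: "j \<in> {1..3}" for j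
        using s j by (intro upper_H[OF sj(1) \<delta> g4\<delta>[OF j]]) auto
      ultimately show ?thesis using upper_B[of y] by blast
    qed
  qed
  then obtain x where x: "\<forall>U\<in>J. (919/1000) * \<alpha> * card U \<le> cnt A x U" by blast
  show ?thesis
  proof (rule exI[of _ \<sigma>], rule exI[of _ s], rule exI[of _ x], intro conjI)
    show "\<forall>j\<in>{1..3}. (919/1000) * \<alpha> * card (H (s j - \<delta> j)) \<le> cnt A x (H (s j - \<delta> j))"
      using x unfolding J_def by simp
  qed (use \<sigma> s x in \<open>simp_all add: J_def\<close>)
qed

text \<open>\<open>c1\<close> and \<open>c2\<close> are logarithmic costs per dimension. Their main
  terms are 40 times the exponents \<open>3 * \<rho>\<^sup>2\<close> and \<open>3 * \<rho>\<close>
  at which the Bogolyubov lemma is used, the 40 coming from its radius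
  \<open>exp (- 40 * l)\<close>; the logarithms pay for scales, dilation and regularity. The rank
  \<open>2000000000 * l ^ 4\<close> with \<open>3 ^ 4 = 81\<close> is covered by
  \<open>200000000000\<close> times \<open>\<rho> ^ 8\<close> or \<open>\<rho> ^ 4\<close>.\<close>

lemma increment_step:
  fixes N d w \<alpha> \<rho> g c1 c2 :: real and K M :: nat
  assumes B: "bsys N d w B" and N: "1 \<le> N" and d: "0 \<le> d"
    and dense: "dense_in A (B 1) \<alpha>" and \<alpha>: "exp (- \<rho>\<^sup>2) \<le> \<alpha>" and \<rho>: "1 \<le> \<rho>"
    and K: "9 \<le> K" and M: "0 < M" and g: "0 < g" "g * (1000000000000 * \<rho> ^ 8 * K * M) \<le> 1"
    and c1: "ln K + 5 * ln (1 / g) + ln (144 * real M) + ln (4 * real M) + 120 * \<rho>\<^sup>2 \<le> c1"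
    and c2: "ln K + 5 * ln (1 / g) + ln (144 * real M) + ln (4 * real M) + 120 * \<rho> \<le> c2" "c2 \<le> c1"
    and budget: "101 * (ln (5 * N) - w + (d + 200000000000 * \<rho> ^ 8) * c1) \<le> M"
    and big: "6 * \<rho>\<^sup>2 \<le> w + d * (5 * ln g - ln K)"
    and nosol: "\<And>xs c. length xs = K \<Longrightarrow> set xs \<subseteq> A \<Longrightarrow> c \<in> A \<Longrightarrow> sum_list xs = int K * c \<Longrightarrow> \<forall>y\<in>set xs. y = c"
  shows "\<exists>B' d' w' \<alpha>'. bsys N d' w' B' \<and> 0 \<le> d' \<and> dense_in A (B' 1) \<alpha>' \<and>
     (exp \<rho> * \<alpha> \<le> \<alpha>' \<and> d' \<le> d + 200000000000 * \<rho> ^ 8 \<and> w - (d + 200000000000 * \<rho> ^ 8) * c1 \<le> w' \<or>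
      (101/100) * \<alpha> \<le> \<alpha>' \<and> d' \<le> d + 200000000000 * \<rho> ^ 4 \<and> w - (d + 200000000000 * \<rho> ^ 4) * c2 \<le> w')"
proof (rule ccontr)
  assume no: "\<not> ?thesis"
  define R1 where "R1 = 200000000000 * \<rho> ^ 8"
  define R2 where "R2 = 200000000000 * \<rho> ^ 4"
  have no1: False if "bsys N d' w' B'" "0 \<le> d'" "dense_in A (B' 1) (exp \<rho> * \<alpha>)" "d' \<le> d + R1" "w - (d + R1) * c1 \<le> w'" for d' w' B'
    using no that unfolding R1_def by blast
  have no2: False if "bsys N d' w' B'" "0 \<le> d'" "dense_in A (B' 1) ((101/100) * \<alpha>)" "d' \<le> d + R2" "w - (d + R2) * c2 \<le> w'" for d' w' B'
    using no that unfolding R2_def by blast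
  define e where "e = 1 / (4 * real M)"
  define \<delta> where "\<delta> j = g ^ j / (2 * real M)" for j :: nat
  define H where "H = (\<lambda>s. (*) (int K) ` B (s / K))"
  define \<Gamma> where "\<Gamma> = ln K + 5 * ln (1 / g)"
  have K1: "9 \<le> real K" and M1: "1 \<le> real M" and K0: "0 < K" using K M by auto
  have \<alpha>0: "0 < \<alpha>" using \<alpha> exp_gt_zero[of "- \<rho>\<^sup>2"] by linarith
  have \<rho>p: "1 \<le> \<rho> ^ j" for j using \<rho> by (rule one_le_power)
  have H: "bsys N d (w - d * ln K) H" unfolding H_def using K by (intro bsys_dilate[OF B]) auto
  have e0: "0 < e" using M1 by (simp add: e_def)
  have gM: "g * x \<le> 1" if "x \<le> 1000000000000 * \<rho> ^ 8 * K * M" for x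
  proof -
    have "g * x \<le> g * (1000000000000 * \<rho> ^ 8 * K * M)" using that g(1) by (intro mult_left_mono) auto
    then show ?thesis using g(2) by linarith
  qed
  have prod3: "a * b * c \<le> 1000000000000 * \<rho> ^ 8 * K * M"
    if "a \<le> 1000000000000 * \<rho> ^ 8" "b \<le> K" "c \<le> M" "0 \<le> b" "0 \<le> c" for a b c :: real
  proof -
    have "0 \<le> 1000000000000 * \<rho> ^ 8 * real K" using \<rho> by simp
    moreover have "a * b \<le> 1000000000000 * \<rho> ^ 8 * K" using that \<rho> by (intro mult_mono) auto
    ultimately show ?thesis using that by (intro mult_mono) auto
  qed
  have \<rho>8: "\<rho> ^ j \<le> \<rho> ^ 8" if "j \<le> 8" for j using \<rho> that by (rule power_increasing[rotated])
  have g32: "32 * real K * g * M \<le> 1"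
    using gM[OF prod3[of 32 K M]] \<rho>p[of 8] by (simp add: mult_ac)
  have g4: "g * (4 * M) \<le> 1"
    using gM[OF prod3[of 4 1 M]] \<rho>p[of 8] K1 by simp
  have g54: "g * (54 * \<rho>\<^sup>2) \<le> 1"
    using gM[OF prod3[of "54 * \<rho>\<^sup>2" 1 1]] \<rho>8[of 2] \<rho>p[of 8] K1 M1 by simp
  have g648: "g * (648000000000 * \<rho> ^ 8 * M) \<le> 1"
    using gM[OF prod3[of "648000000000 * \<rho> ^ 8" 1 M]] \<rho>p[of 8] K1 by simp
  have gle1: "g \<le> 1"
  proof -
    have "g * 1 \<le> g * (4 * M)" using g(1) M1 by (intro mult_left_mono) auto
    then show ?thesis using g4 by simp
  qed
  have gp: "0 < g ^ j" "g ^ j \<le> 1" for j using g gle1 by (auto intro: power_le_one)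
  have \<delta>0: "0 < \<delta> j" for j using gp[of j] M1 by (simp add: \<delta>_def)
  have lnK: "0 \<le> ln (real K)" using K1 by (intro ln_ge_zero) simp
  have lng: "0 \<le> ln (1 / g)" using g gle1 by (simp add: ln_div)
  have lnM: "0 \<le> ln (4 * real M)" "0 \<le> ln (144 * real M)" using M1 by (auto intro!: ln_ge_zero)
  have \<Gamma>1: "\<Gamma> \<le> c1" and \<Gamma>2: "\<Gamma> \<le> c2" and c20: "0 \<le> c2" and c10: "0 \<le> c1"
    using c1 c2 lnK lng lnM \<rho> zero_le_power2[of \<rho>] unfolding \<Gamma>_def by linarith+
  have R: "0 \<le> R2" "R2 \<le> R1" using \<rho>p[of 4] \<rho>8[of 4] by (auto simp: R1_def R2_def)
  have nB: "\<not> dense_in A (B (g ^ 4)) ((101/100) * \<alpha>)"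
  proof
    assume a: "dense_in A (B (g ^ 4)) ((101/100) * \<alpha>)"
    have "- (d * ln (g ^ 4)) = d * (4 * ln (1 / g))" using g by (simp add: ln_realpow ln_div)
    also have "\<dots> \<le> (d + R2) * c2"
      using d R \<Gamma>2 lng lnK by (intro mult_mono) (auto simp: \<Gamma>_def)
    finally show False
      using bsys_rescale[OF B gp(1,2)[of 4]] d a R by (intro no2[of d "w + d * ln (g ^ 4)" "\<lambda>s. B (g ^ 4 * s)"]) auto
  qed
  have nH: "\<not> dense_in A (H (g ^ 4)) ((101/100) * \<alpha>)"
  proof
    assume a: "dense_in A (H (g ^ 4)) ((101/100) * \<alpha>)"
    have "d * ln K - (d * ln (g ^ 4)) = d * (ln K + 4 * ln (1 / g))" using g by (simp add: ln_realpow ln_div algebra_simps)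
    also have "\<dots> \<le> (d + R2) * c2"
      using d R \<Gamma>2 lng lnK by (intro mult_mono) (auto simp: \<Gamma>_def)
    finally show False
      using bsys_rescale[OF H gp(1,2)[of 4]] d a R by (intro no2[of d "w - d * ln K + d * ln (g ^ 4)" "\<lambda>s. H (g ^ 4 * s)"]) auto
  qed
  have budget1: "101 * (ln (5 * N) - w + dd * c) \<le> real M" if "0 \<le> dd" "dd \<le> d + R1" "0 \<le> c" "c \<le> c1" for dd c
  proof -
    have "dd * c \<le> (d + R1) * c1" using that d R by (intro mult_mono) auto
    then have "101 * (ln (5 * N) - w + dd * c) \<le> 101 * (ln (5 * N) - w + (d + R1) * c1)" by simp
    then show ?thesis using budget unfolding R1_def by (rule order_trans)
  qed
  have "101 * (ln (5 * N) - w + d * (ln K + 5 * ln (1 / g))) \<le> M"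
    using budget1[of d \<Gamma>] d R \<Gamma>1 lnK lng by (simp add: \<Gamma>_def)
  from dense_scales[OF B N d dense \<alpha>0 K0 M g(1) g32 this H_def nB nH]
  obtain \<sigma> s x where \<sigma>: "1/2 \<le> \<sigma> - e" "\<sigma> + e \<le> 1"
     "card (H (\<sigma> + e)) \<le> (101/100) * real (card (H (\<sigma> - e)))"
   and s: "\<forall>j\<in>{1..5}. g ^ j \<le> s j - \<delta> j \<and> s j + \<delta> j \<le> 2 * g ^ j \<and>
        card (H (s j + \<delta> j)) \<le> (101/100) * real (card (H (s j - \<delta> j)))"
   and xB: "(919/1000) * \<alpha> * card (B ((\<sigma> - e) / K)) \<le> cnt A x (B ((\<sigma> - e) / K))"
   and xH: "(919/1000) * \<alpha> * card (H (\<sigma> - e)) \<le> cnt A x (H (\<sigma> - e))"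
   and xs: "\<forall>j\<in>{1..3}. (919/1000) * \<alpha> * card (H (s j - \<delta> j)) \<le> cnt A x (H (s j - \<delta> j))"
    unfolding e_def[symmetric] \<delta>_def[symmetric] by (elim exE conjE) (rule that)
  have sl: "g ^ j \<le> s j - \<delta> j" and su: "s j + \<delta> j \<le> 2 * g ^ j"
    and sreg: "card (H (s j + \<delta> j)) \<le> (101/100) * real (card (H (s j - \<delta> j)))" if "j \<in> {1..5}" for j
    using s that by auto
  have s0: "0 < s j - \<delta> j" "0 < s j" if "j \<in> {1..5}" for j
    using sl[OF that] \<delta>0[of j] gp(1)[of j] by linarith+
  have gap: "s (Suc j) \<le> \<delta> j" if "Suc j \<in> {1..5}" for j
  proof -
    have "s (Suc j) \<le> 2 * g ^ Suc j" using su[OF that] \<delta>0[of "Suc j"] by linarith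
    also have "\<dots> = (2 * g) * g ^ j" by simp
    also have "\<dots> \<le> (1 / (2 * real M)) * g ^ j"
      using g4 M1 gp(1)[of j] by (intro mult_right_mono) (auto simp: pos_le_divide_eq)
    finally show ?thesis by (simp add: \<delta>_def)
  qed
  have gap5: "\<delta> 5 \<le> s 4"
  proof -
    have "\<delta> 5 \<le> g ^ 5 / 1" unfolding \<delta>_def using M1 gp(1)[of 5] by (intro divide_left_mono) auto
    also have "\<dots> \<le> g ^ 4" using g gle1 by (simp add: power_decreasing)
    also have "\<dots> \<le> s 4" using sl[of 4] \<delta>0[of 4] by simp
    finally show ?thesis .
  qed
  have monoH: "real (card (H r)) \<le> card (H r')" if "0 < r" "r \<le> r'" for r r'
    using card_mono[OF bsys_finite[OF H] bsys_mono[OF H that]] that by simp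
  have size: "exp (6 * \<rho>\<^sup>2) \<le> card (H (s 3))"
  proof -
    have "g ^ 5 \<le> g ^ 3" using g gle1 by (intro power_decreasing) auto
    then have "g ^ 5 \<le> s 3" using sl[of 3] \<delta>0[of 3] by simp
    then have "real (card (H (g ^ 5))) \<le> card (H (s 3))" by (rule monoH[OF gp(1)])
    moreover have "6 * \<rho>\<^sup>2 \<le> ln (card (H (g ^ 5)))"
      using bsys_card[OF H gp(1,2)[of 5]] big g by (simp add: ln_realpow algebra_simps)
    then have "exp (6 * \<rho>\<^sup>2) \<le> exp (ln (card (H (g ^ 5))))" by simp
    then have "exp (6 * \<rho>\<^sup>2) \<le> card (H (g ^ 5))" using bsys_card_pos[OF H gp(1)[of 5]] by simp
    ultimately show ?thesis by linarith
  qed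
  \<comment> \<open>Kept general in \<open>Y\<close> and \<open>l\<close>, since it is used for
    \<open>A\<close> at \<open>l1\<close> and for the neighbourhood of \<open>A\<close> at
    \<open>l2\<close>, with the same radii and the same \<open>x\<close>.\<close>
  have four: "\<exists>\<Lambda> z. finite \<Lambda> \<and> real (card \<Lambda>) \<le> 2000000000 * l ^ 4 \<and> z \<in> H ((s 1 + \<delta> 1) + (s 2 + \<delta> 2)) \<and>
     (\<forall>t\<in>H (\<delta> 5 * exp (- 40 * l)). (\<forall>\<mu>\<in>\<Lambda>. cdev \<mu> t \<le> exp (- 40 * l)) \<longrightarrow>
       (\<forall>v. four_sum Y v (4 * x + z + t)))"
    if l: "1 \<le> l" "l \<le> 3 * \<rho>\<^sup>2" "l ^ 4 \<le> 81 * \<rho> ^ 8" and r: "0 < r" "exp (- \<rho>\<^sup>2) * (9/10) \<le> r" "1 \<le> exp l * r\<^sup>2"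
      and dens: "\<forall>j\<in>{1..3}. r * card (H (s j + \<delta> j)) \<le> cnt Y x (H (s j))" for l r Y
  proof (rule four_sums[OF H l(1) r(1,3), where ?s0.0 = "s 1" and ?s1.0 = "s 2" and ?s2.0 = "s 3" and ?s3.0 = "s 4" and ?s4.0 = "s 5"
        and ?\<delta>0.0 = "\<delta> 1" and ?\<delta>1.0 = "\<delta> 2" and ?\<delta>2.0 = "\<delta> 3" and ?\<delta>3.0 = "\<delta> 4" and ?\<delta>4.0 = "\<delta> 5"])
    show "9 * l * s 4 \<le> s 3"
    proof -
      have "9 * l * s 4 \<le> 9 * (3 * \<rho>\<^sup>2) * (2 * g ^ 4)"
        using l su[of 4] s0[of 4] \<delta>0[of 4] by (intro mult_mono) auto
      also have "\<dots> = (g * (54 * \<rho>\<^sup>2)) * g ^ 3" by (simp add: power_numeral_reduce)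
      also have "\<dots> \<le> 1 * g ^ 3" using g54 gp(1)[of 3] by (intro mult_right_mono) auto
      also have "\<dots> \<le> s 3" using sl[of 3] \<delta>0[of 3] by simp
      finally show ?thesis .
    qed
    show "2000000000 * l ^ 4 * s 5 \<le> \<delta> 4"
    proof -
      have "2000000000 * l ^ 4 * s 5 \<le> 2000000000 * (81 * \<rho> ^ 8) * (2 * g ^ 5)"
        using l su[of 5] s0[of 5] \<delta>0[of 5] \<rho> by (intro mult_mono) auto
      also have "\<dots> = (g * (648000000000 * \<rho> ^ 8 * M)) * (g ^ 4 / (2 * real M))"
        using M1 by (simp add: power_numeral_reduce)
      also have "\<dots> \<le> 1 * (g ^ 4 / (2 * real M))"
        using g648 gp(1)[of 4] by (intro mult_right_mono) auto
      finally show ?thesis by (simp add: \<delta>_def)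
    qed
    show "card (H (s 4 + \<delta> 4)) \<le> 2 * real (card (H (s 4)))"
      using sreg[of 4] monoH[of "s 4 - \<delta> 4" "s 4"] s0[of 4] \<delta>0[of 4] by simp
    show "card (H (s 5 + \<delta> 5)) \<le> (11/10) * real (card (H (s 5)))"
      using sreg[of 5] monoH[of "s 5 - \<delta> 5" "s 5"] s0[of 5] \<delta>0[of 5] by simp
    show "3 \<le> r\<^sup>2 * card (H (s 3))"
    proof -
      have "(exp (- \<rho>\<^sup>2) * (9/10))\<^sup>2 \<le> r\<^sup>2" using r by (intro power_mono) auto
      then have "(81/100) * exp (- 2 * \<rho>\<^sup>2) \<le> r\<^sup>2"
        by (simp add: power_mult_distrib power2_eq_square exp_add[symmetric])
      then have "((81/100) * exp (- 2 * \<rho>\<^sup>2)) * exp (6 * \<rho>\<^sup>2) \<le> r\<^sup>2 * card (H (s 3))"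
        using size by (intro mult_mono) auto
      moreover have "((81/100) * exp (- 2 * \<rho>\<^sup>2)) * exp (6 * \<rho>\<^sup>2) = (81/100) * exp (4 * \<rho>\<^sup>2)"
        by (simp add: exp_add[symmetric])
      moreover have "1 + 4 * \<rho>\<^sup>2 \<le> exp (4 * \<rho>\<^sup>2)" by (rule exp_ge_add_one_self)
      ultimately show ?thesis using \<rho>p[of 2] by linarith
    qed
  qed (use s0 \<delta>0 gap[of 1] gap[of 2] gap[of 3] gap5 dens in \<open>simp_all add: eval_nat_numeral\<close>)
  have cnt_mono: "cnt A x U \<le> cnt A x U'" if "U \<subseteq> U'" "finite U'" for U U'
    unfolding cnt_def using that by (intro card_mono) auto
  have H_sub: "H (s j - \<delta> j) \<subseteq> H (s j)" "finite (H (s j))" if "j \<in> {1..5}" for j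
  proof -
    show "H (s j - \<delta> j) \<subseteq> H (s j)" using s0[OF that] \<delta>0[of j] by (intro bsys_mono[OF H]) auto
    show "finite (H (s j))" by (rule bsys_finite[OF H s0(2)[OF that]])
  qed
  have dens_A: "\<alpha> * (9/10) * card (H (s j + \<delta> j)) \<le> cnt A x (H (s j))" if j: "j \<in> {1..3}" for j
  proof -
    have j5: "j \<in> {1..5}" using j by auto
    have "\<alpha> * (9/10) * card (H (s j + \<delta> j)) \<le> \<alpha> * (9/10) * ((101/100) * card (H (s j - \<delta> j)))"
      using sreg[OF j5] \<alpha>0 by (intro mult_left_mono) auto
    also have "\<dots> \<le> (919/1000) * \<alpha> * card (H (s j - \<delta> j))" using \<alpha>0 by simp
    also have "\<dots> \<le> cnt A x (H (s j - \<delta> j))" using xs j by blast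
    also have "\<dots> \<le> cnt A x (H (s j))" using cnt_mono[OF H_sub[OF j5]] by simp
    finally show ?thesis .
  qed
  have exp_ge2: "2 \<le> exp (y :: real)" if "1 \<le> y" for y
    using exp_ge_add_one_self[of y] that by linarith
  \<comment> \<open>A symmetric part has about the squared density, so twice the exponent is lost;
    the third copy of \<open>\<rho>\<^sup>2\<close>, or of \<open>\<rho>\<close> in
    \<open>l2\<close>, absorbs the constant \<open>81/100\<close>.\<close>
  define l1 where "l1 = 3 * \<rho>\<^sup>2"
  define l2 where "l2 = 3 * \<rho>"
  have l1: "1 \<le> l1" "l1 \<le> 3 * \<rho>\<^sup>2" "l1 ^ 4 \<le> 81 * \<rho> ^ 8"
    using \<rho>p[of 2] by (auto simp: l1_def power_mult_distrib)
  have l2: "1 \<le> l2" "l2 \<le> 3 * \<rho>\<^sup>2" "l2 ^ 4 \<le> 81 * \<rho> ^ 8"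
    using \<rho> \<rho>8[of 4] self_le_power[of \<rho> 2] by (auto simp: l2_def power_mult_distrib)
  have ln72: "ln (72 / (\<delta> 5 * exp (- 40 * l))) = ln (144 * real M) + 5 * ln (1 / g) + 40 * l" for l
    using g M1 by (simp add: \<delta>_def ln_div ln_mult ln_realpow)
  have \<delta>5: "\<delta> 5 \<le> \<delta> j" if "j \<in> {1..5}" for j
    unfolding \<delta>_def using that g gle1 M1 by (intro divide_right_mono power_decreasing) auto
  have \<delta>51: "\<delta> 5 \<le> 1"
    using gap5 su[of 4] gp(2)[of 4] \<delta>5[of 4] unfolding \<delta>_def
    using M1 gp(2)[of 5] by (simp add: divide_le_eq)
  have r1: "1 \<le> exp l1 * (\<alpha> * (9/10))\<^sup>2"
  proof -
    have "(exp (- \<rho>\<^sup>2) * (9/10))\<^sup>2 \<le> (\<alpha> * (9/10))\<^sup>2" using \<alpha> by (intro power_mono) auto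
    then have "exp l1 * (exp (- \<rho>\<^sup>2) * (9/10))\<^sup>2 \<le> exp l1 * (\<alpha> * (9/10))\<^sup>2" by (intro mult_left_mono) auto
    moreover have "exp l1 * (exp (- \<rho>\<^sup>2) * (9/10))\<^sup>2 = (81/100) * exp (\<rho>\<^sup>2)"
      by (simp add: l1_def power_mult_distrib exp_of_nat_mult[symmetric] power2_eq_square exp_add[symmetric])
    ultimately show ?thesis using exp_ge2[OF \<rho>p[of 2]] by linarith
  qed
  have ra: "0 < \<alpha> * (9/10)" "exp (- \<rho>\<^sup>2) * (9/10) \<le> \<alpha> * (9/10)" using \<alpha> \<alpha>0 by auto
  have dens_A: "\<forall>j\<in>{1..3}. \<alpha> * (9/10) * card (H (s j + \<delta> j)) \<le> cnt A x (H (s j))"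
    using dens_A by blast
  obtain \<Lambda>1 z1 where \<Lambda>1: "finite \<Lambda>1" "real (card \<Lambda>1) \<le> 2000000000 * l1 ^ 4" and z1: "z1 \<in> H ((s 1 + \<delta> 1) + (s 2 + \<delta> 2))"
    and four1: "\<forall>t\<in>H (\<delta> 5 * exp (- 40 * l1)). (\<forall>\<mu>\<in>\<Lambda>1. cdev \<mu> t \<le> exp (- 40 * l1)) \<longrightarrow>
       (\<forall>v. four_sum A v (4 * x + z1 + t))"
    using four[OF l1 ra r1 dens_A] by (elim exE conjE) (rule that)
  define e1 where "e1 = exp (- 40 * l1)"
  define T1 where "T1 = (\<lambda>r. {t\<in>H (\<delta> 5 * e1 / 8 * r). \<forall>\<theta>\<in>\<Lambda>1. cdev \<theta> t \<le> e1 / 8 * r})"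
  define d1 where "d1 = d + card \<Lambda>1"
  have e1: "0 < e1" "e1 \<le> 1" using l1 by (auto simp: e1_def)
  have d1: "0 \<le> d1" "d1 \<le> d + R1"
    using d \<Lambda>1(2) l1(3) \<rho>p[of 8] by (auto simp: d1_def R1_def)
  have T1: "bsys N d1 (w - d1 * (c1 - ln (4 * real M))) T1"
    unfolding T1_def d1_def
  proof (rule restricted_system[OF H d lnK \<Lambda>1(1) e1 \<delta>0 \<delta>51])
    show "ln (real K) + ln (72 / (\<delta> 5 * e1)) \<le> c1 - ln (4 * real M)"
      unfolding e1_def ln72 using c1 by (simp add: l1_def)
  qed
  have b1: "101 * (ln (5 * N) - w + d1 * c1) \<le> real M" by (rule budget1[OF d1 c10 order_refl])
  note T1' = regular_increment_system[OF T1 d1(1) M N b1, folded e_def]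
  obtain r1 where r1: "0 < r1" "r1 \<le> 1" "card (T1 (r1 + e)) \<le> (101/100) * real (card (T1 r1))"
    using T1'(1) by blast
  have "\<not> dense_in A (T1 e) (exp \<rho> * \<alpha>)"
  proof
    assume a: "dense_in A (T1 e) (exp \<rho> * \<alpha>)"
    have "d1 * c1 \<le> (d + R1) * c1" using d1 c10 by (intro mult_right_mono) auto
    then show False using a by (intro no1[OF T1'(2) d1(1) _ d1(2)]) simp_all
  qed
  then have up1: "cnt A y (T1 r1) \<le> (101/100) * (exp \<rho> * \<alpha>) * card (T1 r1)" for y
    using \<alpha>0 by (intro cnt_le_of_not_dense_in_system[OF T1 _ r1(1) e0 _ r1(3)]) auto
  have T1_sub: "T1 r1 \<subseteq> H (\<delta> j)" if "j \<in> {1..5}" for j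
  proof -
    have "\<delta> 5 * e1 / 8 * r1 \<le> \<delta> 5 * 1 * 1"
      using e1 r1 \<delta>0[of 5] by (intro mult_mono) (auto simp: field_simps)
    then have "\<delta> 5 * e1 / 8 * r1 \<le> \<delta> j" using \<delta>5[OF that] by simp
    then have "H (\<delta> 5 * e1 / 8 * r1) \<subseteq> H (\<delta> j)"
      using e1 r1 \<delta>0[of 5] by (intro bsys_mono[OF H]) auto
    then show ?thesis unfolding T1_def by blast
  qed
  have T1_fin: "finite (T1 r1)" "T1 r1 \<noteq> {}"
    using bsys_finite[OF T1 r1(1)] bsys_0[OF T1 r1(1)] by auto
  \<comment> \<open>As \<open>T1 r1\<close> is symmetric, this is \<open>A + T1 r1\<close>. Each
    translate of \<open>T1 r1\<close> contains at most about \<open>exp \<rho> * \<alpha>\<close> of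
    \<open>A\<close>, so covering gives \<open>Y\<close> density about
    \<open>exp (- \<rho>)\<close>; the constants leave
    \<open>0.919 / 1.01 ^ 2 > 0.9\<close>.\<close>
  define Y where "Y = {y. \<exists>t\<in>T1 r1. y + t \<in> A}"
  have dens_Y: "exp (- \<rho>) * (9/10) * card (H (s j + \<delta> j)) \<le> cnt Y x (H (s j))" if j: "j \<in> {1..3}" for j
  proof -
    have j5: "j \<in> {1..5}" using j by auto
    have "cnt A x (H (s j - \<delta> j)) \<le> (101/100) * (exp \<rho> * \<alpha>) * card {b\<in>H (s j). \<exists>t\<in>T1 r1. x + b + t \<in> A}"
    proof (rule cover_count[OF up1 T1_fin H_sub(2)[OF j5]])
      show "finite (H (s j - \<delta> j))" using H_sub[OF j5] by (rule finite_subset)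
      fix u t assume ut: "u \<in> H (s j - \<delta> j)" "t \<in> T1 r1"
      then have "t \<in> H (\<delta> j)" using T1_sub[OF j5] by blast
      then show "u - t \<in> H (s j)"
        using bsys_diff[OF H s0(1)[OF j5] \<delta>0[of j] ut(1)] by simp
    qed
    also have "{b\<in>H (s j). \<exists>t\<in>T1 r1. x + b + t \<in> A} = {b\<in>H (s j). x + b \<in> Y}" by (simp add: Y_def)
    finally have "cnt A x (H (s j - \<delta> j)) \<le> (101/100) * (exp \<rho> * \<alpha>) * cnt Y x (H (s j))"
      by (simp only: cnt_def)
    moreover have "(919/1000) * \<alpha> * card (H (s j - \<delta> j)) \<le> cnt A x (H (s j - \<delta> j))" using xs j by blast
    ultimately have "\<alpha> * ((919/1000) * card (H (s j - \<delta> j))) \<le> \<alpha> * ((101/100) * exp \<rho> * cnt Y x (H (s j)))"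
      by (simp add: mult_ac)
    then have "(919/1000) * card (H (s j - \<delta> j)) \<le> (101/100) * exp \<rho> * cnt Y x (H (s j))"
      using \<alpha>0 by (simp only: mult_le_cancel_left_pos)
    then have "(9/10) * card (H (s j + \<delta> j)) \<le> exp \<rho> * cnt Y x (H (s j))"
      using sreg[OF j5] by simp
    then have "exp (- \<rho>) * ((9/10) * card (H (s j + \<delta> j))) \<le> exp (- \<rho>) * (exp \<rho> * cnt Y x (H (s j)))"
      by (intro mult_left_mono) auto
    then show ?thesis by (simp add: mult.assoc[symmetric] exp_add[symmetric])
  qed
  have r2: "0 < exp (- \<rho>) * (9/10)" "exp (- \<rho>\<^sup>2) * (9/10) \<le> exp (- \<rho>) * (9/10)"
    "1 \<le> exp l2 * (exp (- \<rho>) * (9/10))\<^sup>2"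
  proof -
    show "0 < exp (- \<rho>) * (9/10)" by simp
    show "exp (- \<rho>\<^sup>2) * (9/10) \<le> exp (- \<rho>) * (9/10)" using self_le_power[of \<rho> 2] \<rho> by simp
    have "exp l2 * (exp (- \<rho>) * (9/10))\<^sup>2 = (81/100) * exp \<rho>"
      by (simp add: l2_def power_mult_distrib power2_eq_square exp_add[symmetric])
    then show "1 \<le> exp l2 * (exp (- \<rho>) * (9/10))\<^sup>2" using exp_ge2[OF \<rho>] by linarith
  qed
  have dens_Y': "\<forall>j\<in>{1..3}. exp (- \<rho>) * (9/10) * card (H (s j + \<delta> j)) \<le> cnt Y x (H (s j))"
    using dens_Y by blast
  obtain \<Lambda>2 z2 where \<Lambda>2: "finite \<Lambda>2" "real (card \<Lambda>2) \<le> 2000000000 * l2 ^ 4" and z2: "z2 \<in> H ((s 1 + \<delta> 1) + (s 2 + \<delta> 2))"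
    and four2: "\<forall>t\<in>H (\<delta> 5 * exp (- 40 * l2)). (\<forall>\<mu>\<in>\<Lambda>2. cdev \<mu> t \<le> exp (- 40 * l2)) \<longrightarrow>
       (\<forall>v. four_sum Y v (4 * x + z2 + t))"
    using four[OF l2 r2 dens_Y'] by (elim exE conjE) (rule that)
  define e2 where "e2 = exp (- 40 * l2)"
  define T2 where "T2 = (\<lambda>r. {t\<in>H (\<delta> 5 * e2 / 8 * r). \<forall>\<theta>\<in>\<Lambda>2. cdev \<theta> t \<le> e2 / 8 * r})"
  \<comment> \<open>An error \<open>t3\<close> in the right-hand variable appears multiplied by
    \<open>K\<close> in the equation, so it must come from \<open>T2\<close> divided by
    \<open>K\<close>.\<close>
  define T3 where "T3 = (\<lambda>r. {b. int K * b \<in> T2 r})"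
  define d2 where "d2 = d + card \<Lambda>2"
  have e2: "0 < e2" "e2 \<le> 1" using l2 by (auto simp: e2_def)
  have d2: "0 \<le> d2" "d2 \<le> d + R2"
    using d \<Lambda>2(2) \<rho>p[of 4] by (auto simp: d2_def R2_def l2_def power_mult_distrib)
  have T2: "bsys N d2 (w - d2 * (c2 - ln (4 * real M))) T2"
    unfolding T2_def d2_def
  proof (rule restricted_system[OF H d lnK \<Lambda>2(1) e2 \<delta>0 \<delta>51])
    show "ln (real K) + ln (72 / (\<delta> 5 * e2)) \<le> c2 - ln (4 * real M)"
      unfolding e2_def ln72 using c2 by (simp add: l2_def)
  qed
  have T2_range: "T2 r \<subseteq> range ((*) (int K))" for r
    unfolding T2_def H_def by auto
  have T3: "bsys N d2 (w - d2 * (c2 - ln (4 * real M))) T3"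
    unfolding T3_def by (rule bsys_preimage_mult[OF T2 K0 T2_range])
  have card_T3: "card (T3 r) = card (T2 r)" for r
    unfolding T3_def by (rule card_preimage_mult[OF K0 T2_range])
  have "d2 \<le> d + R1" using d2(2) R by linarith
  then have b2: "101 * (ln (5 * N) - w + d2 * c2) \<le> real M" by (rule budget1[OF d2(1) _ c20 c2(2)])
  note T2' = regular_increment_system[OF T2 d2(1) M N b2, folded e_def]
  note T3' = regular_increment_system[OF T3 d2(1) M N b2, folded e_def]
  obtain r2 where r2: "0 < r2" "r2 \<le> 1" "card (T2 (r2 + e)) \<le> (101/100) * real (card (T2 r2))"
    using T2'(1) by blast
  have w2: "w - (d + R2) * c2 \<le> w - d2 * c2"
    using d2 c20 by (simp add: mult_right_mono)
  have "\<not> dense_in A (T2 e) ((101/100) * \<alpha>)"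
    using no2[OF T2'(2) d2(1) _ d2(2) w2] by auto
  then have up2: "cnt A y (T2 r2) \<le> (101/100) * ((101/100) * \<alpha>) * card (T2 r2)" for y
    using \<alpha>0 by (intro cnt_le_of_not_dense_in_system[OF T2 _ r2(1) e0 _ r2(3)]) auto
  have "\<not> dense_in A (T3 e) ((101/100) * \<alpha>)"
    using no2[OF T3'(2) d2(1) _ d2(2) w2] by auto
  then have up3: "cnt A y (T3 r2) \<le> (101/100) * ((101/100) * \<alpha>) * card (T3 r2)" for y
    using \<alpha>0 r2(3) by (intro cnt_le_of_not_dense_in_system[OF T3 _ r2(1) e0]) (auto simp: card_T3)
  have eight: "\<exists>xs. length xs = 8 \<and> set xs \<subseteq> A \<and> (\<exists>y\<in>set xs. y \<noteq> v) \<and> sum_list xs = 8 * x + z1 + z2 + t"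
    if t: "t \<in> T2 8" for t v
  proof (rule eight_sums[where ?T1.0 = "T1 8" and T = "T1 r1"])
    show "four_sum A v (4 * x + z1 + t)" if "t \<in> T1 8" for t v
      using four1 that by (simp add: T1_def e1_def)
    have "four_sum Y v (4 * x + z2 + t)"
      using four2 t by (simp add: T2_def e2_def)
    then show "\<exists>y1 y2 y3 y4. {y1, y2, y3, y4} \<subseteq> {y. \<exists>t\<in>T1 r1. y + t \<in> A} \<and> y1 + y2 + y3 + y4 = 4 * x + z2 + t"
      unfolding Y_def by blast
    show "- (a + b + c + d) \<in> T1 8" if "a \<in> T1 r1" "b \<in> T1 r1" "c \<in> T1 r1" "d \<in> T1 r1" for a b c d
    proof -
      have "a + b + c + d \<in> T1 (r1 + r1 + r1 + r1)"
        using that r1(1) by (intro bsys_add[OF T1]) auto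
      moreover have "T1 (r1 + r1 + r1 + r1) \<subseteq> T1 8" using r1 by (intro bsys_mono[OF T1]) auto
      ultimately show ?thesis by (intro bsys_minus[OF T1]) auto
    qed
  qed
  have s1: "1 \<in> {1..5::nat}" "1 \<in> {1..3::nat}" by auto
  have "0 < cnt A x (H (s 1))"
  proof -
    have "0 < card (H (s 1 + \<delta> 1))" using s0[OF s1(1)] \<delta>0[of 1] by (intro bsys_card_pos[OF H]) simp
    then have "0 < \<alpha> * (9/10) * card (H (s 1 + \<delta> 1))" using \<alpha>0 by simp
    also have "\<dots> \<le> cnt A x (H (s 1))" using dens_A s1(2) by blast
    finally show ?thesis by simp
  qed
  then obtain f where f: "f \<in> H (s 1)" "x + f \<in> A"
    unfolding cnt_def card_gt_0_iff by blast
  \<comment> \<open>All constant shifts of the prospective solution. The offset has index at most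
    \<open>e / 2\<close>, so subtracting it, together with an error from \<open>T2 r2\<close>, stays
    within the regularity gap at \<open>\<sigma>\<close>.\<close>
  define off where "off = z1 + z2 + int (K - 9) * f"
  have off: "off \<in> H (e / 2)"
  proof -
    define z where "z = (s 1 + \<delta> 1) + (s 2 + \<delta> 2)"
    have z0: "0 < z" using s0[of 1] s0[of 2] \<delta>0[of 1] \<delta>0[of 2] by (simp add: z_def)
    have "int (K - 9) * f \<in> H (real K * s 1)"
    proof (cases "K = 9")
      case True
      then show ?thesis using bsys_0[OF H, of "9 * s 1"] s0[OF s1(1)] by simp
    next
      case False
      then have "int (K - 9) * f \<in> H (real (K - 9) * s 1)"
        using K by (intro bsys_multiple[OF H s0(2)[OF s1(1)] f(1)]) simp
      moreover have "H (real (K - 9) * s 1) \<subseteq> H (real K * s 1)"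
        using s0[OF s1(1)] False K by (intro bsys_mono[OF H]) auto
      ultimately show ?thesis by blast
    qed
    then have "off \<in> H (z + z + real K * s 1)"
      unfolding off_def using z1 z2 z0 s0[OF s1(1)] K0 unfolding z_def[symmetric]
      by (intro bsys_add[OF H]) auto
    moreover have "H (z + z + real K * s 1) \<subseteq> H (e / 2)"
    proof (rule bsys_mono[OF H])
      show "0 < z + z + real K * s 1" using z0 s0[OF s1(1)] by (simp add: add_pos_nonneg)
      have "s 2 + \<delta> 2 \<le> 2 * g ^ 2" "s 1 + \<delta> 1 \<le> 2 * g" using su[of 1] su[of 2] by auto
      moreover have "g ^ 2 \<le> g" using g gle1 by (simp add: power2_eq_square mult_left_le_one_le)
      ultimately have "z \<le> 4 * g" "s 1 \<le> 2 * g" using \<delta>0[of 1] by (simp_all add: z_def)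
      moreover have "real K * s 1 \<le> real K * (2 * g)" using \<open>s 1 \<le> 2 * g\<close> by (intro mult_left_mono) auto
      moreover have "8 * g \<le> real K * g" using K1 g by (intro mult_right_mono) auto
      ultimately have "z + z + real K * s 1 \<le> 4 * (real K * g)" using g by linarith
      also have "\<dots> \<le> e / 2" using g32 M1 by (simp add: e_def pos_le_divide_eq mult_ac)
      finally show "z + z + real K * s 1 \<le> e / 2" .
    qed
    ultimately show ?thesis by blast
  qed
  have T2_sub: "T2 r2 \<subseteq> H (e / 2)"
  proof -
    have "\<delta> 5 * e2 / 8 * r2 \<le> \<delta> 5 * 1 * 1"
      using e2 r2 \<delta>0[of 5] by (intro mult_mono) (auto simp: field_simps)
    also have "\<dots> \<le> e / 2 * (4 * g)"
    proof -
      have "g ^ 5 \<le> g ^ 1" using g gle1 by (intro power_decreasing) auto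
      then have "g ^ 5 / (2 * real M) \<le> g / (2 * real M)" by (intro divide_right_mono) auto
      then show ?thesis using M1 by (simp add: \<delta>_def e_def)
    qed
    also have "\<dots> \<le> e / 2 * 1"
    proof -
      have "g * (4 * 1) \<le> g * (4 * M)" using g M1 by (intro mult_left_mono) auto
      then show ?thesis using g4 e0 by (intro mult_left_mono) auto
    qed
    finally have "H (\<delta> 5 * e2 / 8 * r2) \<subseteq> H (e / 2)"
      using e2 r2 \<delta>0[of 5] by (intro bsys_mono[OF H]) auto
    then show ?thesis unfolding T2_def by blast
  qed
  define V where "V = B (\<sigma> / K)"
  define U where "U = B ((\<sigma> - e) / K)"
  have HU: "H (\<sigma> - e) = (*) (int K) ` U" and HV: "H \<sigma> = (*) (int K) ` V"
    by (simp_all add: H_def U_def V_def)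
  have injK: "inj_on ((*) (int K)) S" for S using K0 by (auto simp: inj_on_def)
  have \<sigma>0: "0 < \<sigma> - e" "0 < \<sigma>" "0 < (\<sigma> - e) / K" "0 < \<sigma> / K" "0 < e / K"
    using \<sigma>(1) e0 K1 by auto
  have finV: "finite V" "finite U" unfolding V_def U_def using \<sigma>0 by (intro bsys_finite[OF B]; simp)+
  have cardV: "card V \<le> (101/100) * real (card U)"
  proof -
    have "card V = card (H \<sigma>)" unfolding HV by (rule card_image[OF injK, symmetric])
    moreover have "real (card (H \<sigma>)) \<le> card (H (\<sigma> + e))" using \<sigma>0 e0 by (intro monoH) auto
    moreover have "card (H (\<sigma> - e)) = card U" unfolding HU by (rule card_image[OF injK])
    ultimately show ?thesis using \<sigma>(3) by simp
  qed
  \<comment> \<open>\<open>C1\<close> collects the \<open>b\<close> for which \<open>x + b\<close>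
    is close to a candidate for the right-hand variable, \<open>C2\<close> those for which
    \<open>x + K * b - off\<close> is close to a candidate for the ninth summand. Both are
    parametrised by the same set \<open>V\<close> so that they can be intersected.\<close>
  define C1 where "C1 = {b\<in>V. \<exists>t\<in>T3 r2. x + b + t \<in> A}"
  define C2 where "C2 = {b\<in>V. \<exists>t\<in>T2 r2. x + (int K * b - off) + t \<in> A}"
  have up': "(101/100) * ((101/100) * \<alpha>) = (10201/10000) * \<alpha>" by simp
  have T3_fin: "finite (T3 r2)" "T3 r2 \<noteq> {}"
    using bsys_finite[OF T3 r2(1)] bsys_0[OF T3 r2(1)] by auto
  have T2_fin: "finite (T2 r2)" "T2 r2 \<noteq> {}"
    using bsys_finite[OF T2 r2(1)] bsys_0[OF T2 r2(1)] by auto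
  have cover: "(9/10) * real (card U) \<le> c" if "(919/1000) * \<alpha> * card U \<le> (10201/10000) * \<alpha> * c" for c
  proof -
    have "\<alpha> * ((919/1000) * card U) \<le> \<alpha> * ((10201/10000) * c)" using that by (simp add: mult_ac)
    then have "(919/1000) * card U \<le> (10201/10000) * c" using \<alpha>0 by (simp only: mult_le_cancel_left_pos)
    then show ?thesis by simp
  qed
  have C1: "(9/10) * real (card U) \<le> card C1"
  proof (rule cover)
    have "cnt A x U \<le> (101/100) * ((101/100) * \<alpha>) * card {b\<in>V. \<exists>t\<in>T3 r2. x + b + t \<in> A}"
    proof (rule cover_count[OF up3 T3_fin finV])
      fix u t assume ut: "u \<in> U" "t \<in> T3 r2"
      have "int K * t \<in> H (e / 2)" using ut(2) T2_sub by (auto simp: T3_def)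
      moreover have "H (e / 2) \<subseteq> H e" using e0 by (intro bsys_mono[OF H]) auto
      ultimately have "int K * t \<in> (*) (int K) ` B (e / K)" unfolding H_def by blast
      then have "t \<in> B (e / K)" using K0 by auto
      then have "u - t \<in> B ((\<sigma> - e) / K + e / K)"
        using ut(1) \<sigma>0 unfolding U_def by (intro bsys_diff[OF B]) auto
      then show "u - t \<in> V" by (simp add: V_def diff_divide_distrib)
    qed
    then show "(919/1000) * \<alpha> * card U \<le> (10201/10000) * \<alpha> * card C1"
      using xB unfolding up' U_def[symmetric] C1_def by linarith
  qed
  have C2: "(9/10) * real (card U) \<le> card C2"
  proof (rule cover)
    define V' where "V' = (\<lambda>b. int K * b - off) ` V"
    define E where "E = {u\<in>V'. \<exists>t\<in>T2 r2. x + u + t \<in> A}"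
    have finHU: "finite (H (\<sigma> - e))" by (rule bsys_finite[OF H \<sigma>0(1)])
    have "cnt A x (H (\<sigma> - e)) \<le> (101/100) * ((101/100) * \<alpha>) * card {u\<in>V'. \<exists>t\<in>T2 r2. x + u + t \<in> A}"
    proof (rule cover_count[OF up2 T2_fin _ finHU])
      show "finite V'" using finV by (simp add: V'_def)
      fix u t assume ut: "u \<in> H (\<sigma> - e)" "t \<in> T2 r2"
      have "off - t \<in> H (e / 2 + e / 2)" using off ut(2) T2_sub e0 by (intro bsys_diff[OF H]) auto
      then have "u + (off - t) \<in> H ((\<sigma> - e) + e)" using ut(1) \<sigma>0 e0 by (intro bsys_add[OF H]) auto
      then have "u + (off - t) \<in> (*) (int K) ` V" by (simp add: HV)
      then obtain b where "b \<in> V" "u + (off - t) = int K * b" by blast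
      then have "b \<in> V" "u - t = int K * b - off" by auto
      then show "u - t \<in> V'" unfolding V'_def by blast
    qed
    then have 1: "(919/1000) * \<alpha> * card (H (\<sigma> - e)) \<le> (10201/10000) * \<alpha> * card E"
      using xH unfolding up' E_def by linarith
    have "E \<subseteq> (\<lambda>b. int K * b - off) ` C2" unfolding E_def V'_def C2_def by blast
    moreover have "finite C2" using finV by (simp add: C2_def)
    ultimately have "card E \<le> card C2" by (rule surj_card_le[rotated])
    then have "(10201/10000) * \<alpha> * card E \<le> (10201/10000) * \<alpha> * card C2"
      using \<alpha>0 by (intro mult_left_mono) auto
    moreover have "card (H (\<sigma> - e)) = card U" unfolding HU by (rule card_image[OF injK])
    ultimately show "(919/1000) * \<alpha> * card U \<le> (10201/10000) * \<alpha> * card C2" using 1 by simp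
  qed
  \<comment> \<open>Each has at least \<open>9/10\<close> of \<open>card U\<close> elements, while
    \<open>V\<close> has at most \<open>101/100\<close> of it.\<close>
  have "C1 \<inter> C2 \<noteq> {}"
  proof
    assume disj: "C1 \<inter> C2 = {}"
    have fin: "finite C1" "finite C2" using finV by (auto simp: C1_def C2_def)
    have "card C1 + card C2 = card (C1 \<union> C2)" using card_Un_disjoint[OF fin disj] by simp
    also have "\<dots> \<le> card V" using finV by (intro card_mono) (auto simp: C1_def C2_def)
    finally have "real (card C1) + real (card C2) \<le> card V" by linarith
    moreover have "0 < real (card U)" unfolding U_def using bsys_card_pos[OF B \<sigma>0(3)] by simp
    ultimately show False using C1 C2 cardV by linarith
  qed
  then obtain b where "b \<in> C1" "b \<in> C2" by blast
  then obtain t3 t2 where t: "t3 \<in> T3 r2" "t2 \<in> T2 r2" and c: "x + b + t3 \<in> A"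
    and a: "x + (int K * b - off) + t2 \<in> A"
    unfolding C1_def C2_def by blast
  have "int K * t3 - t2 \<in> T2 (r2 + r2)" using t r2 unfolding T3_def by (intro bsys_diff[OF T2]) auto
  moreover have "T2 (r2 + r2) \<subseteq> T2 8" using r2 by (intro bsys_mono[OF T2]) auto
  ultimately have t8: "int K * t3 - t2 \<in> T2 8" by blast
  \<comment> \<open>The equation now holds up to \<open>K * t3 - t2\<close>, an element of
    \<open>T2 8\<close>, and the eight summands can be chosen to supply exactly this error.\<close>
  have eq: "int K * (x + b + t3) = (x + (int K * b - off) + t2) + int (K - 1) * x + off + (int K * t3 - t2)"
    using K by (simp add: of_nat_diff algebra_simps)
  show False
    by (rule no_solution_of_common_point[OF nosol K a f(2) c off_def[symmetric] eq eight[OF t8]])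
qed

subsection \<open>Iteration\<close>

lemma bsys_interval:
  assumes N: "1 \<le> N"
  shows "bsys N 1 (ln N) (\<lambda>s. {x. \<bar>real_of_int x\<bar> \<le> s * N})"
  unfolding bsys_def
proof (intro conjI allI impI ballI)
  fix s t :: real and x y
  assume "x \<in> {x. \<bar>real_of_int x\<bar> \<le> s * N}" "y \<in> {x. \<bar>real_of_int x\<bar> \<le> t * N}"
  then show "x + y \<in> {x. \<bar>real_of_int x\<bar> \<le> (s + t) * N}"
    using abs_triangle_ineq[of "real_of_int x" "real_of_int y"] by (simp add: distrib_right)
next
  fix s :: real assume s: "0 < s \<and> s \<le> 1"
  then have p: "0 < s * N" using N by simp
  define z where "z = \<lfloor>s * N\<rfloor>"
  have z: "0 \<le> z" using p by (simp add: z_def)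
  have "{-z..z} \<subseteq> {x. \<bar>real_of_int x\<bar> \<le> s * N}"
  proof
    fix x assume "x \<in> {-z..z}"
    then have "\<bar>x\<bar> \<le> z" by auto
    then have "real_of_int \<bar>x\<bar> \<le> of_int z" by (simp only: of_int_le_iff)
    then have "\<bar>real_of_int x\<bar> \<le> of_int z" by simp
    also have "\<dots> \<le> s * N" unfolding z_def by (rule of_int_floor_le)
    finally show "x \<in> {x. \<bar>real_of_int x\<bar> \<le> s * N}" by simp
  qed
  then have "card {-z..z} \<le> card {x. \<bar>real_of_int x\<bar> \<le> s * N}"
    using card_int_interval(1)[of "s * N"] p by (intro card_mono) auto
  moreover have "s * N \<le> real (card {-z..z})"
  proof -
    have "s * N < of_int z + 1" unfolding z_def by linarith
    moreover have "real (card {-z..z}) = 2 * of_int z + 1" using z by simp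
    ultimately show ?thesis using z by linarith
  qed
  ultimately have "s * N \<le> real (card {x. \<bar>real_of_int x\<bar> \<le> s * N})" by linarith
  then have "ln (s * N) \<le> ln (real (card {x. \<bar>real_of_int x\<bar> \<le> s * N}))" using p by (intro ln_mono) auto
  then show "ln N + 1 * ln s \<le> ln (real (card {x. \<bar>real_of_int x\<bar> \<le> s * N}))"
    using s N by (simp add: ln_mult)
qed (use N in auto)

text \<open>The base points must contain \<open>a - u\<close> for every \<open>a\<close> in
  \<open>A\<close> and every shift \<open>u\<close> of size at most \<open>N\<close>; this interval
  has length \<open>3 * N\<close>, hence the factor 3 in the density.\<close>

lemma dense_in_interval:
  fixes N :: nat
  assumes A: "A \<subseteq> {1..int N}" and N: "1 \<le> N"
  shows "dense_in A {x. \<bar>real_of_int x\<bar> \<le> 1 * real N} (card A / (3 * real N))"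
  unfolding dense_in_def
proof (intro exI[of _ "{1 - int N..2 * int N}"] conjI ballI)
  have c: "card {1 - int N..2 * int N} = 3 * N" by simp
  show "finite {1 - int N..2 * int N}" "{1 - int N..2 * int N} \<noteq> {}" using N by auto
  fix u assume "u \<in> {x. \<bar>real_of_int x\<bar> \<le> 1 * real N}"
  then have "real_of_int \<bar>u\<bar> \<le> real_of_int (int N)" by simp
  then have u: "\<bar>u\<bar> \<le> int N" by (simp only: of_int_le_iff)
  have "card A \<le> card {y\<in>{1 - int N..2 * int N}. y + u \<in> A}"
  proof (rule card_inj_on_le[where f = "\<lambda>a. a - u"])
    show "inj_on (\<lambda>a. a - u) A" by (auto simp: inj_on_def)
    show "(\<lambda>a. a - u) ` A \<subseteq> {y\<in>{1 - int N..2 * int N}. y + u \<in> A}" using A u by fastforce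
    show "finite {y\<in>{1 - int N..2 * int N}. y + u \<in> A}" by (rule finite_Collect_conjI) simp
  qed
  then show "card A / (3 * real N) * card {1 - int N..2 * int N} \<le> card {y\<in>{1 - int N..2 * int N}. y + u \<in> A}"
    unfolding c using N by simp
qed

text \<open>The iteration is governed by one real potential \<open>u\<close>, the logarithmic gain
  of density so far. Both kinds of increment are charged to it at the same rates, \<open>E1\<close>
  for rank and \<open>E2\<close> for logarithmic size, so their order and numbers need no separate
  record. As a density is at most 1, \<open>u\<close> never exceeds \<open>\<rho>\<^sup>2\<close>,
  and the total loss is at most \<open>\<rho>\<^sup>2 * E2\<close>, of order
  \<open>\<rho> ^ 12\<close>.\<close>

lemma no_solution_card_bound:
  assumes K: "9 \<le> K"
  shows "\<exists>\<rho>0. \<forall>\<rho>\<ge>\<rho>0. \<forall>N A. 1 \<le> N \<longrightarrow> A \<subseteq> {1..int N} \<longrightarrow>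
     (\<forall>xs c. length xs = K \<longrightarrow> set xs \<subseteq> A \<longrightarrow> c \<in> A \<longrightarrow> sum_list xs = int K * c \<longrightarrow> (\<forall>y\<in>set xs. y = c)) \<longrightarrow>
     600000000000000000 * \<rho> ^ 12 < ln (real N) \<longrightarrow> card A < 3 * real N * exp (- \<rho>\<^sup>2)"
proof -
  \<comment> \<open>The logarithms in \<open>c1\<close> and \<open>c2\<close> after substituting
    \<open>g\<close> and \<open>M \<le> \<rho> ^ 14\<close>: \<open>ln K\<close> occurs
    \<open>1 + 5\<close> times and \<open>ln \<rho>\<close> occurs
    \<open>5 * 8 + 5 * 14 + 14 + 14 = 138\<close> times.\<close>
  define stuff where "stuff \<rho> = 6 * ln (real K) + 5 * ln 1000000000000 + ln 144 + ln 4 + 138 * ln \<rho>" for \<rho> :: real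
  have "((\<lambda>x::real. ln x / x) \<longlongrightarrow> 0) at_top" by (rule ln_x_over_x_tendsto_0)
  then have "eventually (\<lambda>x::real. ln x / x < 1/276) at_top" by (rule order_tendstoD) simp
  then have "eventually (\<lambda>x. stuff x \<le> x) at_top"
    using eventually_ge_at_top[of "max 1 (2 * (6 * ln (real K) + 5 * ln 1000000000000 + ln 144 + ln 4))"]
  proof eventually_elim
    case (elim x)
    then have "138 * ln x \<le> x / 2" by (simp add: field_simps)
    then show ?case using elim unfolding stuff_def by simp
  qed
  then obtain \<rho>1 where \<rho>1: "\<And>x. \<rho>1 \<le> x \<Longrightarrow> stuff x \<le> x" unfolding eventually_at_top_linorder by blast
  define \<rho>0 where "\<rho>0 = max \<rho>1 100000000000000000000"
  have "card A < 3 * real N * exp (- \<rho>\<^sup>2)"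
    if \<rho>: "\<rho>0 \<le> \<rho>" and N: "1 \<le> N" and A: "A \<subseteq> {1..int N}" and lnN: "600000000000000000 * \<rho> ^ 12 < ln (real N)"
      and nosol: "\<forall>xs c. length xs = K \<longrightarrow> set xs \<subseteq> A \<longrightarrow> c \<in> A \<longrightarrow> sum_list xs = int K * c \<longrightarrow> (\<forall>y\<in>set xs. y = c)"
    for \<rho> N A
  proof (rule ccontr)
    assume "\<not> card A < 3 * real N * exp (- \<rho>\<^sup>2)"
    then have dense0: "exp (- \<rho>\<^sup>2) \<le> card A / (3 * real N)" using N by (simp add: field_simps)
    have \<rho>big: "100000000000000000000 \<le> \<rho>" and \<rho>stuff: "stuff \<rho> \<le> \<rho>" using \<rho> \<rho>1 by (auto simp: \<rho>0_def)
    then have \<rho>_ge1: "1 \<le> \<rho>" by linarith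
    have \<rho>p: "1 \<le> \<rho> ^ j" for j using \<rho>_ge1 by (rule one_le_power)
    have \<rho>m: "\<rho> ^ i \<le> \<rho> ^ j" if "i \<le> j" for i j using \<rho>_ge1 that by (rule power_increasing[rotated])
    have big: "100000000000000000000 * \<rho> ^ j \<le> \<rho> ^ Suc j" for j
      using \<rho>big \<rho>p[of j] by (simp add: mult_right_mono)
    \<comment> \<open>The budget is a constant times \<open>\<rho> ^ 12\<close>; one more power of
      \<open>\<rho>\<close> absorbs the constant, which is below the \<open>10 ^ 20\<close> built
      into \<open>\<rho>0\<close>.\<close>
    define M where "M = nat \<lceil>\<rho> ^ 13\<rceil>"
    define g where "g = 1 / (1000000000000 * \<rho> ^ 8 * K * M)"
    define c1 where "c1 = 121 * \<rho>\<^sup>2"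
    define c2 where "c2 = 121 * \<rho>"
    \<comment> \<open>For rank the first kind is decisive: a gain of \<open>\<rho>\<close> pays for
      \<open>\<rho> ^ 8\<close>. For size both kinds are: a gain of \<open>\<rho>\<close> pays for
      \<open>\<rho> ^ 11\<close>, and a gain of \<open>1/101\<close> for
      \<open>\<rho> ^ 10\<close>.\<close>
    define E1 where "E1 = 30000000000000 * \<rho> ^ 7"
    define E2 where "E2 = 500000000000000000 * \<rho> ^ 10"
    have M_ge: "\<rho> ^ 13 \<le> M" unfolding M_def by (rule real_nat_ceiling_ge)
    have M_le: "M \<le> \<rho> ^ 14"
    proof -
      have "real M \<le> \<rho> ^ 13 + 1" using \<rho>p[of 13] unfolding M_def by linarith
      also have "\<dots> \<le> \<rho> ^ 14" using big[of 13] \<rho>p[of 13] by simp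
      finally show ?thesis .
    qed
    have M1: "1 \<le> real M" using M_ge \<rho>p[of 13] by linarith
    then have M0: "0 < M" by simp
    have K1: "9 \<le> real K" using K by simp
    have lnM: "ln M \<le> 14 * ln \<rho>"
      using ln_mono[OF M_le] M1 \<rho>_ge1 by (simp add: ln_realpow)
    have g0: "0 < g" "g * (1000000000000 * \<rho> ^ 8 * K * M) \<le> 1"
      using M1 K1 \<rho>_ge1 by (auto simp: g_def)
    have lng: "ln (1 / g) = ln 1000000000000 + 8 * ln \<rho> + ln K + ln M"
      using M1 K1 \<rho>_ge1 by (simp add: g_def ln_mult ln_realpow)
    have small: "ln K + 5 * ln (1 / g) + ln (144 * real M) + ln (4 * real M) \<le> \<rho>"
    proof -
      have "ln (144 * real M) = ln 144 + ln M" "ln (4 * real M) = ln 4 + ln M" using M1 by (simp_all add: ln_mult)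
      moreover have "a + 5 * (b + 8 * r + a + u) + (v + u) + (w + u) \<le> \<rho>"
        if "u \<le> 14 * r" "6 * a + 5 * b + v + w + 138 * r \<le> \<rho>" for a b r u v w :: real
        using that by argo
      ultimately show ?thesis
        using lnM \<rho>stuff unfolding lng stuff_def by simp
    qed
    have nn: "0 \<le> ln (real K)" "0 \<le> ln (144 * real M)" "0 \<le> ln (4 * real M)"
      by (rule ln_ge_zero, use K1 M1 in linarith)+
    have \<rho>2: "\<rho> \<le> \<rho>\<^sup>2" using \<rho>m[of 1 2] by simp
    have c1: "ln K + 5 * ln (1 / g) + ln (144 * real M) + ln (4 * real M) + 120 * \<rho>\<^sup>2 \<le> c1"
      using small \<rho>2 unfolding c1_def by linarith
    have c2: "ln K + 5 * ln (1 / g) + ln (144 * real M) + ln (4 * real M) + 120 * \<rho> \<le> c2" "c2 \<le> c1"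
      using small \<rho>2 unfolding c1_def c2_def by linarith+
    have small2: "5 * ln (1 / g) + ln K \<le> \<rho>" using small nn by linarith
    have e101: "exp (1/101) \<le> (101/100 :: real)"
    proof -
      have "1 / 101 \<le> ln (101/100 :: real)" using ln_le_minus_one[of "100/101 :: real"] by (simp add: ln_div)
      then have "exp (1/101) \<le> exp (ln (101/100 :: real))" by (simp only: exp_le_cancel_iff)
      then show ?thesis by simp
    qed
    \<comment> \<open>Each step raises \<open>u\<close> by at least \<open>1/101\<close>, because
      \<open>exp (1/101) \<le> 101/100\<close>. The claim is made for every \<open>j\<close>, and a
      \<open>j\<close> beyond \<open>101 * \<rho>\<^sup>2\<close> gives the contradiction.\<close>
    have state: "\<exists>B d w u. real j / 101 \<le> u \<and> bsys N d w B \<and> 0 \<le> d \<and> dense_in A (B 1) (exp (u - \<rho>\<^sup>2)) \<and>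
        d \<le> 1 + u * E1 \<and> ln N - u * E2 \<le> w" for j :: nat
    proof (induction j)
      case 0
      have "dense_in A {x. \<bar>real_of_int x\<bar> \<le> 1 * real N} (exp (0 - \<rho>\<^sup>2))"
        using dense_in_mono[OF dense_in_interval[OF A N] order_refl] dense0 by simp
      moreover have "bsys N 1 (ln (real N)) (\<lambda>s. {x. \<bar>real_of_int x\<bar> \<le> s * N})"
        using N by (intro bsys_interval) simp
      ultimately show ?case
        by (intro exI[of _ "\<lambda>s. {x. \<bar>real_of_int x\<bar> \<le> s * real N}"] exI[of _ 1] exI[of _ "ln (real N)"] exI[of _ 0]) simp
    next
      case (Suc j)
      then obtain B d w u where u: "real j / 101 \<le> u" and B: "bsys N d w B" and d: "0 \<le> d" "d \<le> 1 + u * E1"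
        and dense: "dense_in A (B 1) (exp (u - \<rho>\<^sup>2))" and w: "ln N - u * E2 \<le> w"
        by blast
      have u0: "0 \<le> u" using u by (rule order_trans[rotated]) simp
      have "B 1 \<noteq> {}" using bsys_0[OF B, of 1] by auto
      then have "exp (u - \<rho>\<^sup>2) \<le> 1" by (rule dense_in_le_1[OF dense])
      then have u2: "u \<le> \<rho>\<^sup>2" by simp
      have "u * E1 \<le> \<rho>\<^sup>2 * E1" using u2 \<rho>_ge1 by (intro mult_right_mono) (auto simp: E1_def)
      also have "\<dots> = 30000000000000 * \<rho> ^ 9" by (simp add: E1_def power_numeral_reduce power2_eq_square)
      finally have dD: "d + 200000000000 * \<rho> ^ 8 \<le> 40000000000000 * \<rho> ^ 9"
        using d(2) big[of 8] \<rho>p[of 8] by simp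
      have dD2: "d + 200000000000 * \<rho> ^ 4 \<le> 40000000000000 * \<rho> ^ 9"
        using dD \<rho>m[of 4 8] by linarith
      have "u * E2 \<le> \<rho>\<^sup>2 * E2" using u2 \<rho>_ge1 by (intro mult_right_mono) (auto simp: E2_def)
      also have "\<dots> = 500000000000000000 * \<rho> ^ 12" by (simp add: E2_def power_numeral_reduce power2_eq_square)
      finally have wE: "ln N - w \<le> 500000000000000000 * \<rho> ^ 12" using w by linarith
      have D1: "(d + 200000000000 * \<rho> ^ 8) * c1 \<le> 4840000000000000 * \<rho> ^ 11"
      proof -
        have "(d + 200000000000 * \<rho> ^ 8) * c1 \<le> (40000000000000 * \<rho> ^ 9) * c1"
          using dD \<rho>_ge1 by (intro mult_right_mono) (auto simp: c1_def)
        also have "\<dots> = 4840000000000000 * \<rho> ^ 11" by (simp add: c1_def power_numeral_reduce power2_eq_square)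
        finally show ?thesis .
      qed
      have D2: "(d + 200000000000 * \<rho> ^ 4) * c2 \<le> 4840000000000000 * \<rho> ^ 10"
      proof -
        have "(d + 200000000000 * \<rho> ^ 4) * c2 \<le> (40000000000000 * \<rho> ^ 9) * c2"
          using dD2 \<rho>_ge1 by (intro mult_right_mono) (auto simp: c2_def)
        also have "\<dots> = 4840000000000000 * \<rho> ^ 10" by (simp add: c2_def power_numeral_reduce)
        finally show ?thesis .
      qed
      have budget: "101 * (ln (5 * real N) - w + (d + 200000000000 * \<rho> ^ 8) * c1) \<le> M"
      proof -
        have "ln (5 * real N) = ln 5 + ln N" using N by (simp add: ln_mult)
        moreover have "ln (5::real) \<le> 4" using ln_le_minus_one[of "5::real"] by simp
        ultimately have "ln (5 * real N) - w \<le> 4 + 500000000000000000 * \<rho> ^ 12" using wE by linarith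
        then have "101 * (ln (5 * real N) - w + (d + 200000000000 * \<rho> ^ 8) * c1)
          \<le> 101 * (4 + 500000000000000000 * \<rho> ^ 12 + 4840000000000000 * \<rho> ^ 11)"
          by (intro mult_left_mono add_mono D1) simp_all
        also have "\<dots> \<le> 100000000000000000000 * \<rho> ^ 12"
          using \<rho>p[of 12] \<rho>m[of 11 12] by simp
        also have "\<dots> \<le> \<rho> ^ 13" using big[of 12] by simp
        finally show ?thesis using M_ge by linarith
      qed
      have bigH: "6 * \<rho>\<^sup>2 \<le> w + d * (5 * ln g - ln K)"
      proof -
        have "ln (1 / g) = - ln g" using g0 by (simp add: ln_div)
        then have "- (d * (5 * ln g - ln K)) = d * (5 * ln (1 / g) + ln K)" by (simp add: algebra_simps)
        also have "\<dots> \<le> d * \<rho>" using small2 d(1) by (rule mult_left_mono)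
        also have "\<dots> \<le> (40000000000000 * \<rho> ^ 9) * \<rho>"
        proof (rule mult_right_mono)
          show "d \<le> 40000000000000 * \<rho> ^ 9" using dD \<rho>p[of 8] by linarith
        qed (use \<rho>_ge1 in simp)
        also have "\<dots> = 40000000000000 * \<rho> ^ 10" by (simp add: power_numeral_reduce)
        finally have "- (d * (5 * ln g - ln K)) \<le> 40000000000000 * \<rho> ^ 10" .
        moreover have "\<rho> ^ 10 \<le> \<rho> ^ 12" "\<rho> ^ 2 \<le> \<rho> ^ 12" by (rule \<rho>m, simp)+
        moreover define X where "X = d * (5 * ln g - ln K)"
        ultimately have "6 * \<rho>\<^sup>2 \<le> w + X" using wE lnN \<rho>p[of 12] by linarith
        then show ?thesis by (simp only: X_def)
      qed
      have \<alpha>: "exp (- \<rho>\<^sup>2) \<le> exp (u - \<rho>\<^sup>2)" using u0 by simp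
      have N1: "1 \<le> real N" using N by simp
      from increment_step[OF B N1 d(1) dense \<alpha> \<rho>_ge1 K M0 g0 c1 c2 budget bigH] nosol
      have "\<exists>B' d' w' \<alpha>'. bsys N d' w' B' \<and> 0 \<le> d' \<and> dense_in A (B' 1) \<alpha>' \<and>
         (exp \<rho> * exp (u - \<rho>\<^sup>2) \<le> \<alpha>' \<and> d' \<le> d + 200000000000 * \<rho> ^ 8 \<and> w - (d + 200000000000 * \<rho> ^ 8) * c1 \<le> w' \<or>
          (101/100) * exp (u - \<rho>\<^sup>2) \<le> \<alpha>' \<and> d' \<le> d + 200000000000 * \<rho> ^ 4 \<and> w - (d + 200000000000 * \<rho> ^ 4) * c2 \<le> w')"
        by blast
      then obtain B' d' w' \<alpha>' where B': "bsys N d' w' B'" "0 \<le> d'" "dense_in A (B' 1) \<alpha>'"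
        and alt: "exp \<rho> * exp (u - \<rho>\<^sup>2) \<le> \<alpha>' \<and> d' \<le> d + 200000000000 * \<rho> ^ 8 \<and> w - (d + 200000000000 * \<rho> ^ 8) * c1 \<le> w' \<or>
          (101/100) * exp (u - \<rho>\<^sup>2) \<le> \<alpha>' \<and> d' \<le> d + 200000000000 * \<rho> ^ 4 \<and> w - (d + 200000000000 * \<rho> ^ 4) * c2 \<le> w'"
        by (elim exE conjE) (rule that)
      have "\<exists>u'. real (Suc j) / 101 \<le> u' \<and> exp (u' - \<rho>\<^sup>2) \<le> \<alpha>' \<and> d' \<le> 1 + u' * E1 \<and> ln N - u' * E2 \<le> w'"
        using alt
      proof
        assume *: "exp \<rho> * exp (u - \<rho>\<^sup>2) \<le> \<alpha>' \<and> d' \<le> d + 200000000000 * \<rho> ^ 8 \<and> w - (d + 200000000000 * \<rho> ^ 8) * c1 \<le> w'"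
        show ?thesis
        proof (rule exI[of _ "u + \<rho>"], intro conjI)
          show "real (Suc j) / 101 \<le> u + \<rho>" using u \<rho>_ge1 by (simp add: add_divide_distrib)
          show "exp (u + \<rho> - \<rho>\<^sup>2) \<le> \<alpha>'" using * by (simp add: exp_add[symmetric] algebra_simps)
          have "\<rho> * E1 = 30000000000000 * \<rho> ^ 8" by (simp add: E1_def power_numeral_reduce)
          then show "d' \<le> 1 + (u + \<rho>) * E1" using * d(2) \<rho>p[of 8] by (simp add: distrib_right)
          have "\<rho> * E2 = 500000000000000000 * \<rho> ^ 11" by (simp add: E2_def power_numeral_reduce)
          then show "ln N - (u + \<rho>) * E2 \<le> w'" using * w D1 \<rho>p[of 11] by (simp add: distrib_right)
        qed
      next
        assume *: "(101/100) * exp (u - \<rho>\<^sup>2) \<le> \<alpha>' \<and> d' \<le> d + 200000000000 * \<rho> ^ 4 \<and> w - (d + 200000000000 * \<rho> ^ 4) * c2 \<le> w'"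
        show ?thesis
        proof (rule exI[of _ "u + 1/101"], intro conjI)
          show "real (Suc j) / 101 \<le> u + 1/101" using u by (simp add: add_divide_distrib)
          have "exp (u + 1/101 - \<rho>\<^sup>2) = exp (1/101) * exp (u - \<rho>\<^sup>2)" by (simp add: exp_add[symmetric] algebra_simps)
          also have "\<dots> \<le> (101/100) * exp (u - \<rho>\<^sup>2)" using e101 by (intro mult_right_mono) auto
          finally show "exp (u + 1/101 - \<rho>\<^sup>2) \<le> \<alpha>'" using * by linarith
          have "200000000000 * \<rho> ^ 4 \<le> (1/101) * E1" using \<rho>m[of 4 7] \<rho>p[of 7] unfolding E1_def by linarith
          then show "d' \<le> 1 + (u + 1/101) * E1" using * d(2) by (simp add: distrib_right)
          have "4840000000000000 * \<rho> ^ 10 \<le> (1/101) * E2" using \<rho>p[of 10] unfolding E2_def by linarith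
          then show "ln N - (u + 1/101) * E2 \<le> w'" using * w D2 by (simp add: distrib_right)
        qed
      qed
      then obtain u' where u': "real (Suc j) / 101 \<le> u'" "exp (u' - \<rho>\<^sup>2) \<le> \<alpha>'" "d' \<le> 1 + u' * E1" "ln N - u' * E2 \<le> w'"
        by blast
      have "dense_in A (B' 1) (exp (u' - \<rho>\<^sup>2))" by (rule dense_in_mono[OF B'(3) order_refl u'(2)])
      then show ?case using B'(1,2) u'(1,3,4) by blast
    qed
    obtain j :: nat where j: "101 * \<rho>\<^sup>2 < j" using reals_Archimedean2 by blast
    obtain B d w u where *: "real j / 101 \<le> u" "bsys N d w B" "dense_in A (B 1) (exp (u - \<rho>\<^sup>2))"
      using state[of j] by blast
    have "B 1 \<noteq> {}" using bsys_0[OF *(2), of 1] by auto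
    then have "exp (u - \<rho>\<^sup>2) \<le> 1" by (rule dense_in_le_1[OF *(3)])
    then show False using *(1) j by simp
  qed
  then show ?thesis by (intro exI[of _ \<rho>0]) blast
qed

section \<open>Passage to natural numbers and the final choice of parameters\<close>

lemma no_nontrivial_solutions_int:
  assumes A: "no_nontrivial_solutions k A" and k: "2 \<le> k"
    and xs: "length xs = k - 1" "set xs \<subseteq> int ` A" "c \<in> int ` A" "sum_list xs = int (k - 1) * c"
  shows "\<forall>y\<in>set xs. y = c"
proof -
  define x where "x i = (if i = k then nat c else nat (xs ! (i - 1)))" for i
  have nth: "xs ! i \<in> int ` A" if "i < k - 1" for i
    by (rule subsetD[OF xs(2) nth_mem]) (use xs(1) that in simp)
  have "is_solution k A x"
    unfolding is_solution_def
  proof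
    show "\<forall>i\<in>{1..k}. x i \<in> A"
    proof
      fix i assume i: "i \<in> {1..k}"
      show "x i \<in> A"
      proof (cases "i = k")
        case False
        then have "i - 1 < k - 1" using i by auto
        then show ?thesis using nth[of "i - 1"] False by (auto simp: x_def)
      qed (use xs(3) in \<open>auto simp: x_def\<close>)
    qed
    have "int (\<Sum>i=1..k-1. x i) = (\<Sum>i=1..k-1. xs ! (i - 1))"
      unfolding of_nat_sum
    proof (rule sum.cong[OF refl])
      fix i assume i: "i \<in> {1..k-1}"
      then have "i - 1 < k - 1" "i \<noteq> k" using k by auto
      then show "int (x i) = xs ! (i - 1)" using nth[of "i - 1"] by (auto simp: x_def)
    qed
    also have "\<dots> = (\<Sum>i<k-1. xs ! i)"
      by (simp add: sum.atLeast1_atMost_eq)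
    also have "\<dots> = sum_list xs" using xs(1) by (simp add: sum_list_sum_nth atLeast0LessThan)
    also have "\<dots> = int ((k - 1) * x k)" using xs(3,4) by (auto simp: x_def)
    finally show "(\<Sum>i=1..k-1. x i) = (k - 1) * x k" by (simp only: of_nat_eq_iff)
  qed
  then have "trivial_solution k x" using A by (simp add: no_nontrivial_solutions_def)
  then have all: "\<forall>i\<in>{1..k}. \<forall>j\<in>{1..k}. x i = x j" by (simp only: trivial_solution_def)
  have triv: "x i = x k" if "i \<in> {1..k}" for i
    by (rule all[THEN bspec, OF that, THEN bspec]) (use k in simp)
  show ?thesis
  proof
    fix y assume "y \<in> set xs"
    then obtain i where "i < length xs" "xs ! i = y" unfolding in_set_conv_nth by blast
    then have i: "i < k - 1" "y = xs ! i" using xs(1) by simp_all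
    then have "x (Suc i) = x k" "Suc i \<noteq> k" using triv[of "Suc i"] by auto
    then have "nat (xs ! i) = nat c" by (simp add: x_def)
    then show "y = c" using nth[OF i(1)] xs(3) i(2) by auto
  qed
qed

theorem theorem1:
  fixes m k :: nat
  assumes "m \<ge> 1" and "k \<ge> 2 * 3 ^ (m + 1) + 2"
  shows "\<exists>c>0. \<exists>N0. \<forall>N\<ge>N0. \<forall>A. A \<subseteq> {1..N} \<and> no_nontrivial_solutions k A \<longrightarrow>
           real (card A) \<le> exp (- c * ln (real N) powr (1 / (6 + (2::real) powr (1 - real m)))) * real N"
proof -
  define \<gamma> where "\<gamma> = (2::real) powr (1 - real m)"
  have \<gamma>: "0 < \<gamma>" by (simp add: \<gamma>_def)
  have "(3::nat) ^ 2 \<le> 3 ^ (m + 1)" using assms(1) by (intro power_increasing) auto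
  then have k: "9 \<le> k - 1" "2 \<le> k" using assms(2) by auto
  obtain \<rho>0 where bound: "\<forall>\<rho>\<ge>\<rho>0. \<forall>N A. 1 \<le> N \<longrightarrow> A \<subseteq> {1..int N} \<longrightarrow>
     (\<forall>xs c. length xs = k - 1 \<longrightarrow> set xs \<subseteq> A \<longrightarrow> c \<in> A \<longrightarrow> sum_list xs = int (k - 1) * c \<longrightarrow> (\<forall>y\<in>set xs. y = c)) \<longrightarrow>
     600000000000000000 * \<rho> ^ 12 < ln (real N) \<longrightarrow> card A < 3 * real N * exp (- \<rho>\<^sup>2)"
    using no_solution_card_bound[OF k(1)] by blast
  \<comment> \<open>The positive \<open>\<gamma>\<close> absorbs all constants:
    \<open>729 = 3 ^ 6\<close> comes from \<open>y + 2 \<le> 3 * y\<close>, and for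
    \<open>y \<ge> Y\<close> one has \<open>y powr \<gamma> \<ge> C\<close>. Thus the constant in
    the exponent can be 1 once \<open>N\<close> is large.\<close>
  define C where "C = 600000000000000000 * 729 + (1::real)"
  define Y where "Y = max (max 1 (\<rho>0\<^sup>2)) (C powr (1 / \<gamma>))"
  define N0 where "N0 = nat \<lceil>exp (Y powr (6 + \<gamma>))\<rceil>"
  have "real (card A) \<le> exp (- 1 * ln (real N) powr (1 / (6 + \<gamma>))) * real N"
    if N: "N0 \<le> N" and A: "A \<subseteq> {1..N}" "no_nontrivial_solutions k A" for N A
  proof -
    have Y1: "1 \<le> Y" "\<rho>0\<^sup>2 \<le> Y" "C powr (1 / \<gamma>) \<le> Y" by (auto simp: Y_def)
    have "exp (Y powr (6 + \<gamma>)) \<le> real N0" unfolding N0_def by (rule real_nat_ceiling_ge)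
    then have expN: "exp (Y powr (6 + \<gamma>)) \<le> real N" using N by (meson of_nat_mono order_trans)
    then have N0: "0 < real N" using exp_gt_zero less_le_trans by blast
    then have N1: "1 \<le> N" by simp
    have lnN: "Y powr (6 + \<gamma>) \<le> ln N" using expN N0 by (simp add: ln_ge_iff)
    have "1 \<le> Y powr (6 + \<gamma>)" using Y1 \<gamma> by (simp add: ge_one_powr_ge_zero)
    then have x1: "1 \<le> ln (real N)" using lnN by linarith
    define y where "y = ln (real N) powr (1 / (6 + \<gamma>))"
    have "(Y powr (6 + \<gamma>)) powr (1 / (6 + \<gamma>)) \<le> y"
      unfolding y_def using lnN \<gamma> by (intro powr_mono2) auto
    then have yY: "Y \<le> y" using Y1 \<gamma> by (simp add: powr_powr)
    then have y1: "1 \<le> y" using Y1 by linarith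
    have yx: "y powr (6 + \<gamma>) = ln N" using x1 \<gamma> by (simp add: y_def powr_powr)
    \<comment> \<open>The summand 2 yields a factor \<open>exp (- 2)\<close>, which cancels the 3 in
      the bound \<open>3 * N * exp (- \<rho>\<^sup>2)\<close>.\<close>
    define \<rho> where "\<rho> = sqrt (y + 2)"
    have \<rho>2: "\<rho>\<^sup>2 = y + 2" using y1 by (simp add: \<rho>_def)
    have "\<bar>\<rho>0\<bar> \<le> \<rho>" unfolding \<rho>_def using Y1(2) yY by (intro real_le_rsqrt) simp
    then have \<rho>: "\<rho>0 \<le> \<rho>" by linarith
    have "600000000000000000 * \<rho> ^ 12 < ln (real N)"
    proof -
      have "\<rho> ^ 12 = (y + 2) ^ 6" using power_mult[of \<rho> 2 6] \<rho>2 by simp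
      also have "\<dots> \<le> (3 * y) ^ 6" using y1 by (intro power_mono) auto
      also have "\<dots> = 729 * y ^ 6" by (simp add: power_mult_distrib)
      finally have "600000000000000000 * \<rho> ^ 12 \<le> (600000000000000000 * 729) * y ^ 6" by simp
      also have "\<dots> < C * y ^ 6" using y1 unfolding C_def by (intro mult_strict_right_mono) auto
      also have "\<dots> \<le> y powr \<gamma> * y ^ 6"
      proof (rule mult_right_mono)
        have "(C powr (1 / \<gamma>)) powr \<gamma> \<le> y powr \<gamma>"
          using Y1(3) yY \<gamma> by (intro powr_mono2) auto
        then show "C \<le> y powr \<gamma>" using \<gamma> by (simp add: powr_powr C_def)
      qed (use y1 in simp)
      also have "\<dots> = y powr (6 + \<gamma>)"
        using y1 by (simp add: powr_add)
      finally show ?thesis by (simp only: yx)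
    qed
    then have "card (int ` A) < 3 * real N * exp (- \<rho>\<^sup>2)"
    proof (rule bound[rule_format, OF \<rho> N1, rotated 2])
      show "int ` A \<subseteq> {1..int N}" using A(1) by force
      fix xs c y
      assume "length xs = k - 1" "set xs \<subseteq> int ` A" "c \<in> int ` A" "sum_list xs = int (k - 1) * c" "y \<in> set xs"
      then show "y = c" using no_nontrivial_solutions_int[OF A(2) k(2), of xs c] by blast
    qed
    moreover have "exp (- \<rho>\<^sup>2) = exp (- 2) * exp (- y)"
      unfolding \<rho>2 exp_add[symmetric] by simp
    ultimately have "card A \<le> 3 * exp (- 2) * exp (- y) * real N"
      by (simp add: card_image mult_ac)
    also have "\<dots> \<le> 1 * exp (- y) * real N"
    proof (intro mult_right_mono)
      have "3 \<le> exp (2::real)" using exp_ge_add_one_self[of 2] by simp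
      then show "3 * exp (- 2) \<le> (1::real)" by (simp add: exp_minus field_simps)
    qed auto
    finally show ?thesis by (simp add: y_def)
  qed
  then have "\<forall>N\<ge>N0. \<forall>A. A \<subseteq> {1..N} \<and> no_nontrivial_solutions k A \<longrightarrow>
      real (card A) \<le> exp (- 1 * ln (real N) powr (1 / (6 + \<gamma>))) * real N" by blast
  then show ?thesis unfolding \<gamma>_def by (intro exI[of _ 1] conjI exI[of _ N0]) simp_all
qed

end
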